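(* Let $f(x)=ax^2+bx+c$ be a polynomial of degree two with integer coefficients, where $a\ge 1$, let $D=b^2-4ac$ be its discriminant, and let $k$ be a positive integer. Let $g_{k,f}$ be the function defined in the context. Then $g_{k,f}$ is eventually periodic if and only if $D\neq a^2i^2$ for all integers $i$ with $1\le i\le k$. If $g_{k,f}$ is eventually periodic, then its smallest period is equal to $A_k$ (the number defined in the context in terms of $k,a,b,D$), except that $\nu_p(k+1)\ge \nu_p(A_k)\ge 1$ for at most one odd prime $p$ such that either $p\mid a$ and $p\nmid b$, or $p\nmid 2aD$ and $\left(\frac{D}{p}\right)=1$, in which case its smallest period equals $A_k/p^{\nu_p(A_k)}$.
   Context: $\mathbb{N}^*$ is the set of positive integers. Let $Z_{k,f}=\bigcup_{i=0}^k\{n\in\mathbb{N}^*: f(n+i)=0\}$ (a finite set). For $n\in\mathbb{N}^*\setminus Z_{k,f}$ define $$g_{k,f}(n)=\frac{\prod_{i=0}^k|f(n+i)|}{\mathrm{lcm}_{0\le i\le k}\{f(n+i)\}},$$ where the lcm is taken to be positive. The function $g_{k,f}$ is eventually periodic if there are positive integers $t$ and $n_0$ such that $g_{k,f}(n+t)=g_{k,f}(n)$ for all integers $n\ge n_0$; such a $t$ is a period, and the smallest period is the least such $t$. $\nu_p$ is the normalized $p$-adic valuation, with the usual convention $\nu_p(0)=+\infty$ (so if $D=0$, every inequality of the form $k<p^{\lceil \nu_p(D)/2\rceil}$ or $k<2^{\lfloor \nu_2(D)/2\rfloor}$ is regarded as true). $\left(\frac{\cdot}{p}\right)$ is the Legendre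 symbol. For $D\ne 0$ put $D_4=D/4^{\lfloor \nu_2(D)/2\rfloor}$ and, for an odd prime $p$, $D_p=D/p^{\nu_p(D)}$. Put $L_k=\mathrm{lcm}(1,2,\dots,k)$ and $B_k=\mathrm{lcm}_{1\le i\le k}\{i(a^2i^2-D)\}$ (taken positive). Define $$A_k=\frac{B_k}{\xi_2\Big(\prod_{p\ne2,\ p\mid\gcd(a,b)}p^{\nu_p(B_k)}\Big)\Big(\prod_{p\nmid 2aD,\ (\frac{D}{p})=-1}p^{\nu_p(B_k)}\Big)\Big(\prod_{p\nmid 2a,\ p\mid D}\eta_p\Big)},$$ the products being over primes $p$ (only finitely many factors differ from 1), where $\xi_2$ is: - $1$, if $2\mid a$, $2\nmid b$ and $\nu_2(k+1)<\nu_2(B_k)$; - $2^{2\nu_2(L_k)}$, if $2\nmid a$, $k<2^{\lfloor \nu_2(D)/2\rfloor}$ and $\nu_2(k+1)<\nu_2(L_k)$; - $2^{\nu_2(B_k)-\lfloor \nu_2(D)/2\rfloor}$, if $2\nmid a$, $k\ge 2^{\lfloor \nu_2(D)/2\rfloor}$, $D_4\not\equiv1\pmod 8$ and $\nu_2(k+1)<\lfloor \nu_2(D)/2\rfloor$; - $2^{\nu_2(D)+1}$, if $2\nmid a$, $k\ge 2^{\lfloor \nu_2(D)/2\rfloor}$ and $D_4\equiv1\pmod 8$; - $2^{\nu_2(B_k)}$, otherwise; and $\eta_p$ is: - $p^{2\nu_p(L_k)}$, if $k<p^{\lceil \nu_p(D)/2\rceil}$ and $\nu_p(k+1)<\nu_p(L_k)$;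 - $p^{\nu_p(B_k)-\lceil \nu_p(D)/2\rceil}$, if $k\ge p^{\lceil \nu_p(D)/2\rceil}$, $\nu_p(k+1)<\lceil \nu_p(D)/2\rceil$, and either $2\nmid\nu_p(D)$ or $\left(\frac{D_p}{p}\right)=-1$; - $p^{\nu_p(D)}$, if $k\ge p^{\lceil \nu_p(D)/2\rceil}$, $\nu_p(k+1)<\nu_p(B_k)-\nu_p(D)$, $2\mid\nu_p(D)$ and $\left(\frac{D_p}{p}\right)=1$; - $p^{\nu_p(B_k)}$, otherwise.
   Formalization: A_k and the exceptional-prime condition are evaluated at a/d, b/d, D/d² with d = gcd(a,b,c), since the formula as stated fails for non-primitive f (f = 2x²+2, k = 2 gives A_k = 5, but the smallest period is 10); for d = 1 nothing changes. *)

theory Defs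
  imports
    "HOL-Library.Groups_Big_Fun"
    "HOL-Computational_Algebra.Computational_Algebra"
    "HOL-Number_Theory.Number_Theory"
begin

section \<open>The function \<open>g\<close> and its periods\<close>

definition zero_set :: "nat \<Rightarrow> int poly \<Rightarrow> nat set" where
  "zero_set k f = (\<Union>i\<in>{0..k}. {n. n \<ge> 1 \<and> poly f (int (n + i)) = 0})"

text \<open>Only the values at positive \<open>n \<notin> zero_set k f\<close> are meaningful. Note that \<open>Lcm\<close> on integers
  is nonnegative.\<close>

definition g_fun :: "nat \<Rightarrow> int poly \<Rightarrow> nat \<Rightarrow> rat" where
  "g_fun k f n =
     of_int (\<Prod>i\<in>{0..k}. \<bar>poly f (int (n + i))\<bar>) / of_int (LCM i\<in>{0..k}. poly f (int (n + i)))"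

text \<open>As \<open>g_fun k f\<close> is a partial function, an eventual period has to be witnessed beyond the zero
  set, which is finite for nonzero \<open>f\<close>.\<close>

definition is_period :: "nat \<Rightarrow> int poly \<Rightarrow> nat \<Rightarrow> bool" where
  "is_period k f t \<longleftrightarrow> t \<ge> 1 \<and>
     (\<exists>n0\<ge>1. \<forall>n\<ge>n0. n \<notin> zero_set k f \<and> n + t \<notin> zero_set k f \<and> g_fun k f (n + t) = g_fun k f n)"

definition eventually_periodic :: "nat \<Rightarrow> int poly \<Rightarrow> bool" where
  "eventually_periodic k f \<longleftrightarrow> (\<exists>t. is_period k f t)"

definition smallest_period :: "nat \<Rightarrow> int poly \<Rightarrow> nat" where
  "smallest_period k f = (LEAST t. is_period k f t)"


section \<open>The arithmetic data\<close>

abbreviation nu :: "nat \<Rightarrow> int \<Rightarrow> nat" where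
  "nu p x \<equiv> multiplicity (int p) x"

definition nu_rat :: "nat \<Rightarrow> rat \<Rightarrow> int" where
  "nu_rat p q = int (nu p (fst (quotient_of q))) - int (nu p (snd (quotient_of q)))"

definition L_num :: "nat \<Rightarrow> int" where
  "L_num k = (LCM i\<in>{1..k}. int i)"

definition B_num :: "nat \<Rightarrow> int \<Rightarrow> int \<Rightarrow> int" where
  "B_num k a D = (LCM i\<in>{1..k}. int i * (a\<^sup>2 * (int i)\<^sup>2 - D))"

text \<open>The library has \<open>multiplicity p 0 = 0\<close>, whereas here \<open>D = 0\<close> has infinite valuation. The next
  two predicates therefore treat \<open>D = 0\<close> separately; wherever else the valuation of \<open>D\<close> occurs
  below, the negation of one of them is assumed. For natural \<open>m\<close>, \<open>\<lfloor>m/2\<rfloor>\<close> is \<open>m div 2\<close>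
  and \<open>\<lceil>m/2\<rceil>\<close> is \<open>(m + 1) div 2\<close>.\<close>

definition below2 :: "nat \<Rightarrow> int \<Rightarrow> bool" where
  "below2 k D \<longleftrightarrow> D = 0 \<or> k < 2 ^ (nu 2 D div 2)"

definition below_odd :: "nat \<Rightarrow> nat \<Rightarrow> int \<Rightarrow> bool" where
  "below_odd p k D \<longleftrightarrow> D = 0 \<or> k < p ^ ((nu p D + 1) div 2)"

definition D4 :: "int \<Rightarrow> int" where
  "D4 D = D div 4 ^ (nu 2 D div 2)"

definition D_odd :: "nat \<Rightarrow> int \<Rightarrow> int" where
  "D_odd p D = D div int p ^ nu p D"

text \<open>Truncated subtraction is harmless below: if \<open>D \<noteq> 0\<close> and \<open>q = p ^ \<lceil>\<nu>/2\<rceil> \<le> k\<close>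
  (\<open>\<lfloor>\<nu>/2\<rfloor>\<close> for \<open>p = 2\<close>), where \<open>\<nu>\<close> is the valuation of \<open>D\<close>, then \<open>q\<close> divides \<open>B_num k a D\<close>.\<close>

definition xi2 :: "nat \<Rightarrow> int \<Rightarrow> int \<Rightarrow> int \<Rightarrow> nat" where
  "xi2 k a b D =
    (let vB = nu 2 (B_num k a D); vL = nu 2 (L_num k); vk = nu 2 (int k + 1) in
     if even a \<and> odd b \<and> vk < vB then 1
     else if odd a \<and> below2 k D \<and> vk < vL then 2 ^ (2 * vL)
     else if odd a \<and> \<not> below2 k D \<and> [D4 D \<noteq> 1] (mod 8) \<and> vk < nu 2 D div 2
       then 2 ^ (vB - nu 2 D div 2)
     else if odd a \<and> \<not> below2 k D \<and> [D4 D = 1] (mod 8) then 2 ^ (nu 2 D + 1)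
     else 2 ^ vB)"

definition eta :: "nat \<Rightarrow> nat \<Rightarrow> int \<Rightarrow> int \<Rightarrow> nat" where
  "eta p k a D =
    (let vB = nu p (B_num k a D); vL = nu p (L_num k); vk = nu p (int k + 1);
         vD = nu p D; h = (vD + 1) div 2 in
     if below_odd p k D \<and> vk < vL then p ^ (2 * vL)
     else if \<not> below_odd p k D \<and> vk < h \<and> (odd vD \<or> Legendre (D_odd p D) (int p) = -1)
       then p ^ (vB - h)
     else if \<not> below_odd p k D \<and> vk < vB - vD \<and> even vD \<and> Legendre (D_odd p D) (int p) = 1
       then p ^ vD
     else p ^ vB)"

text \<open>The products \<open>\<Prod>p. \<dots>\<close> are products over all \<open>p\<close> with only finitely many factors
  different from 1 (provided that \<open>B_num k a D \<noteq> 0\<close>).\<close>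

definition A_num :: "nat \<Rightarrow> int \<Rightarrow> int \<Rightarrow> int \<Rightarrow> rat" where
  "A_num k a b D =
    of_int (B_num k a D) / of_nat (
      xi2 k a b D
      * (\<Prod>p::nat. if prime p \<and> p \<noteq> 2 \<and> int p dvd gcd a b then p ^ nu p (B_num k a D) else 1)
      * (\<Prod>p::nat. if prime p \<and> \<not> int p dvd 2 * a * D \<and> Legendre D (int p) = -1
                then p ^ nu p (B_num k a D) else 1)
      * (\<Prod>p::nat. if prime p \<and> \<not> int p dvd 2 * a \<and> int p dvd D then eta p k a D else 1))"

definition exceptional_primes :: "nat \<Rightarrow> int \<Rightarrow> int \<Rightarrow> int \<Rightarrow> nat set" where
  "exceptional_primes k a b D =
    {p. prime p \<and> odd p \<and>
        int (nu p (int k + 1)) \<ge> nu_rat p (A_num k a b D) \<and> nu_rat p (A_num k a b D) \<ge> 1 \<and>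
        (int p dvd a \<and> \<not> int p dvd b \<or> \<not> int p dvd 2 * a * D \<and> Legendre D (int p) = 1)}"

text \<open>If \<open>d\<close> is the gcd of \<open>a, b, c\<close>, then \<open>g\<close> for \<open>f = a x\<^sup>2 + b x + c\<close> is \<open>d ^ k\<close> times \<open>g\<close> for
  \<open>f / d\<close>, so both have the same periods, but \<open>A_num k a b D\<close> is not invariant under dividing out
  \<open>d\<close>. It describes the periods for primitive \<open>f\<close>, i.e. \<open>d = 1\<close>. (For \<open>f = 2 x\<^sup>2 + 2\<close> and \<open>k = 2\<close>
  it is 5, while the smallest period is 10, which is the value for \<open>x\<^sup>2 + 1\<close>.) In general the
  formula is therefore to be evaluated at the coefficients and the discriminant of \<open>f / d\<close>.\<close>

end

theory Submission
  imports Defs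
begin

text \<open>Dividing \<open>f\<close> by its content only multiplies \<open>g\<close> by a constant, so let \<open>f\<close> be primitive. The
  \<open>p\<close>-adic valuation of \<open>g n\<close> is the sum over \<open>e \<ge> 1\<close> of the excess, over one, of the number of
  \<open>i \<le> k\<close> with \<open>p ^ e dvd f (n + i)\<close>. Two zeros of \<open>f\<close> modulo \<open>p ^ e\<close> at distance \<open>i \<le> k\<close> force
  \<open>p ^ e dvd i * (a\<^sup>2 * i\<^sup>2 - D)\<close>, so if none of these numbers vanishes, only finitely many pairs
  \<open>(p, e)\<close> contribute, each periodically; the smallest period of \<open>g\<close> is the product of the
  smallest periods of the valuations, which are powers of the respective primes.

  If \<open>p\<close> does not divide \<open>a\<close>, the zeros modulo \<open>p ^ e\<close> form, around a zero \<open>r\<close> where \<open>f'\<close> has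
  valuation \<open>w\<close>, the class of \<open>r\<close> modulo \<open>p ^ \<lceil>e/2\<rceil>\<close> if \<open>e \<le> 2 * w\<close>, and otherwise the classes of
  \<open>r\<close> and \<open>r - f' r / a\<close> modulo \<open>p ^ (e - w)\<close>. The largest \<open>e\<close> for which two zeros are at distance at
  most \<open>k\<close> decides the period: a window count drops only when a zero leaves the window, so a smaller
  period would fill a residue class with zeros. If the modulus of the classes divides \<open>k + 1\<close>,
  however, every window meets each class equally often, and the period is 1.

  If \<open>D = a\<^sup>2 * i\<^sup>2\<close> with \<open>1 \<le> i \<le> k\<close>, then \<open>f n\<close> and \<open>f (n + i)\<close> share a linear factor, so
  \<open>g\<close> is unbounded.\<close>

section \<open>Periods of functions on the integers\<close>

text \<open>Zero and negative \<open>t\<close> are allowed, so that the periods of \<open>h\<close>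
  form a subgroup of the integers.\<close>

definition periodic :: "(int \<Rightarrow> 'a) \<Rightarrow> int \<Rightarrow> bool" where
  "periodic h t \<longleftrightarrow> (\<forall>n. h (n + t) = h n)"

lemma periodicD: "periodic h t \<Longrightarrow> h (n + t) = h n"
  by (simp add: periodic_def)

lemma periodic_minus: "periodic h t \<Longrightarrow> periodic h (- t)"
  unfolding periodic_def
proof
  fix n assume "\<forall>n. h (n + t) = h n"
  from this[rule_format, of "n - t"] show "h (n + - t) = h n" by simp
qed

lemma periodic_mult_nat: "periodic h t \<Longrightarrow> periodic h (int m * t)"
proof (induction m)
  case (Suc m)
  have "h (n + int (Suc m) * t) = h n" for n
    using periodicD[OF Suc.prems, of "n + int m * t"] periodicD[OF Suc.IH[OF Suc.prems], of n]
    by (simp add: algebra_simps)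
  thus ?case by (simp add: periodic_def)
qed (simp add: periodic_def)

lemma periodic_mult:
  assumes "periodic h t"
  shows "periodic h (m * t)"
proof (cases "m \<ge> 0")
  case True
  thus ?thesis using periodic_mult_nat[OF assms, of "nat m"] by simp
next
  case False
  thus ?thesis using periodic_minus[OF periodic_mult_nat[OF assms, of "nat (- m)"]] by simp
qed

lemma periodic_dvd: "periodic h s \<Longrightarrow> s dvd t \<Longrightarrow> periodic h t"
  using periodic_mult[of h s] by (auto simp: dvd_def mult.commute)

lemma periodic_add: "periodic h s \<Longrightarrow> periodic h t \<Longrightarrow> periodic h (s + t)"
  by (simp add: periodic_def flip: add.assoc)

lemma periodic_gcd:
  assumes "periodic h s" "periodic h t"
  shows "periodic h (gcd s t)"
proof -
  obtain u v where "u * s + v * t = gcd s t" using bezout_int by blast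
  thus ?thesis using periodic_add[OF periodic_mult[OF assms(1)] periodic_mult[OF assms(2)], of u v]
    by simp
qed

text \<open>The group of periods is generated by \<open>p ^ e\<close>; for \<open>e = 0\<close> the
  function is constant. In this form the conditions at different primes combine by
  divisibility.\<close>

definition has_exponent :: "int \<Rightarrow> (int \<Rightarrow> 'a) \<Rightarrow> nat \<Rightarrow> bool" where
  "has_exponent p h e \<longleftrightarrow> (\<forall>t. periodic h t \<longleftrightarrow> p ^ e dvd t)"

lemma has_exponent_0: "periodic h 1 \<Longrightarrow> has_exponent p h 0"
  using periodic_dvd[of h 1] by (simp add: has_exponent_def)

text \<open>The gcd of \<open>p ^ e\<close> and any period is a period and a power of
  \<open>p\<close>; an exponent below \<open>e\<close> would make \<open>p ^ (e - 1)\<close> a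
  period.\<close>

lemma has_exponentI:
  assumes "prime p" "e \<ge> 1" "periodic h (p ^ e)" "\<not> periodic h (p ^ (e - 1))"
  shows "has_exponent p h e"
  unfolding has_exponent_def
proof (intro allI iffI)
  fix t assume t: "periodic h t"
  obtain j where j: "j \<le> e" "gcd (p ^ e) t = p ^ j"
    using divides_primepow[OF assms(1), of "gcd (p ^ e) t" e] assms(1)
    by (auto simp: normalize_power prime_ge_0_int)
  have "periodic h (p ^ j)" using periodic_gcd[OF assms(3) t] j by simp
  hence "\<not> j \<le> e - 1"
    using assms(4) periodic_dvd[of h "p ^ j" "p ^ (e - 1)"] by (auto intro: le_imp_power_dvd)
  hence "j = e" using j by simp
  thus "p ^ e dvd t" using j by (metis gcd_dvd2)
qed (rule periodic_dvd[OF assms(3)])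

section \<open>Counting points in windows\<close>

definition win_count :: "nat \<Rightarrow> int set \<Rightarrow> int \<Rightarrow> nat" where
  "win_count k R n = card {i. i \<le> k \<and> n + int i \<in> R}"

definition excess :: "nat \<Rightarrow> int set \<Rightarrow> int \<Rightarrow> nat" where
  "excess k R n = win_count k R n - 1"

definition close :: "nat \<Rightarrow> int set \<Rightarrow> bool" where
  "close k R \<longleftrightarrow> (\<exists>s i. 1 \<le> i \<and> i \<le> int k \<and> s \<in> R \<and> s + i \<in> R)"

lemma win_count_sum: "win_count k R n = (\<Sum>i\<le>k. of_bool (n + int i \<in> R))"
proof -
  have "(\<Sum>i\<le>k. of_bool (n + int i \<in> R)) = (\<Sum>i | i \<le> k \<and> n + int i \<in> R. (1::nat))"
    by (rule sum.mono_neutral_cong_right) auto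
  thus ?thesis by (simp add: win_count_def)
qed

lemma win_count_step:
  "win_count k R (n + 1) + of_bool (n \<in> R) = win_count k R n + of_bool (n + int k + 1 \<in> R)"
proof -
  have "win_count k R n + of_bool (n + int k + 1 \<in> R) = (\<Sum>i\<le>Suc k. of_bool (n + int i \<in> R))"
    by (simp add: win_count_sum add_ac)
  also have "\<dots> = of_bool (n \<in> R) + (\<Sum>i\<le>k. of_bool (n + int (Suc i) \<in> R))"
    by (subst sum.atMost_Suc_shift) simp
  finally show ?thesis by (simp add: win_count_sum add_ac)
qed

lemma excess_periodic: "periodic (\<lambda>x. x \<in> R) t \<Longrightarrow> periodic (excess k R) t"
  unfolding periodic_def excess_def win_count_def
proof
  fix n assume "\<forall>n. (n + t \<in> R) = (n \<in> R)"
  from this[rule_format, of "n + int i" for i]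
  have "n + t + int i \<in> R \<longleftrightarrow> n + int i \<in> R" for i
    by (simp add: add_ac)
  thus "card {i. i \<le> k \<and> n + t + int i \<in> R} - 1 = card {i. i \<le> k \<and> n + int i \<in> R} - 1" by simp
qed

text \<open>The point that enters the window and the one that leaves it differ by
  \<open>k + 1\<close>, so both or neither lie in \<open>R\<close>.\<close>

lemma excess_const: "periodic (\<lambda>x. x \<in> R) (int k + 1) \<Longrightarrow> periodic (excess k R) 1"
  unfolding periodic_def excess_def
proof
  fix n assume "\<forall>n. (n + (int k + 1) \<in> R) = (n \<in> R)"
  thus "win_count k R (n + 1) - 1 = win_count k R n - 1"
    using win_count_step[of k R n] by (simp add: add.assoc)
qed

lemma excess_not_close:
  assumes "\<not> close k R"
  shows "excess k R n = 0"
proof -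
  have "i = j" if "i \<le> k" "j \<le> k" "n + int i \<in> R" "n + int j \<in> R" for i j
  proof (rule ccontr)
    assume "i \<noteq> j"
    have "close k R" if "i \<le> k" "j \<le> k" "n + int i \<in> R" "n + int j \<in> R" "i < j" for i j
      unfolding close_def using that
      by (intro exI[of _ "n + int i"] exI[of _ "int j - int i"]) auto
    from this[of i j] this[of j i] that \<open>i \<noteq> j\<close> assms show False by linarith
  qed
  hence "win_count k R n \<le> Suc 0"
    unfolding win_count_def by (subst card_le_Suc0_iff_eq) auto
  thus ?thesis by (simp add: excess_def)
qed

lemma excess_drop_in: "excess k R (n + 1) < excess k R n \<Longrightarrow> n \<in> R"
  using win_count_step[of k R n] unfolding excess_def by (cases "n \<in> R") auto

text \<open>The point \<open>s\<close> leaves and none enters. Because of \<open>s + i\<close> the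
  count at \<open>s\<close> is at least 2, so the truncated difference drops as well.\<close>

lemma excess_drops:
  assumes "s \<in> R" "s + int k + 1 \<notin> R" "1 \<le> i" "i \<le> int k" "s + i \<in> R"
  shows "excess k R (s + 1) < excess k R s"
proof -
  have "{0, nat i} \<subseteq> {i. i \<le> k \<and> s + int i \<in> R}" using assms by auto
  hence "card {0, nat i} \<le> win_count k R s" unfolding win_count_def by (intro card_mono) auto
  moreover have "card {0, nat i} = 2" using assms by simp
  ultimately show ?thesis using win_count_step[of k R s] assms by (simp add: excess_def)
qed

section \<open>The sum of the excesses over all levels\<close>

text \<open>If \<open>R e\<close> is the set of zeros of a polynomial modulo \<open>p ^ e\<close>
  and \<open>N\<close> is large enough, this is the valuation of product over lcm, see
  \<open>multiplicity_prod_Lcm\<close>.\<close>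

definition total_excess :: "nat \<Rightarrow> (nat \<Rightarrow> int set) \<Rightarrow> nat \<Rightarrow> int \<Rightarrow> nat" where
  "total_excess k R N n = (\<Sum>e\<in>{1..N}. excess k (R e) n)"

lemma total_periodic:
  assumes "\<And>e. 1 \<le> e \<Longrightarrow> e \<le> N \<Longrightarrow> close k (R e) \<Longrightarrow> periodic (\<lambda>x. x \<in> R e) t"
  shows "periodic (total_excess k R N) t"
  unfolding periodic_def total_excess_def
proof (intro allI sum.cong refl)
  fix n e assume "e \<in> {1..N}"
  thus "excess k (R e) (n + t) = excess k (R e) n"
    using assms[of e] excess_periodic[of "R e" t k] excess_not_close[of k "R e"]
    by (cases "close k (R e)") (auto simp: periodic_def)
qed

lemma total_const:
  assumes "\<And>e. 1 \<le> e \<Longrightarrow> e \<le> N \<Longrightarrow> close k (R e) \<Longrightarrow> periodic (\<lambda>x. x \<in> R e) (int k + 1)"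
  shows "periodic (total_excess k R N) 1"
  unfolding periodic_def total_excess_def
proof (intro allI sum.cong refl)
  fix n e assume "e \<in> {1..N}"
  thus "excess k (R e) (n + 1) = excess k (R e) n"
    using assms[of e] excess_const[of "R e" k] excess_not_close[of k "R e"]
    by (cases "close k (R e)") (auto simp: periodic_def)
qed

text \<open>The window count can only drop at a point of \<open>R E\<close>, so a period of the total excess would carry
  the drop at \<open>s\<close> along a whole residue class contained in \<open>R E\<close>.\<close>

lemma total_not_periodic:
  assumes E: "1 \<le> E" "E \<le> N"
    and lower: "\<And>e. 1 \<le> e \<Longrightarrow> e < E \<Longrightarrow> periodic (\<lambda>x. x \<in> R e) t"
    and upper: "\<And>e. E < e \<Longrightarrow> e \<le> N \<Longrightarrow> R e = R E \<or> \<not> close k (R e)"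
    and s: "s \<in> R E" "s + int k + 1 \<notin> R E" "1 \<le> i" "i \<le> int k" "s + i \<in> R E"
    and j: "s + j * t \<notin> R E"
  shows "\<not> periodic (total_excess k R N) t"
proof
  assume per: "periodic (total_excess k R N) t"
  \<comment> \<open>The \<open>m\<close> levels from \<open>E\<close> on that coincide with
    \<open>R E\<close> contribute \<open>m\<close> copies of one function; all others above
    \<open>E\<close> contribute nothing.\<close>
  define m where "m = card {e\<in>{E..N}. R e = R E}"
  have "E \<in> {e\<in>{E..N}. R e = R E}" using E by simp
  hence m: "m > 0" unfolding m_def by (subst card_gt_0_iff) auto
  have split: "total_excess k R N n = (\<Sum>e\<in>{1..<E}. excess k (R e) n) + m * excess k (R E) n" for n
  proof -
    have "{1..N} = {1..<E} \<union> {E..N}" using E by auto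
    hence "total_excess k R N n = (\<Sum>e\<in>{1..<E}. excess k (R e) n) + (\<Sum>e\<in>{E..N}. excess k (R e) n)"
      unfolding total_excess_def by (simp, subst sum.union_disjoint) auto
    also have "(\<Sum>e\<in>{E..N}. excess k (R e) n) = (\<Sum>e\<in>{e\<in>{E..N}. R e = R E}. excess k (R E) n)"
    proof (rule sum.mono_neutral_cong_right)
      show "\<forall>e\<in>{E..N} - {e \<in> {E..N}. R e = R E}. excess k (R e) n = 0"
      proof
        fix e assume e: "e \<in> {E..N} - {e \<in> {E..N}. R e = R E}"
        hence "e \<noteq> E" by auto
        hence "\<not> close k (R e)" using e upper[of e] by auto
        thus "excess k (R e) n = 0" by (rule excess_not_close)
      qed
    qed auto
    finally show ?thesis by (simp add: m_def)
  qed
  have "excess k (R E) (n + t) = excess k (R E) n" for n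
  proof -
    have "(\<Sum>e\<in>{1..<E}. excess k (R e) (n + t)) = (\<Sum>e\<in>{1..<E}. excess k (R e) n)"
      using lower by (intro sum.cong refl periodicD excess_periodic) auto
    thus ?thesis using per split[of n] split[of "n + t"] m by (simp add: periodic_def)
  qed
  hence "periodic (excess k (R E)) (j * t)" by (intro periodic_mult) (simp add: periodic_def)
  from periodicD[OF this, of s] periodicD[OF this, of "s + 1"]
  have "excess k (R E) (s + j * t + 1) < excess k (R E) (s + j * t)"
    using excess_drops[OF s] by (simp add: add_ac)
  from excess_drop_in[OF this] j show False by contradiction
qed

section \<open>Divisibility by prime powers\<close>

lemma pdvd_cancel:
  fixes p x y :: int
  assumes "prime p" "\<not> p ^ Suc w dvd x" "p ^ e dvd x * y"
  shows "p ^ (e - w) dvd y"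
proof (cases "y = 0")
  case False
  have x: "x \<noteq> 0" using assms(2) by auto
  have p: "prime_elem p" "\<not> is_unit p" using assms(1) by auto
  have "e \<le> multiplicity p (x * y)"
    using assms(3) x False p by (simp add: power_dvd_iff_le_multiplicity)
  also have "\<dots> = multiplicity p x + multiplicity p y"
    using prime_elem_multiplicity_mult_distrib[OF p(1) x False] .
  also have "multiplicity p x \<le> w"
    using assms(2) x p power_dvd_iff_le_multiplicity[of x p "Suc w"] by simp
  finally show ?thesis by (intro multiplicity_dvd') simp
qed simp

lemma pdvd_exact:
  fixes p x :: int
  assumes "\<not> p ^ t dvd x"
  obtains j where "j < t" "p ^ j dvd x" "\<not> p ^ Suc j dvd x"
proof -
  define i where "i = (LEAST i. \<not> p ^ i dvd x)"
  have i: "\<not> p ^ i dvd x" unfolding i_def by (rule LeastI[of _ t]) (rule assms)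
  have "i \<le> t" unfolding i_def by (rule Least_le) (rule assms)
  moreover have "i \<noteq> 0" using i by (metis one_dvd power_0)
  moreover have "p ^ (i - 1) dvd x" using not_less_Least[of "i - 1" "\<lambda>i. \<not> p ^ i dvd x"] \<open>i \<noteq> 0\<close>
    by (auto simp: i_def)
  ultimately show thesis using i by (intro that[of "i - 1"]) auto
qed

lemma power_dvd_le:
  fixes p x :: int
  shows "p ^ m dvd x \<Longrightarrow> n \<le> m \<Longrightarrow> p ^ n dvd x"
  by (meson dvd_trans le_imp_power_dvd)

lemma power_dvd_power_iff:
  fixes p :: int
  shows "prime p \<Longrightarrow> p ^ m dvd p ^ n \<longleftrightarrow> m \<le> n"
  by (subst dvd_power_iff) auto

lemma pdvd_cancel_unit:
  fixes p x y :: int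
  assumes "prime p" "\<not> p dvd x"
  shows "p ^ e dvd x * y \<longleftrightarrow> p ^ e dvd y"
  using pdvd_cancel[OF assms(1), of 0 x e y] assms(2) by auto

lemma periodic_setI:
  assumes "\<And>x. x \<in> R \<Longrightarrow> x + t \<in> R" "\<And>x. x \<in> R \<Longrightarrow> x - t \<in> R"
  shows "periodic (\<lambda>x. x \<in> R) t"
  unfolding periodic_def
proof
  fix n :: int show "(n + t \<in> R) = (n \<in> R)"
    using assms(1)[of n] assms(2)[of "n + t"] by auto
qed

section \<open>Sets made of one or two residue classes\<close>

text \<open>\<open>R\<close> is empty or a single residue class modulo \<open>q\<close>.\<close>

definition class_mod :: "int \<Rightarrow> int set \<Rightarrow> bool" where
  "class_mod q R \<longleftrightarrow> (\<forall>r\<in>R. \<forall>z. r + z \<in> R \<longleftrightarrow> q dvd z)"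

lemma class_modD: "class_mod q R \<Longrightarrow> r \<in> R \<Longrightarrow> r + z \<in> R \<longleftrightarrow> q dvd z"
  by (simp add: class_mod_def)

lemma class_mod_periodic: "class_mod q R \<Longrightarrow> q dvd t \<Longrightarrow> periodic (\<lambda>x. x \<in> R) t"
  by (rule periodic_setI) (use class_modD[of q R _ t] class_modD[of q R _ "- t"] in auto)

text \<open>For \<open>\<tau> \<ge> 1\<close>, \<open>E\<close> is the first level with the largest
  modulus \<open>p ^ \<tau>\<close>. As \<open>p ^ \<tau> \<le> k\<close>, a point \<open>s\<close>
  of \<open>R E\<close> has \<open>s + p ^ \<tau>\<close> in its window, and the count drops at
  \<open>s\<close> unless \<open>p ^ \<tau>\<close> divides \<open>k + 1\<close>. Levels below
  \<open>E\<close> have period \<open>p ^ (\<tau> - 1)\<close> and close levels above it coincide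
  with \<open>R E\<close>, so \<open>total_not_periodic\<close> applies.\<close>

lemma single_class_exponent:
  fixes p :: int and R :: "nat \<Rightarrow> int set" and t :: "nat \<Rightarrow> nat"
  assumes p: "prime p"
    and close: "\<And>e. 1 \<le> e \<Longrightarrow> e \<le> N \<Longrightarrow> close k (R e) \<Longrightarrow> class_mod (p ^ t e) (R e) \<and> t e \<le> \<tau>"
    and anti: "\<And>e. e < E \<Longrightarrow> R E \<subseteq> R e" "\<And>e. E < e \<Longrightarrow> R e \<subseteq> R E"
    and E: "\<tau> \<ge> 1 \<Longrightarrow> 1 \<le> E \<and> E \<le> N \<and> t E = \<tau> \<and> R E \<noteq> {} \<and> class_mod (p ^ \<tau>) (R E)"
    and lower: "\<And>e. \<tau> \<ge> 1 \<Longrightarrow> 1 \<le> e \<Longrightarrow> e < E \<Longrightarrow> t e < \<tau>"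
    and k: "p ^ \<tau> \<le> int k"
  shows "has_exponent p (total_excess k R N) (if p ^ \<tau> dvd int k + 1 then 0 else \<tau>)"
proof -
  have per: "periodic (\<lambda>x. x \<in> R e) u" if "1 \<le> e" "e \<le> N" "close k (R e)" "p ^ \<tau> dvd u" for e u
    using close[OF that(1-3)] power_dvd_le[OF that(4)] class_mod_periodic by blast
  show ?thesis
  proof (cases "p ^ \<tau> dvd int k + 1")
    case True
    have "periodic (total_excess k R N) 1" by (rule total_const) (rule per, use True in simp_all)
    thus ?thesis using True by (simp add: has_exponent_0)
  next
    case False
    hence \<tau>: "\<tau> \<ge> 1" by (cases \<tau>) auto
    note E = E[OF \<tau>]
    obtain s where s: "s \<in> R E" using E by blast
    have pp: "p ^ \<tau> > 0" "p > 1" using p by (simp_all add: prime_gt_0_int prime_gt_1_int)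
    have cl: "s + z \<in> R E \<longleftrightarrow> p ^ \<tau> dvd z" for z
      using E s by (simp add: class_mod_def)
    have not_dvd: "\<not> p ^ \<tau> dvd p ^ (\<tau> - 1)"
      using \<tau> by (simp add: power_dvd_power_iff[OF p])
    have s': "s + int k + 1 \<notin> R E" "s + p ^ \<tau> \<in> R E" "s + 1 * p ^ (\<tau> - 1) \<notin> R E" "1 \<le> p ^ \<tau>"
      using cl[of "int k + 1"] cl[of "p ^ \<tau>"] cl[of "p ^ (\<tau> - 1)"] False pp(1) not_dvd
      by (simp_all only: add.assoc mult_1_left dvd_refl simp_thms)
    have "\<not> periodic (total_excess k R N) (p ^ (\<tau> - 1))"
    proof (rule total_not_periodic[where R = R and E = E, OF _ _ _ _ s s'(1,4) k s'(2,3)])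
      fix e assume e: "1 \<le> e" "e < E"
      \<comment> \<open>The classes are only known at close levels; \<open>R e\<close> contains
        \<open>R E\<close>, hence \<open>s\<close> and \<open>s + p ^ \<tau>\<close>.\<close>
      have "s + p ^ \<tau> \<in> R E" using cl by simp
      hence "close k (R e)" unfolding close_def using s anti(1)[OF e(2)] k pp
        by (intro exI[of _ s] exI[of _ "p ^ \<tau>"]) auto
      hence "class_mod (p ^ t e) (R e)" using close e E by auto
      thus "periodic (\<lambda>x. x \<in> R e) (p ^ (\<tau> - 1))"
        by (rule class_mod_periodic) (use lower[OF \<tau> e] in \<open>auto intro: le_imp_power_dvd\<close>)
    next
      fix e assume e: "E < e" "e \<le> N"
      show "R e = R E \<or> \<not> close k (R e)"
      proof (intro disjCI)
        assume "\<not> \<not> close k (R e)"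
        hence c: "close k (R e)" by simp
        hence te: "class_mod (p ^ t e) (R e)" "t e \<le> \<tau>" using close[of e] e by auto
        obtain r where r: "r \<in> R e" using c by (auto simp: close_def)
        hence rE: "r \<in> R E" using anti(2)[OF e(1)] by auto
        have cE: "class_mod (p ^ \<tau>) (R E)" using E by simp
        \<comment> \<open>As \<open>R e\<close> is contained in \<open>R E\<close>, its modulus is a
          multiple of \<open>p ^ \<tau>\<close>; since \<open>t e \<le> \<tau>\<close>, the moduli
          agree, and both sets are the class of \<open>r\<close>.\<close>
        have "r + p ^ t e \<in> R e" using class_modD[OF te(1) r] by simp
        hence "r + p ^ t e \<in> R E" using anti(2)[OF e(1)] by auto
        hence "p ^ \<tau> dvd p ^ t e" using class_modD[OF cE rE] by simp
        hence "t e = \<tau>" using te by (simp add: power_dvd_power_iff[OF p])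
        have "x \<in> R e \<longleftrightarrow> x \<in> R E" for x
          using class_modD[OF te(1) r, of "x - r"] class_modD[OF cE rE, of "x - r"] \<open>t e = \<tau>\<close>
          by simp
        thus "R e = R E" by auto
      qed
    qed (use E in auto)
    moreover have "periodic (total_excess k R N) (p ^ \<tau>)" by (rule total_periodic) (rule per, simp_all)
    ultimately show ?thesis using False has_exponentI[OF p \<tau>] by simp
  qed
qed

text \<open>\<open>R E\<close> consists of two classes modulo \<open>p ^ \<tau>\<close>, and no
  level above \<open>E\<close> is close. For odd \<open>p\<close> two classes cannot fill a class
  modulo \<open>p ^ (\<tau> - 1)\<close>. For \<open>p = 2\<close> they can only if they differ by
  \<open>2 ^ (\<tau> - 1)\<close>, which \<open>Suc w < \<tau>\<close> excludes.\<close>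

lemma double_class_exponent:
  fixes p a :: int and R :: "nat \<Rightarrow> int set"
  assumes p: "prime p" and a: "\<not> p dvd a" and E: "1 \<le> E" "E \<le> N" and "w < \<tau>"
    and lower: "\<And>e. 1 \<le> e \<Longrightarrow> e < E \<Longrightarrow> periodic (\<lambda>x. x \<in> R e) (p ^ (\<tau> - 1))"
    and top: "\<And>s. s \<in> R E \<Longrightarrow> \<exists>y. p ^ w dvd y \<and> \<not> p ^ Suc w dvd y \<and>
                (\<forall>z. s + z \<in> R E \<longleftrightarrow> p ^ \<tau> dvd z \<or> p ^ \<tau> dvd a * z + y)"
    and close: "close k (R E)" and upper: "\<And>e. E < e \<Longrightarrow> e \<le> N \<Longrightarrow> \<not> close k (R e)"
    and cases: "odd p \<or> Suc w < \<tau> \<and> int k + 1 < p ^ \<tau>"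
  shows "has_exponent p (total_excess k R N) (if p ^ \<tau> dvd int k + 1 then 0 else \<tau>)"
proof -
  have perE: "periodic (\<lambda>x. x \<in> R E) (p ^ \<tau>)"
  proof (rule periodic_setI)
    fix x assume "x \<in> R E"
    from top[OF this] show "x + p ^ \<tau> \<in> R E" "x - p ^ \<tau> \<in> R E"
      by (metis dvd_refl, metis dvd_minus_iff dvd_refl uminus_add_conv_diff add.commute)
  qed
  have per: "periodic (\<lambda>x. x \<in> R e) u" if e: "1 \<le> e" "e \<le> N" "close k (R e)" "p ^ \<tau> dvd u" for e u
  proof -
    consider "e < E" | "e = E" using upper[of e] e by (meson linorder_neqE_nat)
    thus ?thesis
    proof cases
      case 1
      have "p ^ (\<tau> - 1) dvd u" using e(4) by (rule power_dvd_le) simp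
      thus ?thesis using lower[OF e(1) 1] periodic_dvd by blast
    next
      case 2
      thus ?thesis using periodic_dvd[OF perE e(4)] by simp
    qed
  qed
  show ?thesis
  proof (cases "p ^ \<tau> dvd int k + 1")
    case True
    have "periodic (total_excess k R N) 1" by (rule total_const) (rule per, use True in simp_all)
    thus ?thesis using True by (simp add: has_exponent_0)
  next
    case False
    have \<tau>: "\<tau> \<ge> 1" using \<open>w < \<tau>\<close> by simp
    have pp: "p ^ \<tau> > 0" "p > 1" using p by (simp_all add: prime_gt_0_int prime_gt_1_int)
    have odd: "p ^ \<tau> dvd z" if "odd p" "p ^ \<tau> dvd 2 * z" for z
    proof -
      have "\<not> p dvd 2"
        using that(1) p by (metis primes_dvd_imp_eq two_is_prime dvd_refl)
      thus ?thesis using pdvd_cancel_unit[OF p] that(2) by blast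
    qed
    have unit: "p ^ \<tau> dvd a * z \<longleftrightarrow> p ^ \<tau> dvd z" for z by (rule pdvd_cancel_unit[OF p a])
    have "\<exists>s i. s \<in> R E \<and> s + int k + 1 \<notin> R E \<and> 1 \<le> i \<and> i \<le> int k \<and> s + i \<in> R E"
    proof -
      obtain s i where si: "1 \<le> i" "i \<le> int k" "s \<in> R E" "s + i \<in> R E"
        using close by (auto simp: close_def)
      obtain y where y: "\<And>z. s + z \<in> R E \<longleftrightarrow> p ^ \<tau> dvd z \<or> p ^ \<tau> dvd a * z + y"
        using top[OF si(3)] by blast
      show ?thesis
      proof (cases "s + int k + 1 \<in> R E")
        case True
        hence y1: "p ^ \<tau> dvd a * (int k + 1) + y" using y[of "int k + 1"] False by (simp add: add_ac)
        \<comment> \<open>As \<open>s + k + 1\<close> lies in the other class than \<open>s\<close>,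
          either \<open>i\<close> is a multiple of \<open>p ^ \<tau>\<close>, or
          \<open>s + i\<close> is in that other class too and \<open>k + 1 - i\<close> is a
          multiple.\<close>
        have qk: "p ^ \<tau> \<le> int k"
        proof (cases "p ^ \<tau> dvd i")
          case True
          thus ?thesis using si zdvd_imp_le[of "p ^ \<tau>" i] by linarith
        next
          case False
          hence "p ^ \<tau> dvd a * i + y" using y[of i] si by simp
          hence "p ^ \<tau> dvd (a * (int k + 1) + y) - (a * i + y)" using y1 by (rule dvd_diff[rotated])
          hence "p ^ \<tau> dvd a * (int k + 1 - i)" by (simp add: algebra_simps)
          hence "p ^ \<tau> dvd int k + 1 - i" by (simp add: unit)
          thus ?thesis using si zdvd_imp_le[of "p ^ \<tau>" "int k + 1 - i"] by linarith
        qed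
        hence "odd p" using cases by linarith
        \<comment> \<open>The window can start at \<open>s'\<close> instead:
          \<open>s + 2 * (k + 1)\<close> lies in neither class, because \<open>p\<close> is odd and
          \<open>p ^ \<tau>\<close> does not divide \<open>k + 1\<close>.\<close>
        define s' where "s' = s + int k + 1"
        have eq: "s' + int k + 1 = s + 2 * (int k + 1)" by (simp add: s'_def)
        have "\<not> p ^ \<tau> dvd 2 * (int k + 1)" using odd[OF \<open>odd p\<close>] False by blast
        moreover have "\<not> p ^ \<tau> dvd a * (2 * (int k + 1)) + y"
        proof
          assume "p ^ \<tau> dvd a * (2 * (int k + 1)) + y"
          from dvd_diff[OF this y1] have "p ^ \<tau> dvd a * (int k + 1)" by (simp add: algebra_simps)
          thus False using unit False by simp
        qed
        ultimately have "s' + int k + 1 \<notin> R E" using y[of "2 * (int k + 1)"] unfolding eq by blast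
        moreover have "s' + p ^ \<tau> \<in> R E" "s' \<in> R E"
          using True periodicD[OF perE, of s'] by (auto simp: s'_def)
        ultimately show ?thesis using qk pp by (intro exI[of _ s'] exI[of _ "p ^ \<tau>"]) auto
      qed (use si in blast)
    qed
    then obtain s i where s: "s \<in> R E" "s + int k + 1 \<notin> R E" "1 \<le> i" "i \<le> int k" "s + i \<in> R E"
      by blast
    obtain y where y: "p ^ w dvd y" "\<not> p ^ Suc w dvd y"
      "\<And>z. s + z \<in> R E \<longleftrightarrow> p ^ \<tau> dvd z \<or> p ^ \<tau> dvd a * z + y"
      using top[OF s(1)] by blast
    have not_dvd: "\<not> p ^ \<tau> dvd p ^ (\<tau> - 1)"
      using \<tau> by (simp add: power_dvd_power_iff[OF p])
    have "\<exists>j. s + j * p ^ (\<tau> - 1) \<notin> R E"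
    proof (rule ccontr)
      assume "\<nexists>j. s + j * p ^ (\<tau> - 1) \<notin> R E"
      hence all: "p ^ \<tau> dvd j * p ^ (\<tau> - 1) \<or> p ^ \<tau> dvd a * (j * p ^ (\<tau> - 1)) + y" for j
        using y(3) by blast
      hence 1: "p ^ \<tau> dvd a * p ^ (\<tau> - 1) + y" using not_dvd all[of 1] by simp
      show False
      proof (cases "odd p")
        case True
        hence "p ^ \<tau> dvd a * (2 * p ^ (\<tau> - 1)) + y" using not_dvd all[of 2] odd by blast
        from dvd_diff[OF this 1] have "p ^ \<tau> dvd a * p ^ (\<tau> - 1)" by (simp add: algebra_simps)
        thus False using unit not_dvd by simp
      next
        case False
        hence w: "Suc w \<le> \<tau> - 1" using cases by linarith
        have "p ^ Suc w dvd a * p ^ (\<tau> - 1) + y" by (rule power_dvd_le[OF 1]) (use w in simp)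
        moreover have "p ^ Suc w dvd a * p ^ (\<tau> - 1)"
          by (intro dvd_mult le_imp_power_dvd w)
        ultimately show False using y(2) by (simp add: dvd_add_right_iff)
      qed
    qed
    then obtain j where j: "s + j * p ^ (\<tau> - 1) \<notin> R E" by blast
    have "\<not> periodic (total_excess k R N) (p ^ (\<tau> - 1))"
      by (rule total_not_periodic[where R = R, OF E lower _ s j]) (use upper in auto)
    moreover have "periodic (total_excess k R N) (p ^ \<tau>)" by (rule total_periodic) (rule per, simp_all)
    ultimately show ?thesis using False has_exponentI[OF p \<tau>] by simp
  qed
qed

section \<open>Zeros of a quadratic polynomial modulo prime powers\<close>

lemma pdvd_square_iff:
  fixes p x :: int
  assumes "prime p"
  shows "p ^ e dvd x\<^sup>2 \<longleftrightarrow> p ^ ((e + 1) div 2) dvd x"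
proof
  assume "p ^ ((e + 1) div 2) dvd x"
  hence "(p ^ ((e + 1) div 2))\<^sup>2 dvd x\<^sup>2" by (rule dvd_power_same)
  hence "p ^ ((e + 1) div 2 * 2) dvd x\<^sup>2" by (simp add: power_mult)
  thus "p ^ e dvd x\<^sup>2" by (rule power_dvd_le) simp
next
  assume *: "p ^ e dvd x\<^sup>2"
  show "p ^ ((e + 1) div 2) dvd x"
  proof (rule ccontr)
    assume "\<not> ?thesis"
    then obtain j where j: "j < (e + 1) div 2" "\<not> p ^ Suc j dvd x" by (rule pdvd_exact)
    have "p ^ (e - j) dvd x" using pdvd_cancel[OF assms j(2)] * by (simp add: power2_eq_square)
    hence "p ^ Suc j dvd x" by (rule power_dvd_le) (use j(1) in linarith)
    thus False using j(2) by contradiction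
  qed
qed

locale quad =
  fixes p a b c :: int and k :: nat
  assumes p: "prime p"
begin

definition F :: "int \<Rightarrow> int" where "F x = a * x\<^sup>2 + b * x + c"
text \<open>The derivative of \<open>F\<close>; its valuation at a zero governs the neighbouring
  zeros.\<close>

definition Y :: "int \<Rightarrow> int" where "Y x = 2 * a * x + b"
definition D :: int where "D = b\<^sup>2 - 4 * a * c"
definition R :: "nat \<Rightarrow> int set" where "R e = {x. p ^ e dvd F x}"

text \<open>For \<open>k \<ge> 1\<close> this says that \<open>p ^ e\<close> divides
  \<open>B_num k a D\<close>; compare \<open>BB_iff\<close>.\<close>

definition BB :: "nat \<Rightarrow> bool" where
  "BB e \<longleftrightarrow> (\<exists>i. 1 \<le> i \<and> i \<le> int k \<and> p ^ e dvd i * (a\<^sup>2 * i\<^sup>2 - D))"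

lemma F_add: "F (r + z) = F r + z * (a * z + Y r)"
  by (simp add: F_def Y_def power2_eq_square algebra_simps)

lemma Y_square: "(Y x)\<^sup>2 = D + 4 * a * F x"
  by (simp add: F_def Y_def D_def power2_eq_square algebra_simps)

lemma Y_add: "Y (r + z) = Y r + 2 * a * z"
  by (simp add: Y_def algebra_simps)

lemma factor: "a\<^sup>2 * i\<^sup>2 - D = (a * i - Y r) * (a * i + Y r) + 4 * a * F r"
  using Y_square[of r] by (simp add: power2_eq_square algebra_simps)

lemma R_add_iff: "r \<in> R e \<Longrightarrow> r + z \<in> R e \<longleftrightarrow> p ^ e dvd z * (a * z + Y r)"
  by (simp add: R_def F_add dvd_add_right_iff)

lemma R_anti: "e \<le> e' \<Longrightarrow> R e' \<subseteq> R e"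
  by (auto simp: R_def intro: power_dvd_le)

lemma closeE:
  assumes "close k (R e)"
  obtains r i where "1 \<le> i" "i \<le> int k" "r \<in> R e" "r + i \<in> R e" "p ^ e dvd i * (a * i + Y r)"
  using assms R_add_iff unfolding close_def by blast

lemma closeI: "r \<in> R e \<Longrightarrow> 1 \<le> i \<Longrightarrow> i \<le> int k \<Longrightarrow> p ^ e dvd i * (a * i + Y r) \<Longrightarrow> close k (R e)"
  using R_add_iff unfolding close_def by blast

lemma closeI':
  assumes "r \<in> R e" "1 \<le> i" "i \<le> int k" "p ^ e dvd i * (a * i - Y r)"
  shows "close k (R e)"
proof -
  have "- i * (a * - i + Y r) = i * (a * i - Y r)" by (simp add: algebra_simps)
  hence "r + - i \<in> R e" using R_add_iff[OF assms(1), of "- i"] assms(4) by simp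
  thus ?thesis unfolding close_def using assms
    by (intro exI[of _ "r + - i"] exI[of _ i]) auto
qed

text \<open>For zeros \<open>r\<close> and \<open>r + i\<close>, \<open>p ^ e\<close> divides both
  \<open>i * (a * i + Y r)\<close> and \<open>F r\<close>, and \<open>factor\<close> combines the
  two. So levels beyond the valuation of \<open>B_num\<close> contribute nothing.\<close>

lemma close_BB: "close k (R e) \<Longrightarrow> BB e"
proof (elim closeE)
  fix r i assume i: "1 \<le> i" "i \<le> int k" "r \<in> R e" "p ^ e dvd i * (a * i + Y r)"
  have "i * (a\<^sup>2 * i\<^sup>2 - D) = i * (a * i + Y r) * (a * i - Y r) + 4 * a * i * F r"
    unfolding factor[of i r] by (simp add: algebra_simps)
  moreover have "p ^ e dvd F r" using i by (simp add: R_def)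
  ultimately show "BB e" unfolding BB_def using i by (intro exI[of _ i]) auto
qed

section \<open>Primes dividing the leading but not the linear coefficient\<close>

text \<open>The derivative is a unit everywhere, so by Hensel's lemma the zeros modulo
  \<open>p ^ e\<close> form exactly one class modulo \<open>p ^ e\<close>, and close levels satisfy
  \<open>p ^ e \<le> k\<close>.\<close>

lemma linear_exponent:
  assumes pa: "p dvd a" and pb: "\<not> p dvd b"
    and \<tau>: "p ^ \<tau> \<le> int k" "int k < p ^ Suc \<tau>" and N: "\<tau> \<le> N"
  shows "has_exponent p (total_excess k R N) (if p ^ \<tau> dvd int k + 1 then 0 else \<tau>)"
proof -
  have unit: "\<not> p dvd a * z + Y r" for z r
  proof
    assume "p dvd a * z + Y r"
    moreover have "a * z + Y r = a * (z + 2 * r) + b" by (simp add: Y_def algebra_simps)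
    ultimately show False using pa pb by (simp add: dvd_add_right_iff)
  qed
  have cls: "class_mod (p ^ e) (R e)" for e
    unfolding class_mod_def using R_add_iff pdvd_cancel_unit[OF p unit] by (simp add: mult.commute)
  have "\<exists>r. r \<in> R e" for e
  proof (induction e)
    case (Suc e)
    then obtain r where r: "r \<in> R e" by blast
    then obtain g where g: "F r = p ^ e * g" by (auto simp: R_def)
    have "\<not> p dvd Y r" using unit[of 0] by simp
    hence "coprime p (Y r)" using p prime_imp_coprime by blast
    then obtain u v where uv: "u * p + v * Y r = 1" using bezout_int[of p "Y r"] by auto
    show ?case
    proof (cases "e = 0")
      case True
      have "coprime p b" using pb p prime_imp_coprime by blast
      then obtain u v where uv: "u * p + v * b = 1" using bezout_int[of p b] by auto
      \<comment> \<open>Modulo \<open>p\<close> the polynomial is \<open>b * x + c\<close>, and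
        \<open>v\<close> inverts \<open>b\<close>.\<close>
      have "F (- c * v) = a * (c * v)\<^sup>2 + c * (u * p)"
        using uv by (simp add: F_def power2_eq_square algebra_simps flip: distrib_left)
          (metis (no_types, opaque_lifting) distrib_left mult.right_neutral mult.assoc mult.commute add.commute)
      hence "- c * v \<in> R (Suc e)" using pa True by (simp add: R_def)
      thus ?thesis by blast
    next
      case False
      \<comment> \<open>Newton's step, with \<open>v\<close> as inverse of the derivative; its
        quadratic term carries \<open>p ^ (2 * e)\<close>.\<close>
      define z where "z = p ^ e * (- g * v)"
      have "F (r + z) = p ^ e * (g * (1 - v * Y r) + p ^ e * (a * (g * v)\<^sup>2))"
        unfolding F_add g z_def by (simp add: power2_eq_square algebra_simps)
      also have "1 - v * Y r = u * p" using uv by simp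
      finally have "F (r + z) = p ^ e * (g * (u * p) + p ^ e * (a * (g * v)\<^sup>2))" .
      moreover have "p dvd g * (u * p) + p ^ e * (a * (g * v)\<^sup>2)"
        using False by (simp add: dvd_power)
      ultimately have "r + z \<in> R (Suc e)" by (simp add: R_def mult.commute[of p] mult_dvd_mono)
      thus ?thesis by blast
    qed
  qed (simp add: R_def)
  hence ne: "R e \<noteq> {}" for e by auto
  show ?thesis
  proof (rule single_class_exponent[OF p, where t = "\<lambda>e. e" and E = \<tau>])
    fix e assume "close k (R e)"
    then obtain r i where i: "1 \<le> i" "i \<le> int k" "r \<in> R e" "r + i \<in> R e" by (rule closeE)
    hence "p ^ e dvd i" using class_modD[OF cls] by blast
    hence "p ^ e \<le> int k" using zdvd_imp_le[of "p ^ e" i] i by linarith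
    hence "p ^ e < p ^ Suc \<tau>" using \<tau> by linarith
    hence "e \<le> \<tau>" using p prime_gt_1_int[of p] by (simp add: power_strict_increasing_iff del: power_Suc)
    thus "class_mod (p ^ e) (R e) \<and> e \<le> \<tau>" using cls by simp
  qed (use ne cls N \<tau> R_anti in auto)
qed

end

section \<open>Primes not dividing the leading coefficient\<close>

locale quad_unit = quad +
  assumes pa: "\<not> p dvd a"
begin

text \<open>Let \<open>t = (e + 1) div 2\<close>. If \<open>p ^ t\<close> divides \<open>z\<close>,
  it divides both factors of \<open>z * (a * z + Y r)\<close>. If \<open>z\<close> has valuation
  \<open>j < t\<close>, so has \<open>a * z + Y r\<close>, and \<open>2 * j < e\<close>.\<close>

lemma single_class:
  assumes "\<And>r. r \<in> R e \<Longrightarrow> p ^ ((e + 1) div 2) dvd Y r"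
  shows "class_mod (p ^ ((e + 1) div 2)) (R e)"
  unfolding class_mod_def
proof (intro ballI allI)
  fix r z assume r: "r \<in> R e"
  define t where "t = (e + 1) div 2"
  have Yr: "p ^ t dvd Y r" using assms r by (simp add: t_def)
  have "p ^ e dvd z * (a * z + Y r) \<longleftrightarrow> p ^ t dvd z"
  proof
    assume "p ^ t dvd z"
    hence "p ^ t * p ^ t dvd z * (a * z + Y r)" using Yr by (intro mult_dvd_mono dvd_add) auto
    hence "p ^ (t + t) dvd z * (a * z + Y r)" by (simp add: power_add)
    thus "p ^ e dvd z * (a * z + Y r)" by (rule power_dvd_le) (simp add: t_def)
  next
    assume *: "p ^ e dvd z * (a * z + Y r)"
    show "p ^ t dvd z"
    proof (rule ccontr)
      assume "\<not> ?thesis"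
      then obtain j where j: "j < t" "\<not> p ^ Suc j dvd z" by (rule pdvd_exact)
      have "p ^ (e - j) dvd a * z + Y r" by (rule pdvd_cancel[OF p j(2) *])
      hence "p ^ Suc j dvd a * z + Y r" by (rule power_dvd_le) (use j(1) in \<open>simp add: t_def\<close>)
      moreover have "p ^ Suc j dvd Y r" by (rule power_dvd_le[OF Yr]) (use j(1) in simp)
      ultimately have "p ^ Suc j dvd a * z" by (simp add: dvd_add_left_iff)
      thus False using pdvd_cancel_unit[OF p pa] j(2) by blast
    qed
  qed
  thus "r + z \<in> R e \<longleftrightarrow> p ^ ((e + 1) div 2) dvd z" using R_add_iff[OF r] by (simp add: t_def)
qed

text \<open>Not both of \<open>z\<close> and \<open>a * z + Y r\<close> are divisible by
  \<open>p ^ Suc w\<close>, so one of them must carry \<open>p ^ (e - w)\<close>. Conversely, that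
  forces \<open>p ^ w\<close> on the other, because \<open>w < e - w\<close>.\<close>

lemma double_class:
  assumes r: "r \<in> R e" and w: "p ^ w dvd Y r" "\<not> p ^ Suc w dvd Y r" "2 * w < e"
  shows "r + z \<in> R e \<longleftrightarrow> p ^ (e - w) dvd z \<or> p ^ (e - w) dvd a * z + Y r"
proof -
  have ew: "p ^ e = p ^ w * p ^ (e - w)" using w(3) by (simp flip: power_add)
  have "p ^ e dvd z * (a * z + Y r) \<longleftrightarrow> p ^ (e - w) dvd z \<or> p ^ (e - w) dvd a * z + Y r"
  proof (intro iffI disjCI)
    assume *: "p ^ e dvd z * (a * z + Y r)" and n: "\<not> p ^ (e - w) dvd a * z + Y r"
    have "p ^ Suc w dvd z" using pdvd_cancel[OF p _ *, of w] n by blast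
    hence "\<not> p ^ Suc w dvd a * z + Y r" using w(2) by (simp add: dvd_add_right_iff)
    thus "p ^ (e - w) dvd z" using pdvd_cancel[OF p, of w "a * z + Y r" e z] * by (simp add: mult.commute)
  next
    assume "p ^ (e - w) dvd z \<or> p ^ (e - w) dvd a * z + Y r"
    thus "p ^ e dvd z * (a * z + Y r)"
    proof
      assume z: "p ^ (e - w) dvd z"
      hence "p ^ w dvd z" by (rule power_dvd_le) (use w(3) in simp)
      hence "p ^ w dvd a * z + Y r" using w(1) by simp
      with z show ?thesis unfolding ew by (subst mult.commute) (rule mult_dvd_mono)
    next
      assume z: "p ^ (e - w) dvd a * z + Y r"
      hence "p ^ w dvd a * z + Y r" by (rule power_dvd_le) (use w(3) in simp)
      hence "p ^ w dvd a * z" using w(1) by (simp add: dvd_add_left_iff)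
      hence "p ^ w dvd z" using pdvd_cancel_unit[OF p pa] by blast
      with z show ?thesis unfolding ew by (intro mult_dvd_mono)
    qed
  qed
  thus ?thesis using R_add_iff[OF r] by simp
qed

text \<open>Hensel's lemma at a root with derivative of valuation \<open>w\<close>.\<close>

lemma R_lift:
  assumes r: "r \<in> R e" and w: "p ^ w dvd Y r" "\<not> p ^ Suc w dvd Y r" "2 * w < e"
  shows "\<exists>r' \<in> R (Suc e). p ^ w dvd Y r' \<and> \<not> p ^ Suc w dvd Y r'"
proof -
  obtain g where g: "F r = p ^ e * g" using r by (auto simp: R_def)
  obtain y where y: "Y r = p ^ w * y" using w(1) by auto
  have "\<not> p dvd y" using w(2) y by auto
  hence "coprime p y" using p prime_imp_coprime by blast
  then obtain u v where uv: "u * p + v * y = 1" using bezout_int[of p y] by auto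
  define z where "z = p ^ (e - w) * (- g * v)"
  have ew: "p ^ e = p ^ w * p ^ (e - w)" using w(3) by (simp flip: power_add)
  have "F (r + z) = p ^ e * (g * (1 - v * y)) + p ^ (e - w) * p ^ (e - w) * (a * (g * v)\<^sup>2)"
    unfolding F_add g y z_def ew by (simp add: power2_eq_square algebra_simps)
  also have "1 - v * y = u * p" using uv by simp
  also have "p ^ (e - w) * p ^ (e - w) = p ^ (2 * (e - w))" by (simp add: mult_2 flip: power_add)
  finally have "F (r + z) = p ^ Suc e * (g * u) + p ^ (2 * (e - w)) * (a * (g * v)\<^sup>2)"
    by (simp add: mult_ac)
  moreover have "p ^ Suc e dvd p ^ (2 * (e - w))" using w(3) by (intro le_imp_power_dvd) simp
  ultimately have "r + z \<in> R (Suc e)" by (simp add: R_def del: power_Suc)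
  moreover have "p ^ Suc w dvd z" unfolding z_def
    using w(3) by (intro dvd_mult2 le_imp_power_dvd) simp
  hence Suc: "p ^ Suc w dvd 2 * a * z" by simp
  hence "p ^ w dvd 2 * a * z" by (rule power_dvd_le) simp
  with Suc have "p ^ w dvd Y (r + z)" "\<not> p ^ Suc w dvd Y (r + z)"
    unfolding Y_add using w by (auto simp: dvd_add_left_iff simp del: power_Suc)
  ultimately show ?thesis by blast
qed

text \<open>The level \<open>2 * \<tau> - 1\<close> is the first with modulus
  \<open>p ^ \<tau>\<close>.\<close>

lemma single_exponent:
  assumes k: "p ^ \<tau> \<le> int k" and N: "\<And>e. BB e \<Longrightarrow> e \<le> N"
    and close: "\<And>e. close k (R e) \<Longrightarrow> (\<forall>r\<in>R e. p ^ ((e + 1) div 2) dvd Y r) \<and> (e + 1) div 2 \<le> \<tau>"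
    and ne: "\<tau> \<ge> 1 \<Longrightarrow> \<exists>r\<in>R (2 * \<tau> - 1). p ^ \<tau> dvd Y r"
  shows "has_exponent p (total_excess k R N) (if p ^ \<tau> dvd int k + 1 then 0 else \<tau>)"
proof (rule single_class_exponent[OF p, where t = "\<lambda>e. (e + 1) div 2" and E = "2 * \<tau> - 1"])
  fix e assume "close k (R e)"
  thus "class_mod (p ^ ((e + 1) div 2)) (R e) \<and> (e + 1) div 2 \<le> \<tau>"
    using close single_class by blast
next
  assume \<tau>: "\<tau> \<ge> 1"
  then obtain r where r: "r \<in> R (2 * \<tau> - 1)" "p ^ \<tau> dvd Y r" using ne by blast
  \<comment> \<open>The zeros \<open>r\<close> and \<open>r + p ^ \<tau>\<close> make this level
    close, so the assumption on close levels describes it.\<close>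
  have "p ^ \<tau> * p ^ \<tau> dvd p ^ \<tau> * (a * p ^ \<tau> + Y r)" using r by (intro mult_dvd_mono dvd_add) auto
  hence "p ^ (\<tau> + \<tau>) dvd p ^ \<tau> * (a * p ^ \<tau> + Y r)" by (simp add: power_add)
  hence "p ^ (2 * \<tau> - 1) dvd p ^ \<tau> * (a * p ^ \<tau> + Y r)" by (rule power_dvd_le) simp
  moreover have "p ^ \<tau> > 0" using p by (simp add: prime_gt_0_int)
  ultimately have c: "close k (R (2 * \<tau> - 1))" using r k by (intro closeI[of r _ "p ^ \<tau>"]) auto
  have t: "(2 * \<tau> - 1 + 1) div 2 = \<tau>" using \<tau> by simp
  have "class_mod (p ^ \<tau>) (R (2 * \<tau> - 1))"
    using single_class[of "2 * \<tau> - 1"] close[OF c] unfolding t by blast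
  thus "1 \<le> 2 * \<tau> - 1 \<and> 2 * \<tau> - 1 \<le> N \<and> (2 * \<tau> - 1 + 1) div 2 = \<tau> \<and> R (2 * \<tau> - 1) \<noteq> {} \<and>
      class_mod (p ^ \<tau>) (R (2 * \<tau> - 1))"
    using r \<tau> c close_BB N by auto
qed (use k in \<open>auto intro!: R_anti\<close>)

lemma solve_linear: "\<not> p dvd m \<Longrightarrow> \<exists>r. p ^ t dvd m * r + n"
proof -
  assume "\<not> p dvd m"
  hence "coprime m (p ^ t)" using p prime_imp_coprime[of p m] by (simp add: coprime_commute)
  then obtain u v where uv: "u * m + v * p ^ t = 1" using bezout_int[of m "p ^ t"] by auto
  have "m * (- (n * u)) + n = n * (1 - u * m)" by (simp add: algebra_simps)
  also have "1 - u * m = p ^ t * v" using uv by (simp add: algebra_simps)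
  finally have "m * (- (n * u)) + n = p ^ t * (n * v)" by (simp add: mult_ac)
  thus ?thesis by (metis dvd_triv_left)
qed

text \<open>Make \<open>Y r\<close> divisible by \<open>p ^ \<tau>\<close>; then
  \<open>4 * a * F r = (Y r)\<^sup>2 - D\<close>, and \<open>4 * a\<close> is a unit.\<close>

lemma witness_odd:
  assumes "odd p" "p ^ (2 * \<tau> - 1) dvd D"
  shows "\<exists>r\<in>R (2 * \<tau> - 1). p ^ \<tau> dvd Y r"
proof -
  have p2: "\<not> p dvd 2" using assms(1) p by (metis primes_dvd_imp_eq two_is_prime dvd_refl)
  hence unit: "\<not> p dvd 2 * a" using p pa by (simp add: prime_dvd_mult_iff)
  then obtain r where r: "p ^ \<tau> dvd Y r" using solve_linear[of "2 * a" \<tau> b] by (auto simp: Y_def)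
  have "p ^ (2 * \<tau> - 1) dvd (Y r)\<^sup>2"
    unfolding pdvd_square_iff[OF p] by (rule power_dvd_le[OF r]) simp
  hence "p ^ (2 * \<tau> - 1) dvd 2 * (2 * a * F r)"
    unfolding Y_square using assms(2) by (simp add: dvd_add_right_iff mult.assoc)
  hence "r \<in> R (2 * \<tau> - 1)"
    unfolding pdvd_cancel_unit[OF p p2] pdvd_cancel_unit[OF p unit] by (simp add: R_def)
  thus ?thesis using r by blast
qed

text \<open>Here 4 is not a unit, so it is cancelled first:
  \<open>a * F r = (a * r + \<beta>)\<^sup>2 - \<Delta>\<close>. With \<open>m = \<tau> - 1\<close>,
  both terms are divisible by \<open>4 ^ m\<close>, and the last factor 2 comes from equal parity of
  the quotients.\<close>

lemma witness_even:
  assumes "p = 2" "\<tau> \<ge> 1" "2 ^ (2 * \<tau>) dvd D"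
  shows "\<exists>r\<in>R (2 * \<tau> - 1). p ^ \<tau> dvd Y r"
proof -
  obtain m where m: "\<tau> = Suc m" using assms(2) by (cases \<tau>) auto
  have D4: "4 * 2 ^ (2 * m) dvd D" using assms(3) by (simp add: m power_add)
  hence "4 dvd D" by (rule dvd_mult_left)
  moreover have "b\<^sup>2 = D + 4 * (a * c)" by (simp add: D_def)
  ultimately have "4 dvd b\<^sup>2" by simp
  hence "even (b\<^sup>2)" by (rule dvd_trans[rotated]) simp
  then obtain \<beta> where \<beta>: "b = 2 * \<beta>" by (auto elim!: evenE)
  define \<Delta> where "\<Delta> = \<beta>\<^sup>2 - a * c"
  have "D = 4 * \<Delta>" by (simp only: D_def \<Delta>_def) (simp add: \<beta> power2_eq_square)
  hence "2 ^ (2 * m) dvd \<Delta>" using D4 by simp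
  then obtain \<delta> where \<delta>: "\<Delta> = 2 ^ (2 * m) * \<delta>" by auto
  \<comment> \<open>This choice makes \<open>(a * r + \<beta>) / 2 ^ m\<close> odd exactly if
    \<open>\<delta>\<close> is odd.\<close>
  obtain r where "p ^ \<tau> dvd a * r + (\<beta> + (if even \<delta> then 0 else 2 ^ m))"
    using solve_linear[OF pa] by blast
  then obtain v where "a * r + (\<beta> + (if even \<delta> then 0 else 2 ^ m)) = 2 ^ m * (2 * v)"
    using assms(1) by (auto simp: m)
  hence z: "a * r + \<beta> = 2 ^ m * (2 * v - (if even \<delta> then 0 else 1))"
    by (auto simp: algebra_simps split: if_splits)
  define o' where "o' = 2 * v - (if even \<delta> then 0 else 1)"
  have par: "even (o'\<^sup>2 - \<delta>)" by (auto simp: o'_def)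
  have "a * F r = (a * r + \<beta>)\<^sup>2 - \<Delta>"
    by (simp only: F_def \<Delta>_def) (simp add: \<beta> power2_eq_square algebra_simps)
  also have "\<dots> = 2 ^ (2 * m) * (o'\<^sup>2 - \<delta>)"
    unfolding z \<delta> o'_def[symmetric]
    by (simp only: power_mult_distrib power_mult[symmetric] mult.commute[of m 2] right_diff_distrib)
  finally have "a * F r = 2 ^ (2 * m) * (o'\<^sup>2 - \<delta>)" .
  hence "2 ^ (2 * m) * 2 dvd a * F r" using par by simp
  hence "p ^ (2 * \<tau> - 1) dvd a * F r" using assms(1) by (simp add: m mult.commute)
  hence "r \<in> R (2 * \<tau> - 1)" unfolding pdvd_cancel_unit[OF p pa] by (simp add: R_def)
  moreover have "Y r = 2 * (a * r + \<beta>)" by (simp only: Y_def) (simp add: \<beta>)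
  hence "p ^ \<tau> dvd Y r" unfolding z assms(1) by (simp add: m)
  ultimately show ?thesis by blast
qed

section \<open>Highly divisible and nonsquare discriminants\<close>

text \<open>If the derivative at a zero \<open>s\<close> of a close level had valuation
  \<open>w < (e + 1) div 2\<close>, then \<open>double_class\<close> would give
  \<open>p ^ w dvd i\<close>, so \<open>p ^ w \<le> k\<close>, and \<open>below\<close> would make
  \<open>(Y s)\<^sup>2\<close> divisible by \<open>p ^ (2 * w + 1)\<close>. Hence close levels are
  single classes, with moduli at most \<open>k\<close>.\<close>

lemma below_exponent:
  assumes \<tau>: "p ^ \<tau> \<le> int k" "int k < p ^ Suc \<tau>"
    and below: "\<And>w. p ^ w \<le> int k \<Longrightarrow> p ^ (2 * w + 1) dvd D \<and> (p = 2 \<longrightarrow> p ^ (2 * w + 2) dvd D)"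
    and N: "\<And>e. BB e \<Longrightarrow> e \<le> N"
  shows "has_exponent p (total_excess k R N) (if p ^ \<tau> dvd int k + 1 then 0 else \<tau>)"
proof (rule single_exponent[OF \<tau>(1) N])
  fix e assume "close k (R e)"
  then obtain s i where s: "1 \<le> i" "i \<le> int k" "s \<in> R e" "s + i \<in> R e" by (rule closeE)
  define t where "t = (e + 1) div 2"
  have Fr: "p ^ e dvd 4 * a * F r" if "r \<in> R e" for r using that by (simp add: R_def)
  have Ys: "p ^ t dvd Y s"
  proof (rule ccontr)
    assume "\<not> ?thesis"
    then obtain w where w: "w < t" "p ^ w dvd Y s" "\<not> p ^ Suc w dvd Y s" by (rule pdvd_exact)
    have we: "2 * w < e" using w(1) by (simp add: t_def)
    have "p ^ w dvd i"
      using s(4) unfolding double_class[OF s(3) w(2,3) we]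
    proof
      assume "p ^ (e - w) dvd i"
      thus ?thesis by (rule power_dvd_le) (use we in simp)
    next
      assume "p ^ (e - w) dvd a * i + Y s"
      hence "p ^ w dvd a * i + Y s" by (rule power_dvd_le) (use we in simp)
      hence "p ^ w dvd a * i" using w(2) by (simp add: dvd_add_left_iff)
      thus ?thesis by (simp add: pdvd_cancel_unit[OF p pa])
    qed
    hence "p ^ w \<le> int k" using zdvd_imp_le[of "p ^ w" i] s by linarith
    hence "p ^ (2 * w + 1) dvd D" using below by blast
    moreover have "p ^ (2 * w + 1) dvd 4 * a * F s"
      by (rule power_dvd_le[OF Fr[OF s(3)]]) (use we in simp)
    ultimately have "p ^ (2 * w + 1) dvd (Y s)\<^sup>2" unfolding Y_square by (rule dvd_add)
    thus False using w(3) unfolding pdvd_square_iff[OF p] by simp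
  qed
  \<comment> \<open>For zeros at level \<open>e\<close> this depends on \<open>D\<close> alone, so
    it passes from \<open>s\<close> to all of them.\<close>
  have Y_iff: "p ^ t dvd Y r \<longleftrightarrow> p ^ e dvd D" if "r \<in> R e" for r
    using pdvd_square_iff[OF p, of e "Y r"] Fr[OF that] by (simp add: Y_square t_def dvd_add_left_iff)
  have all: "\<forall>r\<in>R e. p ^ ((e + 1) div 2) dvd Y r" using Ys Y_iff s(3) by (auto simp: t_def)
  have "p ^ t dvd i" using class_modD[OF single_class s(3)] s(4) all by (auto simp: t_def)
  hence "p ^ t \<le> int k" using zdvd_imp_le[of "p ^ t" i] s by linarith
  hence "p ^ t < p ^ Suc \<tau>" using \<tau> by linarith
  hence "t \<le> \<tau>" using p prime_gt_1_int[of p] by (simp add: power_strict_increasing_iff del: power_Suc)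
  thus "(\<forall>r\<in>R e. p ^ ((e + 1) div 2) dvd Y r) \<and> (e + 1) div 2 \<le> \<tau>" using all by (simp add: t_def)
next
  assume "\<tau> \<ge> 1"
  have "p ^ (\<tau> - 1) \<le> p ^ \<tau>" using p prime_gt_1_int[of p] by (intro power_increasing) auto
  hence "p ^ (\<tau> - 1) \<le> int k" using \<tau>(1) by linarith
  from below[OF this] have D: "p ^ (2 * \<tau> - 1) dvd D" "p = 2 \<longrightarrow> p ^ (2 * \<tau>) dvd D"
    using \<open>\<tau> \<ge> 1\<close> by (auto simp: diff_mult_distrib2 numeral_2_eq_2 Suc_diff_Suc)
  show "\<exists>r\<in>R (2 * \<tau> - 1). p ^ \<tau> dvd Y r"
  proof (cases "odd p")
    case False
    hence "p = 2" using p by (metis primes_dvd_imp_eq two_is_prime)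
    thus ?thesis using witness_even[OF _ \<open>\<tau> \<ge> 1\<close>] D by simp
  qed (use witness_odd D in blast)
qed

text \<open>A zero modulo \<open>p ^ Suc d\<close> would make \<open>D\<close> congruent to
  \<open>(Y r)\<^sup>2\<close> modulo \<open>p ^ Suc d\<close>; then \<open>d\<close> would be even
  and \<open>D div p ^ d\<close> a square modulo \<open>p\<close>. So \<open>e \<le> d\<close>, and
  \<open>p ^ e\<close> divides \<open>(Y r)\<^sup>2\<close>.\<close>

lemma nonsplit_odd:
  assumes "odd p" and d: "p ^ d dvd D" "\<not> p ^ Suc d dvd D"
    and ns: "odd d \<or> (\<forall>u. \<not> p dvd u\<^sup>2 - D div p ^ d)"
    and r: "r \<in> R e"
  shows "p ^ ((e + 1) div 2) dvd Y r \<and> (e + 1) div 2 \<le> (d + 1) div 2"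
proof -
  have ed: "e \<le> d"
  proof (rule ccontr)
    assume "\<not> ?thesis"
    hence "p ^ Suc d dvd F r" using r power_dvd_le[of p e "F r" "Suc d"] by (simp add: R_def)
    hence F: "p ^ Suc d dvd 4 * a * F r" by simp
    hence "p ^ d dvd 4 * a * F r" by (rule power_dvd_le) simp
    hence "p ^ d dvd (Y r)\<^sup>2" unfolding Y_square using d(1) by simp
    hence Y: "p ^ ((d + 1) div 2) dvd Y r" by (simp add: pdvd_square_iff[OF p])
    from ns show False
    proof
      assume "odd d"
      hence "(Suc d + 1) div 2 = (d + 1) div 2" by presburger
      hence "p ^ Suc d dvd (Y r)\<^sup>2" using Y by (simp only: pdvd_square_iff[OF p])
      thus False using d(2) F unfolding Y_square by (simp add: dvd_add_left_iff)
    next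
      assume ns: "\<forall>u. \<not> p dvd u\<^sup>2 - D div p ^ d"
      show False
      proof (cases "odd d")
        case True
        hence "(Suc d + 1) div 2 = (d + 1) div 2" by presburger
        hence "p ^ Suc d dvd (Y r)\<^sup>2" using Y by (simp only: pdvd_square_iff[OF p])
        thus False using d(2) F unfolding Y_square by (simp add: dvd_add_left_iff)
      next
        case False
        hence dd: "2 * ((d + 1) div 2) = d" by presburger
        obtain u where u: "Y r = p ^ ((d + 1) div 2) * u" using Y by auto
        have "p ^ d * p dvd (Y r)\<^sup>2 - D" using F by (simp add: Y_square mult.commute)
        also have "(Y r)\<^sup>2 = p ^ d * u\<^sup>2"
          by (simp only: u power_mult_distrib power_mult[symmetric] mult.commute[of _ "2::nat"] dd)
        also have "p ^ d * u\<^sup>2 - D = p ^ d * (u\<^sup>2 - D div p ^ d)" using d(1) by (simp add: right_diff_distrib)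
        finally have "p dvd u\<^sup>2 - D div p ^ d" using p by simp
        thus False using ns by blast
      qed
    qed
  qed
  have "p ^ e dvd D" by (rule power_dvd_le[OF d(1) ed])
  moreover have "p ^ e dvd 4 * a * F r" using r by (simp add: R_def)
  ultimately have "p ^ e dvd (Y r)\<^sup>2" unfolding Y_square by (rule dvd_add)
  thus ?thesis using ed by (simp add: pdvd_square_iff[OF p] div_le_mono)
qed

text \<open>If \<open>Y r\<close> were \<open>2 ^ w * u\<close> with \<open>u\<close> odd and
  \<open>w < (e + 1) div 2\<close>, then \<open>D\<close> would be \<open>4 ^ w\<close> times a
  number congruent to \<open>u\<^sup>2\<close>, hence to 1, modulo 8.\<close>

lemma nonsplit_two:
  assumes "p = 2" and M: "\<And>t. 2 ^ (2 * t) dvd D \<Longrightarrow> t \<le> M"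
    and ns: "\<And>w x. D = 2 ^ (2 * w) * x \<Longrightarrow> \<not> 8 dvd x - 1"
    and r: "r \<in> R e"
  shows "p ^ ((e + 1) div 2) dvd Y r \<and> (e + 1) div 2 \<le> M"
proof -
  define t where "t = (e + 1) div 2"
  obtain f where "F r = p ^ e * f" using r by (auto simp: R_def)
  hence f: "F r = 2 ^ e * f" using assms(1) by simp
  have D: "D = (Y r)\<^sup>2 - 2 ^ (e + 2) * (a * f)" using Y_square[of r] by (simp add: f power_add)
  have Y: "2 ^ t dvd Y r"
  proof (rule ccontr)
    assume "\<not> ?thesis"
    then obtain w where w: "w < t" "2 ^ w dvd Y r" "\<not> 2 ^ Suc w dvd Y r" by (rule pdvd_exact)
    obtain u where u: "Y r = 2 ^ w * u" using w(2) by auto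
    have "odd u" using w(3) u by auto
    then obtain v where v: "u = 2 * v + 1" by (rule oddE)
    have "even (v * (v + 1))" by simp
    then obtain v' where "v * (v + 1) = 2 * v'" by blast
    hence "u\<^sup>2 - 1 = 8 * v'" by (simp add: v power2_eq_square algebra_simps)
    hence "8 dvd u\<^sup>2 - 1" by simp
    \<comment> \<open>The factor 4 in \<open>4 * a * F r\<close> raises \<open>e\<close> to
      \<open>e + 2\<close>, so the error term is still divisible by 8 after division by
      \<open>4 ^ w\<close>.\<close>
    have "2 * w + 3 \<le> e + 2" using w(1) by (simp add: t_def)
    then obtain j where j: "e + 2 = 2 * w + 3 + j" using le_Suc_ex by blast
    have "D = 2 ^ (2 * w) * u\<^sup>2 - 2 ^ (2 * w + 3 + j) * (a * f)"
      by (simp only: D u j power_mult_distrib power_mult[symmetric] mult.commute[of w 2])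
    also have "\<dots> = 2 ^ (2 * w) * (u\<^sup>2 - 8 * (2 ^ j * (a * f)))"
      by (simp only: power_add) (simp add: algebra_simps)
    finally have "D = 2 ^ (2 * w) * (u\<^sup>2 - 8 * (2 ^ j * (a * f)))" .
    hence "\<not> 8 dvd (u\<^sup>2 - 8 * (2 ^ j * (a * f))) - 1" by (rule ns)
    moreover have "8 dvd (u\<^sup>2 - 1) - 8 * (2 ^ j * (a * f))" using \<open>8 dvd u\<^sup>2 - 1\<close> by (rule dvd_diff) simp
    ultimately show False by (simp add: algebra_simps)
  qed
  hence "(2 ^ t)\<^sup>2 dvd (Y r)\<^sup>2" by (rule dvd_power_same)
  hence "2 ^ (2 * t) dvd (Y r)\<^sup>2" by (simp add: mult.commute flip: power_mult)
  moreover have "(2::int) ^ (2 * t) dvd 2 ^ (e + 2) * (a * f)"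
    by (intro dvd_mult2 le_imp_power_dvd) (simp add: t_def)
  ultimately have "2 ^ (2 * t) dvd D" unfolding D by (rule dvd_diff)
  thus ?thesis using Y M assms(1) by (simp add: t_def)
qed

end

text \<open>For \<open>a = 2 * m + 1\<close> and \<open>u = 2 * n + 1\<close> the product is
  \<open>4 * (m - n) * (m + n + 1)\<close>, where the last two factors have opposite parity.\<close>

lemma odd_square_diff:
  fixes a u :: int
  assumes "odd a" "odd u"
  shows "8 dvd (a - u) * (a + u)"
proof -
  obtain m n where mn: "a = 2 * m + 1" "u = 2 * n + 1" using assms by (auto elim!: oddE)
  have "even ((m - n) * (m + n + 1))" by auto
  then obtain l where "(m - n) * (m + n + 1) = 2 * l" by blast
  hence "(a - u) * (a + u) = 8 * l" by (simp add: mn algebra_simps)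
  thus ?thesis by simp
qed

context quad_unit
begin

text \<open>If \<open>i\<close> has valuation \<open>j\<close>, then
  \<open>a\<^sup>2 * i\<^sup>2\<close> has valuation \<open>2 * j\<close>, less than that of
  \<open>D\<close>; so \<open>i * (a\<^sup>2 * i\<^sup>2 - D)\<close> has valuation
  \<open>3 * j\<close>, largest for \<open>i = p ^ \<tau>\<close>.\<close>

lemma below_BB:
  assumes \<tau>: "p ^ \<tau> \<le> int k" "int k < p ^ Suc \<tau>"
    and below: "\<And>w. p ^ w \<le> int k \<Longrightarrow> p ^ (2 * w + 1) dvd D"
  shows "BB e \<longleftrightarrow> e \<le> 3 * \<tau>"
proof
  assume "BB e"
  then obtain i where i: "1 \<le> i" "i \<le> int k" "p ^ e dvd i * (a\<^sup>2 * i\<^sup>2 - D)" by (auto simp: BB_def)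
  have "\<not> p ^ Suc \<tau> dvd i" using zdvd_imp_le[of "p ^ Suc \<tau>" i] i \<tau> by linarith
  then obtain j where j: "j < Suc \<tau>" "p ^ j dvd i" "\<not> p ^ Suc j dvd i" by (rule pdvd_exact)
  have "p ^ j \<le> int k" using zdvd_imp_le[OF j(2)] i by linarith
  hence D: "p ^ (2 * j + 1) dvd D" by (rule below)
  have "\<not> p ^ (2 * j + 1) dvd a\<^sup>2 * i\<^sup>2 - D"
  proof
    assume "p ^ (2 * j + 1) dvd a\<^sup>2 * i\<^sup>2 - D"
    hence "p ^ (2 * j + 1) dvd (a * i)\<^sup>2" using D by (simp add: power_mult_distrib dvd_diff_left_iff)
    hence "p ^ Suc j dvd a * i" unfolding pdvd_square_iff[OF p] by simp
    thus False using j(3) pdvd_cancel_unit[OF p pa] by blast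
  qed
  moreover have "p ^ (e - j) dvd a\<^sup>2 * i\<^sup>2 - D" by (rule pdvd_cancel[OF p j(3) i(3)])
  ultimately have "\<not> 2 * j + 1 \<le> e - j" using power_dvd_le by blast
  thus "e \<le> 3 * \<tau>" using j(1) by linarith
next
  assume e: "e \<le> 3 * \<tau>"
  have "p ^ (2 * \<tau>) dvd D" by (rule power_dvd_le[OF below[OF \<tau>(1)]]) simp
  moreover have "p ^ (2 * \<tau>) dvd a\<^sup>2 * (p ^ \<tau>)\<^sup>2" by (simp add: mult.commute flip: power_mult)
  ultimately have "p ^ \<tau> * p ^ (2 * \<tau>) dvd p ^ \<tau> * (a\<^sup>2 * (p ^ \<tau>)\<^sup>2 - D)"
    by (intro mult_dvd_mono dvd_diff) auto
  hence "p ^ (\<tau> + 2 * \<tau>) dvd p ^ \<tau> * (a\<^sup>2 * (p ^ \<tau>)\<^sup>2 - D)" by (simp only: power_add)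
  hence "p ^ e dvd p ^ \<tau> * (a\<^sup>2 * (p ^ \<tau>)\<^sup>2 - D)" by (rule power_dvd_le) (use e in simp)
  moreover have "1 \<le> p ^ \<tau>" using p prime_gt_0_int[of p] by (simp add: int_one_le_iff_zero_less)
  ultimately show "BB e" unfolding BB_def using \<tau> by blast
qed

text \<open>Choose \<open>r\<close> with \<open>Y r\<close> congruent to \<open>p ^ M * u\<close>
  modulo \<open>p ^ Suc M\<close>; then \<open>p ^ Suc (2 * M)\<close> divides
  \<open>(Y r)\<^sup>2 - D\<close>.\<close>

lemma R_one_nonempty_odd:
  assumes "odd p" "p ^ (2 * M) dvd D" "p dvd u\<^sup>2 - D div p ^ (2 * M)"
  shows "R (Suc (2 * M)) \<noteq> {}"
proof -
  have p2: "\<not> p dvd 2" using assms(1) p by (metis primes_dvd_imp_eq two_is_prime dvd_refl)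
  hence unit: "\<not> p dvd 2 * a" using p pa by (simp add: prime_dvd_mult_iff)
  then obtain r where "p ^ Suc M dvd 2 * a * r + (b - p ^ M * u)" using solve_linear by blast
  then obtain v where "2 * a * r + (b - p ^ M * u) = p ^ Suc M * v" by blast
  hence Y: "Y r = p ^ M * (u + p * v)" by (simp add: Y_def algebra_simps)
  define D' where "D' = D div p ^ (2 * M)"
  have D: "D = p ^ (2 * M) * D'" using assms(2) by (simp add: D'_def)
  obtain w where w: "u\<^sup>2 - D' = p * w" using assms(3) by (auto simp: D'_def)
  have "2 * (2 * a * F r) = (Y r)\<^sup>2 - D" by (simp add: Y_square)
  also have "\<dots> = p ^ (2 * M) * ((u + p * v)\<^sup>2 - D')"
    by (simp only: Y D power_mult_distrib power_mult[symmetric] mult.commute[of M 2] right_diff_distrib)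
  also have "(u + p * v)\<^sup>2 - D' = p * (w + 2 * u * v + p * v\<^sup>2)"
    using w by (simp add: power2_eq_square algebra_simps)
  finally have "p ^ Suc (2 * M) dvd 2 * (2 * a * F r)" by simp
  hence "r \<in> R (Suc (2 * M))"
    unfolding pdvd_cancel_unit[OF p p2] pdvd_cancel_unit[OF p unit] by (simp add: R_def)
  thus ?thesis by blast
qed

text \<open>Once \<open>Y r = 2 ^ M * u\<close> with \<open>u\<close> odd,
  \<open>4 * a * F r\<close> is \<open>4 ^ M * (u\<^sup>2 - x)\<close>, and 8 divides the second
  factor: cancelling 4 leaves one additional factor 2.\<close>

lemma R_one_nonempty_two:
  assumes "p = 2" "D = 2 ^ (2 * M) * x" "8 dvd x - 1"
  shows "R (Suc (2 * M)) \<noteq> {}"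
proof -
  have "\<exists>r u. Y r = 2 ^ M * u \<and> odd u"
  proof (cases M)
    case 0
    have "odd x" using assms(3) by presburger
    hence "odd (b\<^sup>2)" using assms(2) 0 by (auto simp: D_def)
    hence "odd (Y 0)" by (simp add: Y_def)
    thus ?thesis using 0 by auto
  next
    case (Suc m)
    hence "even D" using assms(2) by simp
    hence "even (b\<^sup>2)" by (simp add: D_def)
    then obtain \<beta> where \<beta>: "b = 2 * \<beta>" by (auto elim!: evenE)
    obtain r where "p ^ Suc m dvd a * r + (\<beta> - 2 ^ m)" using solve_linear[OF pa] by blast
    then obtain v where "a * r + (\<beta> - 2 ^ m) = 2 ^ Suc m * v" using assms(1) by auto
    hence "2 * a * r + b = 2 ^ M * (1 + 2 * v)" unfolding \<beta> Suc by (simp add: algebra_simps)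
    hence "Y r = 2 ^ M * (1 + 2 * v)" by (simp only: Y_def)
    thus ?thesis by (intro exI[of _ r] exI[of _ "1 + 2 * v"]) simp
  qed
  then obtain r u where ru: "Y r = 2 ^ M * u" "odd u" by blast
  have "8 dvd (u - 1) * (u + 1)" by (rule odd_square_diff) (use ru in auto)
  moreover have "(u - 1) * (u + 1) = u\<^sup>2 - 1" by (simp add: power2_eq_square algebra_simps)
  ultimately have "8 dvd u\<^sup>2 - 1" by simp
  hence "8 dvd (u\<^sup>2 - 1) - (x - 1)" using assms(3) by (rule dvd_diff)
  then obtain w where w: "u\<^sup>2 - x = 8 * w" by auto
  have "4 * (a * F r) = (Y r)\<^sup>2 - D" by (simp add: Y_square)
  also have "\<dots> = 2 ^ (2 * M) * (u\<^sup>2 - x)"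
    by (simp only: ru assms(2) power_mult_distrib power_mult[symmetric] mult.commute[of M 2] right_diff_distrib)
  also have "\<dots> = 4 * (2 ^ Suc (2 * M) * w)" by (simp add: w)
  finally have "a * F r = p ^ Suc (2 * M) * w" using assms(1) by simp
  hence "p ^ Suc (2 * M) dvd a * F r" by simp
  hence "r \<in> R (Suc (2 * M))" unfolding pdvd_cancel_unit[OF p pa] by (simp add: R_def)
  thus ?thesis by blast
qed

end

section \<open>The split case\<close>

text \<open>The valuation of \<open>D\<close> is exactly \<open>2 * M\<close>, and
  \<open>R_ne\<close> expresses, for odd \<open>p\<close> and \<open>p = 2\<close> alike, that the
  unit part of \<open>D\<close> is a \<open>p\<close>-adic square. \<open>N\<close> is the valuation
  of \<open>B_num\<close>.\<close>

locale quad_split = quad_unit +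
  fixes M N :: nat
  assumes D_dvd: "p ^ (2 * M) dvd D" and D_ndvd: "\<not> p ^ Suc (2 * M) dvd D"
    and R_ne: "R (Suc (2 * M)) \<noteq> {}"
    and pM: "p ^ M \<le> int k"
    and BB_N: "BB N" and BB_le: "\<And>e. BB e \<Longrightarrow> e \<le> N"
begin

lemma Y_low: "r \<in> R e \<Longrightarrow> e \<le> 2 * M \<Longrightarrow> p ^ ((e + 1) div 2) dvd Y r"
proof -
  assume r: "r \<in> R e" and e: "e \<le> 2 * M"
  have "p ^ e dvd D" by (rule power_dvd_le[OF D_dvd e])
  moreover have "p ^ e dvd 4 * a * F r" using r by (simp add: R_def)
  ultimately have "p ^ e dvd (Y r)\<^sup>2" unfolding Y_square by (rule dvd_add)
  thus ?thesis by (simp add: pdvd_square_iff[OF p])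
qed

text \<open>\<open>(Y r)\<^sup>2\<close> agrees with \<open>D\<close> modulo
  \<open>p ^ Suc (2 * M)\<close>.\<close>

lemma Y_high:
  assumes r: "r \<in> R e" and e: "2 * M < e"
  shows "p ^ M dvd Y r" "\<not> p ^ Suc M dvd Y r"
proof -
  have "r \<in> R (2 * M)" using r R_anti[of "2 * M" e] e by auto
  from Y_low[OF this] show "p ^ M dvd Y r" by simp
  have "p ^ Suc (2 * M) dvd F r" using r power_dvd_le[of p e _ "Suc (2 * M)"] e by (simp add: R_def)
  hence F: "p ^ Suc (2 * M) dvd 4 * a * F r" by simp
  show "\<not> p ^ Suc M dvd Y r"
  proof
    assume "p ^ Suc M dvd Y r"
    hence "p ^ Suc (2 * M) dvd (Y r)\<^sup>2" unfolding pdvd_square_iff[OF p] by simp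
    thus False using D_ndvd F unfolding Y_square by (simp add: dvd_add_left_iff)
  qed
qed

lemma R_nonempty: "\<exists>r. r \<in> R e"
proof -
  have "\<exists>r. r \<in> R (Suc (2 * M) + j)" for j
  proof (induction j)
    case (Suc j)
    then obtain r where r: "r \<in> R (Suc (2 * M) + j)" by blast
    show ?case using R_lift[OF r Y_high[OF r]] by auto
  qed (use R_ne in auto)
  from this[of e] show ?thesis using R_anti[of e "Suc (2 * M) + e"] by auto
qed

text \<open>In both cases of \<open>double_class\<close> the factors \<open>i\<close> and \<open>a * i - Y r\<close> of
  \<open>i * (a\<^sup>2 * i\<^sup>2 - D)\<close> contribute at least \<open>p ^ M\<close> each.\<close>

lemma close_factor:
  assumes e: "2 * M < e" and r: "r \<in> R e" and i: "p ^ e dvd i * (a * i + Y r)"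
  shows "p ^ M dvd i" "p ^ (e - M) dvd i \<or> p ^ (e - M) dvd a * i + Y r"
proof -
  note Y = Y_high[OF r e]
  show *: "p ^ (e - M) dvd i \<or> p ^ (e - M) dvd a * i + Y r"
    using double_class[OF r Y e, of i] R_add_iff[OF r] i by simp
  thus "p ^ M dvd i"
  proof
    assume "p ^ (e - M) dvd i"
    thus ?thesis by (rule power_dvd_le) (use e in simp)
  next
    assume "p ^ (e - M) dvd a * i + Y r"
    hence "p ^ M dvd a * i + Y r" by (rule power_dvd_le) (use e in simp)
    hence "p ^ M dvd a * i" using Y(1) by (simp add: dvd_add_left_iff)
    thus ?thesis by (simp add: pdvd_cancel_unit[OF p pa])
  qed
qed

lemma BB_I:
  assumes "1 \<le> i" "i \<le> int k" "p ^ e dvd i * (4 * a * F r)"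
    and "p ^ e dvd i * ((a * i - Y r) * (a * i + Y r))"
  shows "BB e"
proof -
  have "p ^ e dvd i * ((a * i - Y r) * (a * i + Y r)) + i * (4 * a * F r)"
    using assms(4,3) by (rule dvd_add)
  thus ?thesis unfolding BB_def factor[of _ r] using assms
    by (intro exI[of _ i]) (simp add: distrib_left)
qed

lemma F_part: "r \<in> R e' \<Longrightarrow> p ^ M dvd i \<Longrightarrow> e \<le> M + e' \<Longrightarrow> p ^ e dvd i * (4 * a * F r)"
proof (rule power_dvd_le)
  assume "r \<in> R e'" "p ^ M dvd i"
  thus "p ^ (M + e') dvd i * (4 * a * F r)"
    unfolding power_add by (intro mult_dvd_mono) (auto simp: R_def)
qed

lemma F_part_two:
  assumes "p = 2" "r \<in> R e'" "p ^ M dvd i" "e \<le> M + e' + 2"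
  shows "p ^ e dvd i * (4 * a * F r)"
proof (rule power_dvd_le)
  have "p ^ M * p ^ e' dvd i * F r" using assms(2,3) by (intro mult_dvd_mono) (auto simp: R_def)
  hence "4 * (p ^ M * p ^ e') dvd 4 * (a * (i * F r))" by simp
  thus "p ^ (M + e' + 2) dvd i * (4 * a * F r)" by (simp add: power_add assms(1) mult_ac)
qed (fact assms)

text \<open>Multiplying \<open>i * (a * i + Y r)\<close> by the remaining factor
  \<open>a * i - Y r\<close> adds \<open>M\<close> to the exponent.\<close>

lemma close_le:
  assumes e: "2 * M < e" and "close k (R e)"
  shows "e + M \<le> N"
proof -
  obtain r i where i: "1 \<le> i" "i \<le> int k" "r \<in> R e" "p ^ e dvd i * (a * i + Y r)"
    using assms(2) by (rule closeE)
  have pi: "p ^ M dvd i" using close_factor[OF e i(3,4)] by simp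
  have "p ^ e * p ^ M dvd (i * (a * i + Y r)) * (a * i - Y r)"
    using i(4) pi Y_high(1)[OF i(3) e] by (intro mult_dvd_mono dvd_diff) auto
  hence *: "p ^ (e + M) dvd i * ((a * i - Y r) * (a * i + Y r))" by (simp add: power_add mult_ac)
  have "BB (e + M)" by (rule BB_I[OF i(1,2) F_part[OF i(3) pi] *]) simp
  thus ?thesis by (rule BB_le)
qed

lemma N_ge: "3 * M \<le> N"
proof -
  have "p ^ (2 * M) dvd a\<^sup>2 * (p ^ M)\<^sup>2" by (simp add: mult.commute flip: power_mult)
  hence "p ^ (2 * M) dvd a\<^sup>2 * (p ^ M)\<^sup>2 - D" using D_dvd by simp
  hence "p ^ M * p ^ (2 * M) dvd p ^ M * (a\<^sup>2 * (p ^ M)\<^sup>2 - D)" by simp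
  hence "p ^ (M + 2 * M) dvd p ^ M * (a\<^sup>2 * (p ^ M)\<^sup>2 - D)" by (simp only: power_add)
  moreover have "1 \<le> p ^ M" using p prime_gt_0_int[of p] by (simp add: int_one_le_iff_zero_less)
  ultimately have "BB (M + 2 * M)" unfolding BB_def using pM by blast
  thus ?thesis using BB_le by force
qed

text \<open>Let \<open>i\<close> attain the valuation \<open>N\<close>. For a zero \<open>r\<close>
  modulo \<open>p ^ N\<close>, \<open>a\<^sup>2 * i\<^sup>2 - D\<close> may be replaced by
  \<open>(a * i - Y r) * (a * i + Y r)\<close>. All three factors contain \<open>p ^ M\<close>, and
  up to a loss \<open>\<kappa>\<close> caused by the 2 in \<open>2 * a * i\<close> only one contains
  more. Dropping one of \<open>a * i - Y r\<close> and \<open>a * i + Y r\<close> leaves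
  \<open>p ^ (N - M - \<kappa>)\<close>, so \<open>r + i\<close> or \<open>r - i\<close> is a second
  zero.\<close>

lemma close_top:
  fixes \<kappa> :: nat
  assumes \<kappa>: "\<And>m x. p ^ Suc (m + \<kappa>) dvd 2 * x \<Longrightarrow> p ^ Suc m dvd x"
    and E: "3 * M + \<kappa> < N"
  shows "close k (R (N - M - \<kappa>))"
proof -
  define E where "E = N - M - \<kappa>"
  have EM: "p ^ E = p ^ M * p ^ (N - 2 * M - \<kappa>)" using E by (simp add: E_def flip: power_add)
  obtain i where i: "1 \<le> i" "i \<le> int k" "p ^ N dvd i * (a\<^sup>2 * i\<^sup>2 - D)" using BB_N by (auto simp: BB_def)
  obtain r where r: "r \<in> R N" using R_nonempty by blast
  have "2 * M < N" using E by linarith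
  note Y = Y_high[OF r this]
  have rE: "r \<in> R E" using r R_anti[of E N] by (auto simp: E_def)
  have "p ^ N dvd i * (4 * a * F r)" using r by (simp add: R_def)
  with i(3) have N: "p ^ N dvd i * ((a * i - Y r) * (a * i + Y r))"
    unfolding factor[of i r] by (simp add: distrib_left dvd_add_left_iff)
  have ai: "p ^ m dvd a * i \<longleftrightarrow> p ^ m dvd i" for m by (rule pdvd_cancel_unit[OF p pa])
  \<comment> \<open>Otherwise all three factors would have valuation \<open>j < M\<close>, although
    \<open>N > 3 * M\<close>.\<close>
  have Mi: "p ^ M dvd i"
  proof (rule ccontr)
    assume "\<not> ?thesis"
    then obtain j where j: "j < M" "p ^ j dvd i" "\<not> p ^ Suc j dvd i" by (rule pdvd_exact)
    have Yj: "p ^ Suc j dvd Y r" by (rule power_dvd_le[OF Y(1)]) (use j in simp)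
    have n: "\<not> p ^ Suc j dvd a * i - Y r" "\<not> p ^ Suc j dvd a * i + Y r"
      using Yj j(3) ai[of "Suc j"] by (simp_all add: dvd_diff_left_iff dvd_add_left_iff del: power_Suc)
    have "p ^ (N - j - j) dvd a * i + Y r"
      by (intro pdvd_cancel[OF p n(1)] pdvd_cancel[OF p j(3)] N)
    hence "p ^ Suc j dvd a * i + Y r" by (rule power_dvd_le) (use j(1) E in linarith)
    thus False using n(2) by contradiction
  qed
  \<comment> \<open>If \<open>i\<close> has valuation above \<open>M\<close>, the other two factors
    have exactly \<open>M\<close>. Otherwise \<open>i\<close> has valuation \<open>M\<close>, and
    the other two, whose sum is \<open>2 * a * i\<close>, are not both divisible by
    \<open>p ^ Suc (M + \<kappa>)\<close>.\<close>
  have "p ^ E dvd i * (a * i + Y r) \<or> p ^ E dvd i * (a * i - Y r)"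
  proof (cases "p ^ Suc M dvd i")
    case True
    hence n: "\<not> p ^ Suc M dvd a * i - Y r" "\<not> p ^ Suc M dvd a * i + Y r"
      using Y(2) ai[of "Suc M"] by (simp_all add: dvd_diff_right_iff dvd_add_right_iff del: power_Suc)
    have "p ^ N dvd (a * i - Y r) * ((a * i + Y r) * i)" using N by (simp add: mult_ac)
    hence "p ^ (N - M - M) dvd i" by (intro pdvd_cancel[OF p n(2)] pdvd_cancel[OF p n(1)])
    hence "p ^ (N - 2 * M - \<kappa>) dvd i" by (rule power_dvd_le) simp
    moreover have "p ^ M dvd a * i + Y r" using Mi Y(1) by simp
    ultimately have "p ^ (N - 2 * M - \<kappa>) * p ^ M dvd i * (a * i + Y r)" by (rule mult_dvd_mono)
    thus ?thesis unfolding EM by (simp add: mult.commute)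
  next
    case False
    have N': "p ^ (N - M) dvd (a * i - Y r) * (a * i + Y r)" by (rule pdvd_cancel[OF p False N])
    have eqs: "N - M - (M + \<kappa>) = N - 2 * M - \<kappa>" by simp
    show ?thesis
    proof (cases "p ^ Suc (M + \<kappa>) dvd a * i - Y r")
      case False
      have "p ^ (N - M - (M + \<kappa>)) dvd a * i + Y r" by (rule pdvd_cancel[OF p False N'])
      thus ?thesis unfolding EM eqs using Mi by (intro disjI1 mult_dvd_mono)
    next
      case True
      have n: "\<not> p ^ Suc (M + \<kappa>) dvd a * i + Y r"
      proof
        assume "p ^ Suc (M + \<kappa>) dvd a * i + Y r"
        hence "p ^ Suc (M + \<kappa>) dvd (a * i - Y r) + (a * i + Y r)" using True by (rule dvd_add[rotated])
        hence "p ^ Suc (M + \<kappa>) dvd 2 * (a * i)" by simp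
        hence "p ^ Suc M dvd a * i" by (rule \<kappa>)
        thus False using False ai by blast
      qed
      have "p ^ (N - M - (M + \<kappa>)) dvd a * i - Y r"
        by (rule pdvd_cancel[OF p n]) (use N' in \<open>simp add: mult.commute\<close>)
      thus ?thesis unfolding EM eqs using Mi by (intro disjI2 mult_dvd_mono)
    qed
  qed
  thus ?thesis using closeI[OF rE i(1,2)] closeI'[OF rE i(1,2)] by (auto simp: E_def)
qed

text \<open>The top close level is \<open>N - M - \<kappa>\<close>, and its two classes have modulus
  exponent \<open>M\<close> less. The loss \<open>\<kappa>\<close> is taken as 0 for odd
  \<open>p\<close> and 1 for \<open>p = 2\<close>.\<close>

lemma split_exponent:
  fixes \<kappa> :: nat
  assumes \<kappa>: "\<And>m x. p ^ Suc (m + \<kappa>) dvd 2 * x \<Longrightarrow> p ^ Suc m dvd x"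
    and N: "3 * M + \<kappa> < N"
    and upper: "\<And>e. 2 * M < e \<Longrightarrow> close k (R e) \<Longrightarrow> e + M + \<kappa> \<le> N"
    and cases: "odd p \<or> Suc M < N - 2 * M - \<kappa> \<and> int k + 1 < p ^ (N - 2 * M - \<kappa>)"
  shows "has_exponent p (total_excess k R N)
           (if p ^ (N - 2 * M - \<kappa>) dvd int k + 1 then 0 else N - 2 * M - \<kappa>)"
proof (rule double_class_exponent[OF p pa, where E = "N - M - \<kappa>" and w = M])
  have dc: "r + z \<in> R e \<longleftrightarrow> p ^ (e - M) dvd z \<or> p ^ (e - M) dvd a * z + Y r"
    if "r \<in> R e" "2 * M < e" for r z e
    by (rule double_class[OF that(1) Y_high[OF that] that(2)])
  {
    fix e assume e: "1 \<le> e" "e < N - M - \<kappa>"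
    show "periodic (\<lambda>x. x \<in> R e) (p ^ (N - 2 * M - \<kappa> - 1))"
    proof (cases "e \<le> 2 * M")
      case True
      have "class_mod (p ^ ((e + 1) div 2)) (R e)" using single_class Y_low[OF _ True] by blast
      thus ?thesis by (rule class_mod_periodic) (use True N in \<open>intro le_imp_power_dvd, linarith\<close>)
    next
      case False
      hence e2: "2 * M < e" by simp
      have "p ^ (e - M) dvd p ^ (N - 2 * M - \<kappa> - 1)"
        by (intro le_imp_power_dvd) (use e in linarith)
      thus ?thesis using dc[OF _ e2, of _ "p ^ (N - 2 * M - \<kappa> - 1)"]
          dc[OF _ e2, of _ "- (p ^ (N - 2 * M - \<kappa> - 1))"]
        by (intro periodic_setI) auto
    qed
  next
    fix s assume s: "s \<in> R (N - M - \<kappa>)"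
    have E: "2 * M < N - M - \<kappa>" and eq: "N - M - \<kappa> - M = N - 2 * M - \<kappa>" using N by auto
    show "\<exists>y. p ^ M dvd y \<and> \<not> p ^ Suc M dvd y \<and> (\<forall>z. s + z \<in> R (N - M - \<kappa>) \<longleftrightarrow>
             p ^ (N - 2 * M - \<kappa>) dvd z \<or> p ^ (N - 2 * M - \<kappa>) dvd a * z + y)"
      using Y_high[OF s E] dc[OF s E] unfolding eq by blast
  next
    fix e assume "N - M - \<kappa> < e" "e \<le> N"
    thus "\<not> close k (R e)" using upper[of e] N by linarith
  }
qed (use N cases close_top[OF \<kappa> N] in auto)

text \<open>If \<open>N = 3 * M\<close>, no level above \<open>2 * M\<close> is close, so all close
  levels are single classes, with moduli at most \<open>p ^ M\<close>.\<close>

lemma split_odd_exponent: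
  assumes "odd p"
  shows "has_exponent p (total_excess k R N) (if p ^ (N - 2 * M) dvd int k + 1 then 0 else N - 2 * M)"
proof (cases "3 * M < N")
  case True
  have p2: "\<not> p dvd 2" using assms(1) p by (metis primes_dvd_imp_eq two_is_prime dvd_refl)
  show ?thesis
    using split_exponent[of 0] pdvd_cancel_unit[OF p p2] True close_le assms
    by (simp only: add_0_right diff_zero) blast
next
  case False
  hence N: "N - 2 * M = M" using N_ge by simp
  show ?thesis unfolding N
  proof (rule single_exponent[OF pM BB_le])
    fix e assume c: "close k (R e)"
    have "e \<le> 2 * M" using close_le[OF _ c] False by linarith
    thus "(\<forall>r\<in>R e. p ^ ((e + 1) div 2) dvd Y r) \<and> (e + 1) div 2 \<le> M" using Y_low by auto
  next
    have "p ^ (2 * M - 1) dvd D" by (rule power_dvd_le[OF D_dvd]) simp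
    thus "\<exists>r\<in>R (2 * M - 1). p ^ M dvd Y r" by (rule witness_odd[OF assms])
  qed
qed

text \<open>Windows this long contain an \<open>i\<close> for which one of
  \<open>a * i + Y r\<close> and \<open>a * i - Y r\<close> is divisible by
  \<open>2 ^ (e - M + 1)\<close>. The other differs from it by \<open>2 * Y r\<close> and is
  divisible by \<open>2 ^ Suc M\<close>, while \<open>2 ^ M\<close> divides \<open>i\<close>; the
  exponents add up to \<open>e + M + 2\<close>.\<close>

lemma big_two:
  assumes p2: "p = 2" and e: "2 * M < e" and k: "2 ^ (e - M) \<le> int k + 1"
  shows "e + M + 2 \<le> N"
proof -
  define t where "t = e - M"
  have t: "M < t" "e = t + M" using e by (auto simp: t_def)
  obtain r where r: "r \<in> R (Suc e)" using R_nonempty by blast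
  note Y = Y_high[OF r less_SucI[OF e]]
  obtain j0 where j0: "p ^ Suc t dvd a * j0 + Y r" using solve_linear[OF pa] by blast
  define j where "j = j0 mod 2 ^ Suc t"
  have "p ^ Suc t dvd a * j0 + Y r - a * (2 ^ Suc t * (j0 div 2 ^ Suc t))"
    using j0 by (intro dvd_diff) (simp_all add: p2)
  also have "a * j0 + Y r - a * (2 ^ Suc t * (j0 div 2 ^ Suc t)) = a * j + Y r"
    unfolding j_def by (simp add: minus_mult_div_eq_mod[symmetric] right_diff_distrib)
  finally have j: "p ^ Suc t dvd a * j + Y r" .
  have bounds: "0 \<le> j" "j < 2 * 2 ^ t" by (simp_all add: j_def)
  have ai: "p ^ m dvd a * i \<longleftrightarrow> p ^ m dvd i" for m i by (rule pdvd_cancel_unit[OF p pa])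
  \<comment> \<open>The valuation of \<open>j\<close> is that of \<open>Y r\<close>, namely
    \<open>M < t\<close>, so \<open>j\<close> is neither 0 nor \<open>2 ^ t\<close>.\<close>
  have "p ^ M dvd a * j + Y r" by (rule power_dvd_le[OF j]) (use t in simp)
  hence Mj: "p ^ M dvd j" using Y(1) ai by (simp add: dvd_add_left_iff)
  have "p ^ Suc M dvd a * j + Y r" by (rule power_dvd_le[OF j]) (use t in simp)
  hence nj: "\<not> p ^ Suc M dvd j" using Y(2) ai[of "Suc M" j] by (auto simp: dvd_add_right_iff simp del: power_Suc)
  have pt: "p ^ Suc M dvd 2 ^ t" using t p2 by (simp add: le_imp_power_dvd del: power_Suc)
  have "j \<noteq> 0" "j \<noteq> 2 ^ t" using nj pt by (auto simp del: power_Suc)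
  \<comment> \<open>If \<open>j\<close> is beyond \<open>2 ^ t\<close>, its reflection
    \<open>2 * 2 ^ t - j\<close> takes its place, with the sign of \<open>Y r\<close>
    changed.\<close>
  have "\<exists>i. 1 \<le> i \<and> i \<le> int k \<and> p ^ M dvd i \<and>
          (p ^ Suc t dvd a * i + Y r \<or> p ^ Suc t dvd a * i - Y r)"
  proof (cases "j < 2 ^ t")
    case True
    thus ?thesis using j Mj bounds \<open>j \<noteq> 0\<close> k by (intro exI[of _ j]) (auto simp: t_def)
  next
    case False
    have "p ^ Suc t dvd a * (2 * 2 ^ t) - (a * j + Y r)" using j by (intro dvd_diff) (simp_all add: p2)
    hence "p ^ Suc t dvd a * (2 * 2 ^ t - j) - Y r" by (simp add: algebra_simps)
    moreover have "p ^ M dvd 2 * 2 ^ t - j"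
      using Mj power_dvd_le[OF pt, of M] by (intro dvd_diff dvd_mult) auto
    ultimately show ?thesis using bounds False \<open>j \<noteq> 2 ^ t\<close> k
      by (intro exI[of _ "2 * 2 ^ t - j"]) (auto simp: t_def)
  qed
  then obtain i where i: "1 \<le> i" "i \<le> int k" "p ^ M dvd i"
    "p ^ Suc t dvd a * i + Y r \<or> p ^ Suc t dvd a * i - Y r" by blast
  have Y2: "p ^ Suc M dvd 2 * Y r" using Y(1) by (simp add: p2)
  have "p ^ (Suc t + Suc M) dvd (a * i - Y r) * (a * i + Y r)"
    using i(4)
  proof
    assume *: "p ^ Suc t dvd a * i + Y r"
    have "p ^ Suc M dvd (a * i + Y r) - 2 * Y r"
      by (intro dvd_diff Y2 power_dvd_le[OF *]) (use t in simp)
    hence "p ^ Suc M * p ^ Suc t dvd (a * i - Y r) * (a * i + Y r)"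
      using * by (intro mult_dvd_mono) (simp_all add: algebra_simps del: power_Suc)
    thus ?thesis by (simp add: power_add mult_ac)
  next
    assume *: "p ^ Suc t dvd a * i - Y r"
    have "p ^ Suc M dvd (a * i - Y r) + 2 * Y r"
      by (intro dvd_add Y2 power_dvd_le[OF *]) (use t in simp)
    hence "p ^ Suc t * p ^ Suc M dvd (a * i - Y r) * (a * i + Y r)"
      using * by (intro mult_dvd_mono) (simp_all add: algebra_simps del: power_Suc)
    thus ?thesis by (simp add: power_add mult_ac)
  qed
  hence "p ^ M * p ^ (Suc t + Suc M) dvd i * ((a * i - Y r) * (a * i + Y r))"
    by (intro mult_dvd_mono i(3))
  hence *: "p ^ (M + (Suc t + Suc M)) dvd i * ((a * i - Y r) * (a * i + Y r))"
    by (simp only: power_add)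
  have "BB (M + (Suc t + Suc M))" by (rule BB_I[OF i(1,2) F_part_two[OF p2 r i(3)] *]) (use t in simp)
  thus ?thesis using BB_le t by force
qed

text \<open>The 2 in \<open>2 * a * i\<close> costs one power, so \<open>\<kappa> = 1\<close>. By
  \<open>big_two\<close> the window length \<open>k + 1\<close> is less than the modulus
  \<open>2 ^ (N - 2 * M - 1)\<close>, which therefore cannot divide it.\<close>

lemma split_two_exponent:
  assumes p2: "p = 2"
  shows "has_exponent p (total_excess k R N) (N - (2 * M + 1))" "2 * M + 1 \<le> N"
proof -
  have upper: "e + M + 1 \<le> N" if e: "2 * M < e" and c: "close k (R e)" for e
  proof -
    obtain r i where i: "1 \<le> i" "i \<le> int k" "r \<in> R e" "p ^ e dvd i * (a * i + Y r)"
      using c by (rule closeE)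
    note Y = Y_high[OF i(3) e]
    from close_factor(2)[OF e i(3,4)] show ?thesis
    proof
      assume "p ^ (e - M) dvd i"
      hence "2 ^ (e - M) \<le> int k" using zdvd_imp_le[of "p ^ (e - M)" i] i unfolding p2 by linarith
      thus ?thesis using big_two[OF p2 e] by linarith
    next
      assume *: "p ^ (e - M) dvd a * i + Y r"
      have "p ^ Suc M dvd a * i + Y r" by (rule power_dvd_le[OF *]) (use e in simp)
      moreover have "p ^ Suc M dvd 2 * Y r" using Y(1) by (simp add: p2)
      ultimately have "p ^ Suc M dvd (a * i + Y r) - 2 * Y r" by (rule dvd_diff)
      hence "p ^ Suc M * p ^ e dvd (a * i - Y r) * (i * (a * i + Y r))"
        using i(4) by (intro mult_dvd_mono) (simp_all add: algebra_simps del: power_Suc)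
      hence "p ^ (e + M + 1) dvd i * ((a * i - Y r) * (a * i + Y r))"
        by (simp add: power_add mult_ac)
      moreover have "p ^ (e + M + 1) dvd i * (4 * a * F r)"
        by (rule F_part_two[OF p2 i(3) close_factor(1)[OF e i(3,4)]]) simp
      ultimately have "BB (e + M + 1)" by (intro BB_I[OF i(1,2)])
      thus ?thesis by (rule BB_le)
    qed
  qed
  \<comment> \<open>Take \<open>i = 2 ^ M\<close> and \<open>Y r = 2 ^ M * u\<close>: as
    \<open>a\<close> and \<open>u\<close> are odd, 8 divides
    \<open>a\<^sup>2 - u\<^sup>2\<close>.\<close>
  have N3: "3 * M + 3 \<le> N"
  proof -
    obtain r where r: "r \<in> R (2 * M + 3)" using R_nonempty by blast
    have Y: "p ^ M dvd Y r" "\<not> p ^ Suc M dvd Y r" using Y_high[OF r] by auto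
    obtain u where u: "Y r = p ^ M * u" using Y(1) by auto
    have "odd u" using Y(2) u p2 by auto
    moreover have "odd a" using pa p2 by simp
    ultimately have "8 dvd (a - u) * (a + u)"
      using odd_square_diff by simp
    hence "p ^ (3 * M) * 8 dvd p ^ (3 * M) * ((a - u) * (a + u))" by simp
    also have "p ^ (3 * M) * 8 = p ^ (3 * M + 3)" by (simp add: p2 power_add)
    also have "p ^ (3 * M) * ((a - u) * (a + u)) = p ^ M * ((a * p ^ M - Y r) * (a * p ^ M + Y r))"
      unfolding u by (simp add: numeral_3_eq_3 power_add algebra_simps)
    finally have *: "p ^ (3 * M + 3) dvd p ^ M * ((a * p ^ M - Y r) * (a * p ^ M + Y r))" .
    have "1 \<le> p ^ M" by (simp add: p2)
    hence "BB (3 * M + 3)" by (rule BB_I[OF _ pM F_part[OF r] *]) auto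
    thus ?thesis by (rule BB_le)
  qed
  thus "2 * M + 1 \<le> N" by simp
  \<comment> \<open>Otherwise \<open>big_two\<close> at the level \<open>N - M - 1\<close> would
    give \<open>N + 1 \<le> N\<close>.\<close>
  have small: "int k + 1 < p ^ (N - 2 * M - 1)"
  proof (rule ccontr)
    assume "\<not> ?thesis"
    hence "2 ^ (N - 2 * M - 1 + M - M) \<le> int k + 1" using p2 by simp
    hence "N - 2 * M - 1 + M + M + 2 \<le> N" using N3 by (intro big_two[OF p2]) auto
    thus False using N3 by linarith
  qed
  moreover have "\<not> p ^ (N - 2 * M - 1) dvd int k + 1"
    using zdvd_imp_le[of "p ^ (N - 2 * M - 1)" "int k + 1"] small by linarith
  moreover have \<kappa>: "p ^ Suc m dvd x" if "p ^ Suc (m + 1) dvd 2 * x" for m x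
  proof -
    have "2 * p ^ Suc m dvd 2 * x" using that p2 by simp
    thus ?thesis by (subst (asm) dvd_mult_cancel_left) simp
  qed
  have "has_exponent p (total_excess k R N)
           (if p ^ (N - 2 * M - 1) dvd int k + 1 then 0 else N - 2 * M - 1)"
    by (rule split_exponent[OF \<kappa> _ upper]) (use N3 small in auto)
  ultimately show "has_exponent p (total_excess k R N) (N - (2 * M + 1))" by simp
qed

end

section \<open>The exponent at a prime\<close>

lemma prime_power_dvd_Lcm_iff:
  fixes A :: "int set"
  assumes "finite A" "A \<noteq> {}" "prime p"
  shows "p ^ e dvd Lcm A \<longleftrightarrow> (\<exists>x\<in>A. p ^ e dvd x)"
  using assms(1,2)
proof (induction rule: finite_ne_induct)
  case (insert x A)
  have "p ^ e dvd lcm x y \<longleftrightarrow> p ^ e dvd x \<or> p ^ e dvd y" for y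
  proof (cases "x = 0 \<or> y = 0")
    case False
    hence "lcm x y \<noteq> 0" "x \<noteq> 0" "y \<noteq> 0" by (auto simp: lcm_eq_0_iff)
    moreover have "\<not> is_unit p" using assms(3) by auto
    moreover have "multiplicity p (lcm x y) = max (multiplicity p x) (multiplicity p y)"
      using False assms(3) by (intro multiplicity_lcm) auto
    ultimately show ?thesis by (simp add: power_dvd_iff_le_multiplicity le_max_iff_disj)
  qed auto
  thus ?case using insert by simp
qed simp

lemma power_dvd_iff_nu:
  "prime p \<Longrightarrow> x \<noteq> 0 \<Longrightarrow> int p ^ e dvd x \<longleftrightarrow> e \<le> nu p x"
  by (rule power_dvd_iff_le_multiplicity) (auto simp: prime_nat_iff)

lemma prime_power_dvd_L_num_iff:
  assumes "prime p" "k \<ge> 1"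
  shows "int p ^ e dvd L_num k \<longleftrightarrow> int p ^ e \<le> int k"
proof -
  have "int p ^ e dvd L_num k \<longleftrightarrow> (\<exists>i\<in>{1..k}. int p ^ e dvd int i)"
    unfolding L_num_def by (subst prime_power_dvd_Lcm_iff) (use assms in auto)
  also have "\<dots> \<longleftrightarrow> int p ^ e \<le> int k"
  proof
    assume "\<exists>i\<in>{1..k}. int p ^ e dvd int i"
    then obtain i where "1 \<le> i" "i \<le> k" "int p ^ e dvd int i" by auto
    thus "int p ^ e \<le> int k" using zdvd_imp_le[of "int p ^ e" "int i"] by linarith
  next
    assume "int p ^ e \<le> int k"
    hence "p ^ e \<le> k" by (simp flip: of_nat_power)
    thus "\<exists>i\<in>{1..k}. int p ^ e dvd int i" using assms prime_gt_0_nat[of p]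
      by (intro bexI[of _ "p ^ e"]) (auto simp: Suc_le_eq)
  qed
  finally show ?thesis .
qed

lemma L_num_nonzero: "L_num k \<noteq> 0"
  unfolding L_num_def by (subst Lcm_0_iff) auto

lemma Legendre_prime:
  assumes "prime p" "\<not> p dvd x"
  shows "Legendre x p = 1 \<longleftrightarrow> (\<exists>u. p dvd u\<^sup>2 - x)" "Legendre x p = -1 \<longleftrightarrow> \<not> (\<exists>u. p dvd u\<^sup>2 - x)"
  using assms unfolding Legendre_def QuadRes_def by (auto simp: cong_iff_dvd_diff)

lemma nu_two_eqI: "odd x \<Longrightarrow> nu 2 (2 ^ n * x) = n"
  by (rule multiplicity_eqI) (auto simp: mult.commute dvd_mult_cancel_right)

section \<open>The factor of \<open>A_num\<close> at one prime\<close>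

text \<open>The share of \<open>p\<close> in the denominator of \<open>A_num\<close>; the three
  products there and \<open>xi2\<close> concern disjoint sets of primes.\<close>

definition denominator_factor :: "nat \<Rightarrow> nat \<Rightarrow> int \<Rightarrow> int \<Rightarrow> int \<Rightarrow> nat" where
  "denominator_factor p k a b D =
    (if p = 2 then xi2 k a b D
     else if int p dvd gcd a b \<or> \<not> int p dvd 2 * a * D \<and> Legendre D (int p) = -1
       then p ^ nu p (B_num k a D)
     else if \<not> int p dvd 2 * a \<and> int p dvd D then eta p k a D else 1)"

definition exceptional_type :: "nat \<Rightarrow> int \<Rightarrow> int \<Rightarrow> int \<Rightarrow> bool" where
  "exceptional_type p a b D \<longleftrightarrow> odd p \<and>
     (int p dvd a \<and> \<not> int p dvd b \<or> \<not> int p dvd 2 * a * D \<and> Legendre D (int p) = 1)"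

locale local_data = quad "int p" a b c k for p :: nat and a b c :: int and k :: nat +
  assumes k: "k \<ge> 1" and primitive: "gcd a (gcd b c) = 1"
    and D_ne: "\<And>i::int. 1 \<le> i \<Longrightarrow> i \<le> int k \<Longrightarrow> D \<noteq> a\<^sup>2 * i\<^sup>2"
begin

abbreviation "vB \<equiv> nu p (B_num k a D)"
abbreviation "vL \<equiv> nu p (L_num k)"
abbreviation "vk \<equiv> nu p (int k + 1)"

lemma pn: "prime p"
  using p by simp

lemma p_pos: "p > 0"
  using pn prime_gt_0_nat by blast

lemma B_nonzero: "B_num k a D \<noteq> 0"
proof -
  have "int i * (a\<^sup>2 * (int i)\<^sup>2 - D) \<noteq> 0" if "i \<in> {1..k}" for i
    using D_ne[of "int i"] that by auto
  thus ?thesis unfolding B_num_def by (subst Lcm_0_iff) fastforce+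
qed

lemma BB_iff: "BB e \<longleftrightarrow> e \<le> vB"
proof -
  have "e \<le> vB \<longleftrightarrow> int p ^ e dvd B_num k a D"
    using power_dvd_iff_nu[OF pn B_nonzero] by simp
  also have "\<dots> \<longleftrightarrow> (\<exists>i\<in>{1..k}. int p ^ e dvd int i * (a\<^sup>2 * (int i)\<^sup>2 - D))"
    unfolding B_num_def by (subst prime_power_dvd_Lcm_iff) (use k p in auto)
  also have "\<dots> \<longleftrightarrow> BB e"
  proof
    assume "BB e"
    then obtain i where "1 \<le> i" "i \<le> int k" "int p ^ e dvd i * (a\<^sup>2 * i\<^sup>2 - D)" by (auto simp: BB_def)
    thus "\<exists>i\<in>{1..k}. int p ^ e dvd int i * (a\<^sup>2 * (int i)\<^sup>2 - D)" by (intro bexI[of _ "nat i"]) auto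
  next
    assume "\<exists>i\<in>{1..k}. int p ^ e dvd int i * (a\<^sup>2 * (int i)\<^sup>2 - D)"
    then obtain i where "i \<in> {1..k}" "int p ^ e dvd int i * (a\<^sup>2 * (int i)\<^sup>2 - D)" by blast
    thus "BB e" unfolding BB_def by (intro exI[of _ "int i"]) auto
  qed
  finally show ?thesis by simp
qed

lemma le_vL_iff: "e \<le> vL \<longleftrightarrow> int p ^ e \<le> int k"
  using power_dvd_iff_nu[OF pn L_num_nonzero] prime_power_dvd_L_num_iff[OF pn k] by simp

lemma vL: "int p ^ vL \<le> int k" "int k < int p ^ Suc vL"
  using le_vL_iff[of vL] le_vL_iff[of "Suc vL"] by simp_all

lemma le_vk_iff: "int p ^ e dvd int k + 1 \<longleftrightarrow> e \<le> vk"
  using power_dvd_iff_nu[OF pn] by simp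

text \<open>\<open>D\<close> is congruent to \<open>b\<^sup>2\<close> modulo \<open>p\<close>, so
  \<open>a\<^sup>2 * i\<^sup>2 - D\<close> is always a unit.\<close>

lemma vB_linear:
  assumes "int p dvd a" "\<not> int p dvd b"
  shows "vB = vL"
proof -
  have "int p dvd a\<^sup>2 * i\<^sup>2 - D \<longleftrightarrow> int p dvd b * b" for i
    using assms(1) by (simp add: D_def power2_eq_square dvd_diff_right_iff dvd_diff_left_iff mult.assoc)
  hence unit: "\<not> int p dvd a\<^sup>2 * i\<^sup>2 - D" for i
    using assms(2) p by (simp add: prime_dvd_mult_iff)
  have "BB e \<longleftrightarrow> int p ^ e dvd L_num k" for e
  proof -
    have "BB e \<longleftrightarrow> (\<exists>i. 1 \<le> i \<and> i \<le> int k \<and> int p ^ e dvd i)"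
      using pdvd_cancel_unit[OF p unit] unfolding BB_def by (simp add: mult.commute)
    also have "\<dots> \<longleftrightarrow> int p ^ e \<le> int k"
    proof
      assume "\<exists>i. 1 \<le> i \<and> i \<le> int k \<and> int p ^ e dvd i"
      then obtain i where i: "1 \<le> i" "i \<le> int k" "int p ^ e dvd i" by blast
      thus "int p ^ e \<le> int k" using zdvd_imp_le[OF i(3)] by linarith
    next
      assume "int p ^ e \<le> int k"
      thus "\<exists>i. 1 \<le> i \<and> i \<le> int k \<and> int p ^ e dvd i" using p_pos
        by (intro exI[of _ "int p ^ e"]) (auto simp: int_one_le_iff_zero_less)
    qed
    finally show ?thesis using prime_power_dvd_L_num_iff[OF pn k] by simp
  qed
  hence "e \<le> vB \<longleftrightarrow> e \<le> vL" for e
    using BB_iff le_vL_iff prime_power_dvd_L_num_iff[OF pn k] by simp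
  thus ?thesis by (meson order_antisym order_refl)
qed

lemma exponent_linear:
  assumes "int p dvd a" "\<not> int p dvd b"
  shows "has_exponent p (total_excess k R vB) (if vB \<le> vk then 0 else vB)"
  using linear_exponent[OF assms vL, of vL] unfolding vB_linear[OF assms] le_vk_iff by simp

text \<open>As \<open>F\<close> is primitive, it is congruent modulo \<open>p\<close> to the nonzero
  constant \<open>c\<close> and has no zeros.\<close>

lemma exponent_empty:
  assumes "int p dvd a" "int p dvd b"
  shows "has_exponent p (total_excess k R vB) 0"
proof -
  have "\<not> int p dvd c"
    using assms primitive p gcd_greatest[of "int p" a "gcd b c"] by auto
  hence n: "\<not> int p dvd F x" for x using assms by (simp add: F_def dvd_add_right_iff)
  have "R e = {}" if "1 \<le> e" for e
    using n power_dvd_le[of "int p" e _ 1] that by (auto simp: R_def)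
  hence "\<not> close k (R e)" if "1 \<le> e" for e using that by (simp add: close_def)
  hence "periodic (total_excess k R vB) 1" by (intro total_periodic) auto
  thus ?thesis by (rule has_exponent_0)
qed

end

locale local_data_unit = local_data +
  assumes pa': "\<not> int p dvd a"

sublocale local_data_unit \<subseteq> quad_unit "int p" a b c k
  by standard (rule pa')

context local_data_unit
begin

lemma exponent_below:
  assumes "\<And>w. int p ^ w \<le> int k \<Longrightarrow> int p ^ (2 * w + 1) dvd D \<and> (int p = 2 \<longrightarrow> int p ^ (2 * w + 2) dvd D)"
  shows "vB = 3 * vL" "has_exponent p (total_excess k R vB) (if vL \<le> vk then 0 else vL)"
proof -
  have "BB e \<longleftrightarrow> e \<le> 3 * vL" for e using below_BB[OF vL] assms by blast
  hence "e \<le> vB \<longleftrightarrow> e \<le> 3 * vL" for e using BB_iff by blast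
  thus "vB = 3 * vL" by (meson order_antisym order_refl)
  show "has_exponent p (total_excess k R vB) (if vL \<le> vk then 0 else vL)"
    using below_exponent[OF vL assms, of vB] BB_iff by (simp add: le_vk_iff)
qed

lemma exponent_single:
  assumes "int p ^ \<tau> \<le> int k" "\<tau> \<ge> 1 \<Longrightarrow> \<exists>r\<in>R (2 * \<tau> - 1). int p ^ \<tau> dvd Y r"
    and "\<And>r e. r \<in> R e \<Longrightarrow> int p ^ ((e + 1) div 2) dvd Y r \<and> (e + 1) div 2 \<le> \<tau>"
  shows "has_exponent p (total_excess k R vB) (if \<tau> \<le> vk then 0 else \<tau>)" "\<tau> \<le> vB"
proof -
  show "has_exponent p (total_excess k R vB) (if \<tau> \<le> vk then 0 else \<tau>)"
    unfolding le_vk_iff[symmetric]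
  proof (rule single_exponent[OF assms(1)])
    fix e assume "close k (R e)"
    then obtain r where "r \<in> R e" by (auto simp: close_def)
    thus "(\<forall>r\<in>R e. int p ^ ((e + 1) div 2) dvd Y r) \<and> (e + 1) div 2 \<le> \<tau>" using assms(3) by blast
  qed (use assms BB_iff in auto)
  have "BB \<tau>" unfolding BB_def using assms(1) p_pos
    by (intro exI[of _ "int p ^ \<tau>"]) (auto simp: int_one_le_iff_zero_less)
  thus "\<tau> \<le> vB" by (simp add: BB_iff)
qed

lemma dvd_D_iff: "D \<noteq> 0 \<Longrightarrow> int p ^ e dvd D \<longleftrightarrow> e \<le> nu p D"
  using power_dvd_iff_nu[OF pn] .

lemma exponent_split_data:
  assumes "D \<noteq> 0" "even (nu p D)" "R (Suc (nu p D)) \<noteq> {}" "int p ^ (nu p D div 2) \<le> int k"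
  shows "quad_split (int p) a b c k (nu p D div 2) vB"
proof
  show "int p ^ (2 * (nu p D div 2)) dvd D" "\<not> int p ^ Suc (2 * (nu p D div 2)) dvd D"
    using assms(2) by (simp_all add: dvd_D_iff[OF assms(1)] del: power_Suc)
qed (use assms BB_iff in simp_all)

lemma exponent_odd_below:
  assumes "odd p" "below_odd p k D"
  shows "vB = 3 * vL" "has_exponent p (total_excess k R vB) (if vL \<le> vk then 0 else vL)"
proof -
  have "int p ^ (2 * w + 1) dvd D \<and> (int p = 2 \<longrightarrow> int p ^ (2 * w + 2) dvd D)"
    if w: "int p ^ w \<le> int k" for w
  proof (cases "D = 0")
    case False
    hence "k < p ^ ((nu p D + 1) div 2)" using assms(2) by (simp add: below_odd_def)
    moreover have "p ^ w \<le> k" using w by (simp flip: of_nat_power)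
    ultimately have "p ^ w < p ^ ((nu p D + 1) div 2)" by linarith
    hence "w < (nu p D + 1) div 2" using prime_gt_1_nat[OF pn] by (simp add: power_strict_increasing_iff)
    hence "int p ^ (2 * w + 1) dvd D" unfolding dvd_D_iff[OF False] by linarith
    thus ?thesis using assms(1) by auto
  qed simp
  thus "vB = 3 * vL" "has_exponent p (total_excess k R vB) (if vL \<le> vk then 0 else vL)"
    using exponent_below by blast+
qed

lemma exponent_two_below:
  assumes "p = 2" "below2 k D"
  shows "vB = 3 * vL" "has_exponent p (total_excess k R vB) (if vL \<le> vk then 0 else vL)"
proof -
  have "int p ^ (2 * w + 1) dvd D \<and> (int p = 2 \<longrightarrow> int p ^ (2 * w + 2) dvd D)"
    if w: "int p ^ w \<le> int k" for w
  proof (cases "D = 0")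
    case False
    hence "k < 2 ^ (nu p D div 2)" using assms by (simp add: below2_def)
    moreover have "2 ^ w \<le> k" using w assms(1) by (metis of_nat_le_iff of_nat_power)
    ultimately have "(2::nat) ^ w < 2 ^ (nu p D div 2)" by linarith
    hence "w < nu p D div 2" by (simp add: power_strict_increasing_iff)
    thus ?thesis unfolding dvd_D_iff[OF False] by linarith
  qed simp
  thus "vB = 3 * vL" "has_exponent p (total_excess k R vB) (if vL \<le> vk then 0 else vL)"
    using exponent_below by blast+
qed

lemma square_mod_iff_Legendre:
  assumes "D \<noteq> 0"
  shows "Legendre (D_odd p D) (int p) = 1 \<longleftrightarrow> (\<exists>u. int p dvd u\<^sup>2 - D div int p ^ nu p D)"
    "Legendre (D_odd p D) (int p) = -1 \<longleftrightarrow> \<not> (\<exists>u. int p dvd u\<^sup>2 - D div int p ^ nu p D)"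
proof -
  have "\<not> int p dvd D div int p ^ nu p D"
    using multiplicity_decompose[OF assms, of "int p"] p not_prime_unit by blast
  thus "Legendre (D_odd p D) (int p) = 1 \<longleftrightarrow> (\<exists>u. int p dvd u\<^sup>2 - D div int p ^ nu p D)"
    "Legendre (D_odd p D) (int p) = -1 \<longleftrightarrow> \<not> (\<exists>u. int p dvd u\<^sup>2 - D div int p ^ nu p D)"
    unfolding D_odd_def using Legendre_prime[OF p] by blast+
qed

lemma exponent_odd_nonsplit:
  assumes "odd p" "\<not> below_odd p k D" "odd (nu p D) \<or> Legendre (D_odd p D) (int p) = -1"
  defines "h \<equiv> (nu p D + 1) div 2"
  shows "has_exponent p (total_excess k R vB) (if h \<le> vk then 0 else h)" "h \<le> vB"
proof -
  have D0: "D \<noteq> 0" and hk: "p ^ h \<le> k" using assms(2) by (auto simp: below_odd_def h_def)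
  have hk': "int p ^ h \<le> int k" using hk by (simp flip: of_nat_power)
  have *: "int p ^ ((e + 1) div 2) dvd Y r \<and> (e + 1) div 2 \<le> h" if "r \<in> R e" for r e
    unfolding h_def
    by (rule nonsplit_odd[OF _ _ _ _ that])
      (use assms D0 square_mod_iff_Legendre in \<open>auto simp: dvd_D_iff simp del: power_Suc\<close>)
  have "\<exists>r\<in>R (2 * h - 1). int p ^ h dvd Y r"
    by (rule witness_odd) (use assms(1) in \<open>auto simp: dvd_D_iff[OF D0] h_def\<close>)
  thus "has_exponent p (total_excess k R vB) (if h \<le> vk then 0 else h)" "h \<le> vB"
    using exponent_single[OF hk' _ *] by blast+
qed

lemma exponent_odd_split:
  assumes "odd p" "\<not> below_odd p k D" "even (nu p D)" "Legendre (D_odd p D) (int p) = 1"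
  shows "has_exponent p (total_excess k R vB) (if vB - nu p D \<le> vk then 0 else vB - nu p D)"
    "nu p D \<le> vB"
proof -
  define M where "M = nu p D div 2"
  have M: "nu p D = 2 * M" using assms(3) by (simp add: M_def)
  have D0: "D \<noteq> 0" and "p ^ ((nu p D + 1) div 2) \<le> k" using assms(2) by (auto simp: below_odd_def)
  hence "p ^ M \<le> k" by (simp add: M)
  hence hk: "int p ^ M \<le> int k" by (simp flip: of_nat_power)
  obtain u where u: "int p dvd u\<^sup>2 - D div int p ^ nu p D" using assms(4) square_mod_iff_Legendre D0 by blast
  have "R (Suc (nu p D)) \<noteq> {}" unfolding M
    by (rule R_one_nonempty_odd[of _ u]) (use assms(1) u M D0 in \<open>auto simp: dvd_D_iff\<close>)
  then interpret split: quad_split "int p" a b c k M vB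
    unfolding M_def by (intro exponent_split_data) (use D0 hk assms M_def in auto)
  show "has_exponent p (total_excess k R vB) (if vB - nu p D \<le> vk then 0 else vB - nu p D)"
    using split.split_odd_exponent assms(1) unfolding le_vk_iff M by simp
  show "nu p D \<le> vB" using split.N_ge M by simp
qed

lemma exponent_two_nonsplit:
  assumes "p = 2" "\<not> below2 k D" "[D4 D \<noteq> 1] (mod 8)"
  defines "h \<equiv> nu 2 D div 2"
  shows "has_exponent p (total_excess k R vB) (if h \<le> vk then 0 else h)" "h \<le> vB"
proof -
  have D0: "D \<noteq> 0" and hk: "2 ^ h \<le> k" using assms(2) by (auto simp: below2_def h_def)
  have hk': "int p ^ h \<le> int k" using hk assms(1) by (metis of_nat_le_iff of_nat_power)
  have *: "int p ^ ((e + 1) div 2) dvd Y r \<and> (e + 1) div 2 \<le> h" if "r \<in> R e" for r e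
  proof (rule nonsplit_two[OF _ _ _ that])
    fix t assume "2 ^ (2 * t) dvd D"
    hence "2 * t \<le> nu 2 D" using dvd_D_iff[OF D0] assms(1) by simp
    thus "t \<le> h" by (simp add: h_def)
  next
    fix w x assume D: "D = 2 ^ (2 * w) * x"
    show "\<not> 8 dvd x - 1"
    proof
      assume x: "8 dvd x - 1"
      hence "odd x" by presburger
      have "nu 2 D = 2 * w"
        unfolding D by (rule nu_two_eqI) fact
      hence "D4 D = x" by (simp add: D4_def D power_mult)
      thus False using assms(3) x by (simp add: cong_iff_dvd_diff)
    qed
  qed (use assms in simp)
  have "\<exists>r\<in>R (2 * h - 1). int p ^ h dvd Y r" if "h \<ge> 1"
    by (rule witness_even[OF _ that]) (use assms(1) dvd_D_iff[OF D0] in \<open>auto simp: h_def\<close>)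
  thus "has_exponent p (total_excess k R vB) (if h \<le> vk then 0 else h)" "h \<le> vB"
    using exponent_single[OF hk' _ *] by blast+
qed

lemma exponent_two_split:
  assumes "p = 2" "\<not> below2 k D" "[D4 D = 1] (mod 8)"
  shows "has_exponent p (total_excess k R vB) (vB - (nu 2 D + 1))" "nu 2 D + 1 \<le> vB"
proof -
  define M where "M = nu 2 D div 2"
  have D0: "D \<noteq> 0" and hk: "2 ^ M \<le> k" using assms(2) by (auto simp: below2_def M_def)
  have hk': "int p ^ M \<le> int k" using hk assms(1) by (metis of_nat_le_iff of_nat_power)
  have x: "8 dvd D4 D - 1" using assms(3) by (simp add: cong_iff_dvd_diff)
  hence "odd (D4 D)" by presburger
  have "(2::int) ^ (2 * M) dvd D" using dvd_D_iff[OF D0] assms(1) by (simp add: M_def)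
  hence D: "D = 2 ^ (2 * M) * D4 D" unfolding D4_def M_def[symmetric] by (simp add: power_mult)
  have "nu 2 D = 2 * M"
    by (subst D, rule nu_two_eqI) fact
  have "nu p D = 2 * M" using \<open>nu 2 D = 2 * M\<close> assms(1) by simp
  hence "R (Suc (nu p D)) \<noteq> {}" using R_one_nonempty_two[OF _ D x] assms(1) by simp
  then interpret split: quad_split "int p" a b c k M vB
    using exponent_split_data D0 hk' \<open>nu p D = 2 * M\<close> by simp
  show "has_exponent p (total_excess k R vB) (vB - (nu 2 D + 1))" "nu 2 D + 1 \<le> vB"
    using split.split_two_exponent assms(1) \<open>nu 2 D = 2 * M\<close> by simp_all
qed

text \<open>The cases of \<open>xi2\<close> for odd \<open>a\<close> match those of the zero sets:
  below the threshold \<open>vB = 3 * vL\<close>, and \<open>2 ^ (2 * vL)\<close> leaves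
  \<open>vL\<close>; the next two leave \<open>nu 2 D div 2\<close> and
  \<open>vB - (nu 2 D + 1)\<close>. The value \<open>2 ^ vB\<close> leaves 0, as it must when the
  modulus divides \<open>k + 1\<close>.\<close>

lemma local_exponent_two:
  assumes "p = 2"
  shows "\<exists>\<alpha>. xi2 k a b D * 2 ^ \<alpha> = 2 ^ vB \<and> has_exponent p (total_excess k R vB) \<alpha>"
proof -
  have odd: "odd a" using pa assms by simp
  consider (below) "below2 k D" | (nonsplit) "\<not> below2 k D" "[D4 D \<noteq> 1] (mod 8)"
    | (split) "\<not> below2 k D" "[D4 D = 1] (mod 8)" by blast
  thus ?thesis
  proof cases
    case below
    have "xi2 k a b D * 2 ^ (if vL \<le> vk then 0 else vL) = 2 ^ vB"
      using below odd exponent_two_below(1)[OF assms below] assms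
      by (auto simp: xi2_def Let_def simp flip: power_add)
    thus ?thesis using exponent_two_below(2)[OF assms below] by blast
  next
    case nonsplit
    define h where "h = nu 2 D div 2"
    note ns = exponent_two_nonsplit[OF assms nonsplit, folded h_def]
    have "xi2 k a b D * 2 ^ (if h \<le> vk then 0 else h) = 2 ^ vB"
      using nonsplit odd ns(2) assms
      by (auto simp: xi2_def Let_def h_def simp flip: power_add)
    thus ?thesis using ns(1) by blast
  next
    case split
    have "xi2 k a b D = 2 ^ (nu 2 D + 1)" using split odd by (simp add: xi2_def Let_def)
    hence "xi2 k a b D * 2 ^ (vB - (nu 2 D + 1)) = 2 ^ vB"
      using exponent_two_split(2)[OF assms split] by (simp flip: power_add del: power_Suc)
    thus ?thesis using exponent_two_split(1)[OF assms split] by blast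
  qed
qed

text \<open>\<open>eta\<close> is parallel to \<open>xi2\<close>; in the split case it leaves
  \<open>vB - nu p D\<close>, the \<open>N - 2 * M\<close> of
  \<open>split_odd_exponent\<close>.\<close>

lemma local_exponent_odd_dvd:
  assumes "odd p" "int p dvd D"
  shows "\<exists>\<alpha>. eta p k a D * p ^ \<alpha> = p ^ vB \<and> has_exponent p (total_excess k R vB) \<alpha>"
proof -
  have "Legendre (D_odd p D) (int p) = 1 \<or> Legendre (D_odd p D) (int p) = -1" if "D \<noteq> 0"
    using square_mod_iff_Legendre[OF that] by blast
  then consider (below) "below_odd p k D"
    | (nonsplit) "\<not> below_odd p k D" "odd (nu p D) \<or> Legendre (D_odd p D) (int p) = -1"
    | (split) "\<not> below_odd p k D" "even (nu p D)" "Legendre (D_odd p D) (int p) = 1"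
    unfolding below_odd_def by blast
  thus ?thesis
  proof cases
    case below
    have "eta p k a D * p ^ (if vL \<le> vk then 0 else vL) = p ^ vB"
      using below exponent_odd_below(1)[OF assms(1) below]
      by (auto simp: eta_def Let_def simp flip: power_add)
    thus ?thesis using exponent_odd_below(2)[OF assms(1) below] by blast
  next
    case nonsplit
    define h where "h = (nu p D + 1) div 2"
    note ns = exponent_odd_nonsplit[OF assms(1) nonsplit, folded h_def]
    have "eta p k a D * p ^ (if h \<le> vk then 0 else h) = p ^ vB"
      using nonsplit ns(2) by (auto simp: eta_def Let_def h_def simp flip: power_add)
    thus ?thesis using ns(1) by blast
  next
    case split
    note sp = exponent_odd_split[OF assms(1) split]
    have "eta p k a D * p ^ (if vB - nu p D \<le> vk then 0 else vB - nu p D) = p ^ vB"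
      using split sp(2) by (auto simp: eta_def Let_def simp flip: power_add)
    thus ?thesis using sp(1) by blast
  qed
qed

lemma local_exponent_odd_coprime:
  assumes "odd p" "\<not> int p dvd D"
  shows "Legendre D (int p) = 1 \<Longrightarrow> has_exponent p (total_excess k R vB) (if vB \<le> vk then 0 else vB)"
    "Legendre D (int p) = -1 \<Longrightarrow> has_exponent p (total_excess k R vB) 0"
proof -
  have nu: "nu p D = 0" using assms(2) by (rule not_dvd_imp_multiplicity_0)
  hence Dp: "D_odd p D = D" by (simp add: D_odd_def)
  have "D \<noteq> 0" using assms(2) by auto
  hence nb: "\<not> below_odd p k D" using k nu by (simp add: below_odd_def)
  show "has_exponent p (total_excess k R vB) (if vB \<le> vk then 0 else vB)" if "Legendre D (int p) = 1"
    using exponent_odd_split(1)[OF assms(1) nb] that unfolding nu Dp by (simp split: if_splits)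
  show "has_exponent p (total_excess k R vB) 0" if "Legendre D (int p) = -1"
    using exponent_odd_nonsplit[OF assms(1) nb] that nu Dp by simp
qed

end

context local_data
begin

text \<open>\<open>\<alpha>\<close> is to be the exponent of \<open>p\<close> in
  \<open>A_num\<close>. Where \<open>xi2\<close> or \<open>eta\<close> applies, the condition on
  \<open>k + 1\<close> is built in; for the exceptional types the denominator is 1, and the collapse
  to exponent 0 is stated separately.\<close>

lemma local_exponent:
  "\<exists>\<alpha>. denominator_factor p k a b D * p ^ \<alpha> = p ^ vB \<and>
     has_exponent p (total_excess k R vB) (if exceptional_type p a b D \<and> \<alpha> \<le> vk then 0 else \<alpha>)"
proof (cases "int p dvd a")
  case True
  show ?thesis
  proof (cases "int p dvd b")
    case b: True
    have e: "\<not> exceptional_type p a b D" using True b by (auto simp: exceptional_type_def)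
    show ?thesis
    proof (rule exI[of _ 0], intro conjI)
      show "denominator_factor p k a b D * p ^ 0 = p ^ vB"
        using True b by (auto simp: denominator_factor_def xi2_def Let_def)
    qed (use exponent_empty[OF True b] e in simp)
  next
    case b: False
    have ab: "\<not> int p dvd gcd a b" using b by (meson dvd_trans gcd_dvd2)
    show ?thesis
    proof (cases "p = 2")
      case p2: True
      have e: "\<not> exceptional_type p a b D" using p2 by (auto simp: exceptional_type_def)
      have "denominator_factor p k a b D * p ^ (if vB \<le> vk then 0 else vB) = p ^ vB"
        using True b by (auto simp: denominator_factor_def xi2_def Let_def p2)
      thus ?thesis using exponent_linear[OF True b] e by auto
    next
      case False
      hence "odd p" using pn by (metis prime_nat_iff two_is_prime_nat primes_dvd_imp_eq)
      hence e: "exceptional_type p a b D" using True b by (auto simp: exceptional_type_def)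
      have "denominator_factor p k a b D * p ^ vB = p ^ vB"
        using True ab False by (auto simp: denominator_factor_def)
      thus ?thesis using exponent_linear[OF True b] e by auto
    qed
  qed
next
  case False
  interpret unit: local_data_unit p a b c k by standard (rule False)
  have ab: "\<not> int p dvd gcd a b" using False by (meson dvd_trans gcd_dvd1)
  show ?thesis
  proof (cases "p = 2")
    case p2: True
    have e: "\<not> exceptional_type p a b D" using p2 by (auto simp: exceptional_type_def)
    show ?thesis using unit.local_exponent_two[OF p2] e p2 by (simp add: denominator_factor_def)
  next
    case p2: False
    hence odd: "odd p" using pn by (metis prime_nat_iff two_is_prime_nat primes_dvd_imp_eq)
    hence "\<not> int p dvd 2" using p by (metis primes_dvd_imp_eq two_is_prime dvd_refl even_of_nat_iff)
    hence 2: "\<not> int p dvd 2 * a" using False p by (simp add: prime_dvd_mult_iff)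
    hence D2: "int p dvd 2 * a * D \<longleftrightarrow> int p dvd D" using p by (simp add: prime_dvd_mult_iff)
    show ?thesis
    proof (cases "int p dvd D")
      case True
      have "\<not> exceptional_type p a b D" using True False by (auto simp: exceptional_type_def)
      thus ?thesis using unit.local_exponent_odd_dvd[OF odd True] p2 ab D2 True 2 False by (simp add: denominator_factor_def)
    next
      case nD: False
      consider "Legendre D (int p) = 1" | "Legendre D (int p) = -1"
        using Legendre_prime[OF p nD] by blast
      thus ?thesis
      proof cases
        case 1
        hence e: "exceptional_type p a b D" using nD D2 odd by (auto simp: exceptional_type_def)
        have "denominator_factor p k a b D * p ^ vB = p ^ vB" using 1 p2 ab nD False by (simp add: denominator_factor_def)
        thus ?thesis using unit.local_exponent_odd_coprime(1)[OF odd nD 1] e by auto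
      next
        case m: 2
        hence e: "\<not> exceptional_type p a b D" using False by (auto simp: exceptional_type_def)
        have "denominator_factor p k a b D * p ^ 0 = p ^ vB" using m p2 ab nD D2 False by (simp add: denominator_factor_def)
        thus ?thesis using unit.local_exponent_odd_coprime(2)[OF odd nD m] e by (intro exI[of _ 0]) simp
      qed
    qed
  qed
qed

lemma vL_le_vB: "vL \<le> vB"
proof -
  have "BB vL" unfolding BB_def using vL(1) p_pos
    by (intro exI[of _ "int p ^ vL"]) (auto simp: int_one_le_iff_zero_less)
  thus ?thesis by (simp add: BB_iff)
qed

lemma denominator_factor_exceptional: "exceptional_type p a b D \<Longrightarrow> denominator_factor p k a b D = 1"
  by (auto simp: exceptional_type_def denominator_factor_def)

end

section \<open>From valuations to periods\<close>

lemma multiplicity_eq_sum: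
  fixes p y :: int
  assumes "prime p" "y \<noteq> 0" "multiplicity p y \<le> V"
  shows "multiplicity p y = (\<Sum>e\<in>{1..V}. of_bool (p ^ e dvd y))"
proof -
  have "(\<Sum>e\<in>{1..V}. of_bool (p ^ e dvd y)) = (\<Sum>e\<in>{1..multiplicity p y}. (1::nat))"
    using assms power_dvd_iff_le_multiplicity[OF assms(2), of p]
    by (intro sum.mono_neutral_cong_right) auto
  thus ?thesis by simp
qed

text \<open>Summing valuations over the window amounts to summing \<open>win_count\<close> over all
  levels, while the lcm counts each level once if the window meets it. The difference is the
  excess.\<close>

lemma multiplicity_prod_Lcm:
  fixes x :: "int \<Rightarrow> int" and p :: int
  defines "S \<equiv> \<lambda>e. {z. p ^ e dvd x z}"
  assumes p: "prime p" and x: "\<And>i. i \<le> k \<Longrightarrow> x (n + int i) \<noteq> 0"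
    and N: "\<And>e. N < e \<Longrightarrow> excess k (S e) n = 0"
  shows "multiplicity p (\<Prod>i\<in>{0..k}. \<bar>x (n + int i)\<bar>) =
    multiplicity p (LCM i\<in>{0..k}. x (n + int i)) + total_excess k S N n"
proof -
  define L where "L = (LCM i\<in>{0..k}. x (n + int i))"
  \<comment> \<open>\<open>V\<close> is at least \<open>N\<close> and all valuations involved, so
    every sum over levels can run up to \<open>V\<close>.\<close>
  define V where "V = N + (\<Sum>i\<in>{0..k}. multiplicity p (x (n + int i))) + multiplicity p L"
  have L0: "L \<noteq> 0" unfolding L_def by (subst Lcm_0_iff) (use x in fastforce)+
  have "multiplicity p (\<Prod>i\<in>{0..k}. \<bar>x (n + int i)\<bar>) = (\<Sum>i\<in>{0..k}. multiplicity p \<bar>x (n + int i)\<bar>)"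
    using p x by (intro prime_elem_multiplicity_prod_distrib) auto
  also have "\<dots> = (\<Sum>i\<in>{0..k}. \<Sum>e\<in>{1..V}. of_bool (p ^ e dvd x (n + int i)))"
  proof (rule sum.cong[OF refl])
    fix i assume i: "i \<in> {0..k}"
    have "multiplicity p (x (n + int i)) \<le> (\<Sum>i\<in>{0..k}. multiplicity p (x (n + int i)))"
      by (rule member_le_sum) (use i in auto)
    moreover have "multiplicity p \<bar>x (n + int i)\<bar> = multiplicity p (x (n + int i))"
      by (metis multiplicity_normalize_right normalize_int_def)
    ultimately have "multiplicity p \<bar>x (n + int i)\<bar> \<le> V" by (simp add: V_def)
    from multiplicity_eq_sum[OF p _ this]
    show "multiplicity p \<bar>x (n + int i)\<bar> = (\<Sum>e\<in>{1..V}. of_bool (p ^ e dvd x (n + int i)))"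
      using x i by simp
  qed
  also have "\<dots> = (\<Sum>e\<in>{1..V}. \<Sum>i\<in>{0..k}. of_bool (p ^ e dvd x (n + int i)))"
    by (rule sum.swap)
  also have "\<dots> = (\<Sum>e\<in>{1..V}. win_count k (S e) n)"
    by (simp add: win_count_sum S_def atLeast0AtMost)
  also have "\<dots> = (\<Sum>e\<in>{1..V}. of_bool (p ^ e dvd L) + excess k (S e) n)"
  proof (rule sum.cong[OF refl])
    fix e
    have "p ^ e dvd L \<longleftrightarrow> (\<exists>i\<le>k. n + int i \<in> S e)"
      unfolding L_def S_def by (subst prime_power_dvd_Lcm_iff) (use p in auto)
    also have "\<dots> \<longleftrightarrow> win_count k (S e) n > 0" by (auto simp: win_count_def card_gt_0_iff)
    finally show "win_count k (S e) n = of_bool (p ^ e dvd L) + excess k (S e) n"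
      by (simp add: excess_def)
  qed
  also have "\<dots> = multiplicity p L + (\<Sum>e\<in>{1..V}. excess k (S e) n)"
    unfolding sum.distrib using multiplicity_eq_sum[OF p L0, of V] by (simp add: V_def)
  also have "(\<Sum>e\<in>{1..V}. excess k (S e) n) = total_excess k S N n"
    unfolding total_excess_def by (rule sum.mono_neutral_right) (use N in \<open>auto simp: V_def\<close>)
  finally show ?thesis by (simp only: L_def)
qed

lemma Lcm_dvd_prod:
  fixes x :: "nat \<Rightarrow> int"
  shows "(LCM i\<in>{0..k}. x i) dvd (\<Prod>i\<in>{0..k}. \<bar>x i\<bar>)"
proof (rule Lcm_least)
  fix y assume "y \<in> x ` {0..k}"
  then obtain i where i: "i \<in> {0..k}" "y = x i" by auto
  have "\<bar>x i\<bar> dvd (\<Prod>i\<in>{0..k}. \<bar>x i\<bar>)" by (rule dvd_prodI) (use i in auto)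
  thus "y dvd (\<Prod>i\<in>{0..k}. \<bar>x i\<bar>)" using i by simp
qed

text \<open>Hence \<open>g_fun\<close> is at least the gcd of any two of the values.\<close>

lemma Lcm_gcd_dvd_prod:
  fixes x :: "nat \<Rightarrow> int"
  assumes "1 \<le> i" "i \<le> k"
  shows "(LCM i\<in>{0..k}. x i) * gcd (x 0) (x i) dvd (\<Prod>i\<in>{0..k}. \<bar>x i\<bar>)"
proof -
  define r where "r = (\<Prod>j\<in>{0..k} - {0,i}. \<bar>x j\<bar>)"
  have "{0..k} = insert 0 (insert i ({0..k} - {0,i}))" using assms by auto
  hence "(\<Prod>j\<in>{0..k}. \<bar>x j\<bar>) = (\<Prod>j\<in>insert 0 (insert i ({0..k} - {0,i})). \<bar>x j\<bar>)" by simp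
  also have "\<dots> = \<bar>x 0\<bar> * (\<bar>x i\<bar> * r)" using assms by (simp add: r_def)
  also have "\<dots> = \<bar>x 0 * x i\<bar> * r" by (simp add: abs_mult)
  also have "\<bar>x 0 * x i\<bar> = lcm (x 0) (x i) * gcd (x 0) (x i)"
    by (metis abs_mult normalize_int_def lcm_gcd_prod lcm_mult_gcd)
  finally have P: "(\<Prod>j\<in>{0..k}. \<bar>x j\<bar>) = (lcm (x 0) (x i) * r) * gcd (x 0) (x i)" by simp
  have "(LCM i\<in>{0..k}. x i) dvd lcm (x 0) (x i) * r"
  proof (rule Lcm_least)
    fix y assume "y \<in> x ` {0..k}"
    then obtain j where j: "j \<in> {0..k}" "y = x j" by auto
    show "y dvd lcm (x 0) (x i) * r"
    proof (cases "j \<in> {0,i}")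
      case False
      have "\<bar>x j\<bar> dvd r" unfolding r_def by (rule dvd_prodI) (use j False in auto)
      thus ?thesis using j by simp
    qed (use j in auto)
  qed
  thus ?thesis unfolding P by (rule mult_dvd_mono) simp
qed

section \<open>Values of \<open>g_fun\<close> and failure of periodicity\<close>

lemma g_fun_eq_int:
  assumes "n \<notin> zero_set k f" "n \<ge> 1"
  obtains G where "G > 0" "g_fun k f n = of_int G"
    "(\<Prod>i\<in>{0..k}. \<bar>poly f (int (n + i))\<bar>) = (LCM i\<in>{0..k}. poly f (int (n + i))) * G"
    "(LCM i\<in>{0..k}. poly f (int (n + i))) > 0"
proof -
  define P where "P = (\<Prod>i\<in>{0..k}. \<bar>poly f (int (n + i))\<bar>)"
  define L where "L = (LCM i\<in>{0..k}. poly f (int (n + i)))"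
  have nz: "poly f (int (n + i)) \<noteq> 0" if "i \<in> {0..k}" for i
    using assms that by (auto simp: zero_set_def)
  hence P: "P > 0" unfolding P_def by (intro prod_pos) auto
  obtain G where G: "P = L * G"
    using Lcm_dvd_prod[of "\<lambda>i. poly f (int (n + i))" k] unfolding P_def L_def by blast
  have "L \<ge> 0" by (simp add: L_def)
  hence "L > 0" "G > 0" using P G by (auto simp: zero_less_mult_iff)
  moreover have "g_fun k f n = of_int G"
    using \<open>L > 0\<close> unfolding g_fun_def P_def[symmetric] L_def[symmetric] G by simp
  ultimately show thesis using that G unfolding P_def L_def by blast
qed

lemma quadratic_pos:
  fixes a b c n :: int
  assumes "a \<ge> 1" "n > \<bar>b\<bar> + \<bar>c\<bar>"
  shows "a * n\<^sup>2 + b * n + c > 0"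
proof -
  have "n \<ge> 1" using assms by linarith
  have "(\<bar>b\<bar> + \<bar>c\<bar> + 1) * n \<le> n * n" using assms \<open>n \<ge> 1\<close> by (intro mult_right_mono) auto
  also have "n * n \<le> a * n\<^sup>2" using assms mult_right_mono[of 1 a "n * n"] by (simp add: power2_eq_square)
  finally have "\<bar>b\<bar> * n + \<bar>c\<bar> * n + n \<le> a * n\<^sup>2" by (simp add: algebra_simps)
  moreover have "- (\<bar>b\<bar> * n) \<le> b * n" using \<open>n \<ge> 1\<close> by (metis abs_ge_minus_self abs_mult abs_of_pos minus_le_iff zero_less_one order_less_le_trans)
  moreover have "\<bar>c\<bar> \<le> \<bar>c\<bar> * n" using \<open>n \<ge> 1\<close> mult_left_mono[of 1 n "\<bar>c\<bar>"] by simp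
  ultimately show ?thesis using \<open>n \<ge> 1\<close> by linarith
qed

lemma not_in_zero_set:
  assumes "a \<ge> 1" "int n > \<bar>b\<bar> + \<bar>c\<bar>"
  shows "n \<notin> zero_set k [:c, b, a:]"
proof
  assume "n \<in> zero_set k [:c, b, a:]"
  then obtain i where "poly [:c, b, a:] (int (n + i)) = 0" by (auto simp: zero_set_def)
  moreover have "a * (int (n + i))\<^sup>2 + b * int (n + i) + c > 0"
    by (rule quadratic_pos) (use assms in auto)
  ultimately show False by (simp add: power2_eq_square algebra_simps)
qed

lemma periodic_eventually:
  assumes "periodic h q" "q > 0" "\<And>n. n \<ge> n0 \<Longrightarrow> h (n + t) = h n"
  shows "periodic h t"
  unfolding periodic_def
proof
  fix n
  define m where "m = \<bar>n0\<bar> + \<bar>n\<bar>"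
  have per: "periodic h (m * q)" using assms(1) by (rule periodic_mult)
  have "m * 1 \<le> m * q" using assms(2) by (intro mult_left_mono) (auto simp: m_def)
  hence "n + m * q \<ge> n0" by (auto simp: m_def)
  hence "h (n + m * q + t) = h (n + m * q)" by (rule assms(3))
  thus "h (n + t) = h n" using periodicD[OF per, of n] periodicD[OF per, of "n + t"] by (simp add: add_ac)
qed

text \<open>If \<open>D = a\<^sup>2 * i\<^sup>2\<close>, then \<open>2 * a * n + b + a * i\<close> divides both \<open>4 * a * f n\<close> and
  \<open>4 * a * f (n + i)\<close>.\<close>

lemma not_periodic:
  assumes a: "a \<ge> 1" and i: "1 \<le> i" "i \<le> int k" and D: "b\<^sup>2 - 4 * a * c = a\<^sup>2 * i\<^sup>2"
  shows "\<not> eventually_periodic k [:c, b, a:]"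
proof
  define f where "f = [:c, b, a:]"
  assume "eventually_periodic k [:c, b, a:]"
  then obtain t n0 where t: "t \<ge> 1" "n0 \<ge> 1"
    "\<And>n. n \<ge> n0 \<Longrightarrow> n \<notin> zero_set k f \<and> n + t \<notin> zero_set k f \<and> g_fun k f (n + t) = g_fun k f n"
    unfolding eventually_periodic_def is_period_def f_def by auto
  have const: "g_fun k f (n0 + m * t) = g_fun k f n0" for m
  proof (induction m)
    case (Suc m)
    thus ?case using t(3)[of "n0 + m * t"] by (simp add: add_ac)
  qed simp
  have lower: "of_int (2 * a * int n + b + a * i) \<le> 4 * of_int a * g_fun k f n"
    if n: "n \<ge> n0" for n
  proof -
    obtain G where G: "G > 0" "g_fun k f n = of_int G"
      "(\<Prod>i\<in>{0..k}. \<bar>poly f (int (n + i))\<bar>) = (LCM i\<in>{0..k}. poly f (int (n + i))) * G"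
      "(LCM i\<in>{0..k}. poly f (int (n + i))) > 0"
      using t(3)[OF n] t(2) n by (elim conjE g_fun_eq_int) auto
    define j where "j = nat i"
    have j: "1 \<le> j" "j \<le> k" "int j = i" using i by (auto simp: j_def)
    define y where "y = 2 * a * int n + b + a * i"
    have F: "4 * a * poly f x = (2 * a * x + b - a * i) * (2 * a * x + b + a * i)" for x
      using D by (simp add: f_def power2_eq_square algebra_simps)
    have "y dvd 4 * a * poly f (int n)" unfolding F y_def by simp
    moreover have "2 * a * int (n + j) + b - a * i = y" using j by (simp add: y_def algebra_simps)
    hence "y dvd 4 * a * poly f (int (n + j))" unfolding F by simp
    ultimately have "y dvd gcd (4 * a * poly f (int n)) (4 * a * poly f (int (n + j)))"
      by (rule gcd_greatest)
    also have "\<dots> = 4 * a * gcd (poly f (int n)) (poly f (int (n + j)))"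
      using a by (simp add: gcd_mult_left abs_mult)
    finally have "y dvd 4 * a * gcd (poly f (int n)) (poly f (int (n + j)))" .
    moreover have "gcd (poly f (int n)) (poly f (int (n + j))) dvd G"
      using Lcm_gcd_dvd_prod[OF j(1,2), of "\<lambda>i. poly f (int (n + i))"] G(3,4) by simp
    ultimately have "y dvd 4 * a * G" by (meson dvd_trans mult_dvd_mono dvd_refl)
    hence "y \<le> 4 * a * G" using G(1) a by (intro zdvd_imp_le) auto
    hence "(of_int y :: rat) \<le> of_int (4 * a * G)" by (simp only: of_int_le_iff)
    thus ?thesis unfolding G(2) y_def by simp
  qed
  obtain G where "g_fun k f n0 = of_int G"
    using t(3)[of n0] g_fun_eq_int[OF _ t(2)] by (metis order_refl)
  \<comment> \<open>So large that \<open>2 * a * (n0 + m * t) + b + a * i\<close> exceeds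
    \<open>4 * a * G\<close>.\<close>
  define m where "m = nat (4 * a * \<bar>G\<bar> + \<bar>b\<bar> + 1)"
  have "of_int (2 * a * int (n0 + m * t) + b + a * i) \<le> (of_int (4 * a * G) :: rat)"
    using lower[of "n0 + m * t"] const[of m] \<open>g_fun k f n0 = of_int G\<close> by simp
  hence *: "2 * a * int (n0 + m * t) + b + a * i \<le> 4 * a * G" by (simp only: of_int_le_iff)
  have "m * 1 \<le> m * t" using t(1) by (rule mult_le_mono2)
  hence "m \<le> n0 + m * t" by linarith
  hence "int m \<le> int (n0 + m * t)" by (simp only: of_nat_le_iff)
  also have "1 * int (n0 + m * t) \<le> 2 * a * int (n0 + m * t)" using a by (intro mult_right_mono) auto
  finally have "int m \<le> 2 * a * int (n0 + m * t)" by simp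
  moreover have "0 \<le> a * i" using a i by simp
  moreover have "4 * a * G \<le> 4 * a * \<bar>G\<bar>" using a by simp
  moreover have "0 \<le> 4 * a * \<bar>G\<bar>" using a by simp
  ultimately show False using * unfolding m_def by linarith
qed

text \<open>The product gains \<open>d ^ (k + 1)\<close> and the lcm \<open>d\<close>, so
  \<open>g_fun\<close> is multiplied by \<open>d ^ k\<close>.\<close>

lemma is_period_smult:
  assumes "d > 0"
  shows "is_period k (Polynomial.smult d f) t \<longleftrightarrow> is_period k f t"
proof -
  have Z: "zero_set k (Polynomial.smult d f) = zero_set k f"
    using assms by (simp add: zero_set_def)
  have "g_fun k (Polynomial.smult d f) n = of_int d ^ k * g_fun k f n" for n
  proof -
    have "(LCM i\<in>{0..k}. poly (Polynomial.smult d f) (int (n + i))) = d * (LCM i\<in>{0..k}. poly f (int (n + i)))"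
    proof -
      have "(\<lambda>i. poly (Polynomial.smult d f) (int (n + i))) ` {0..k} = (*) d ` (\<lambda>i. poly f (int (n + i))) ` {0..k}"
        by (simp add: image_image)
      moreover have "Lcm ((*) d ` (\<lambda>i. poly f (int (n + i))) ` {0..k}) =
          d * (LCM i\<in>{0..k}. poly f (int (n + i)))"
        using assms by (subst Lcm_mult) (auto simp: normalize_mult)
      ultimately show ?thesis by simp
    qed
    moreover have "(\<Prod>i\<in>{0..k}. \<bar>poly (Polynomial.smult d f) (int (n + i))\<bar>) =
        d * d ^ k * (\<Prod>i\<in>{0..k}. \<bar>poly f (int (n + i))\<bar>)"
      using assms by (simp add: abs_mult prod.distrib)
    ultimately show ?thesis using assms by (simp add: g_fun_def)
  qed
  thus ?thesis using assms unfolding is_period_def Z by simp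
qed

lemma nu_int:
  assumes "prime p" "x > 0"
  shows "nu p (int x) = multiplicity p x"
proof -
  have "e \<le> nu p (int x) \<longleftrightarrow> e \<le> multiplicity p x" for e
  proof -
    have "e \<le> nu p (int x) \<longleftrightarrow> int (p ^ e) dvd int x"
      using power_dvd_iff_nu[OF assms(1), of "int x" e] assms(2) by simp
    also have "\<dots> \<longleftrightarrow> e \<le> multiplicity p x"
      unfolding of_nat_dvd_iff
      by (rule power_dvd_iff_le_multiplicity) (use assms in \<open>auto simp: prime_nat_iff\<close>)
    finally show ?thesis .
  qed
  thus ?thesis by (meson order_antisym order_refl)
qed

section \<open>The denominator of \<open>A_num\<close> as a finite product\<close>

lemma denominator_factor_eq:
  assumes p: "prime p"
  shows "denominator_factor p k a b D =
    (if p = 2 then xi2 k a b D else 1) *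
    (if prime p \<and> p \<noteq> 2 \<and> int p dvd gcd a b then p ^ nu p (B_num k a D) else 1) *
    (if prime p \<and> \<not> int p dvd 2 * a * D \<and> Legendre D (int p) = -1
       then p ^ nu p (B_num k a D) else 1) *
    (if prime p \<and> \<not> int p dvd 2 * a \<and> int p dvd D then eta p k a D else 1)"
proof -
  have "int p dvd 2 * a" if "p = 2" using that by simp
  moreover have "int p dvd 2 * a" if "int p dvd gcd a b" using that by simp
  moreover have "int p dvd 2 * a * D" if "int p dvd 2 * a \<or> int p dvd D"
    using that by (blast intro: dvd_mult dvd_mult2)
  ultimately show ?thesis using p unfolding denominator_factor_def
    by (cases "p = 2"; cases "int p dvd gcd a b"; cases "int p dvd 2 * a"; cases "int p dvd D")
      (simp_all only: simp_thms if_True if_False mult_1 mult_1_right if_cancel)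
qed

lemma A_num_eq_quotient:
  assumes S: "finite S" "\<And>p. p \<in> S \<Longrightarrow> prime p" "\<And>p. prime p \<Longrightarrow> p \<notin> S \<Longrightarrow> denominator_factor p k a b D = 1"
    and two: "2 \<in> S"
  shows "A_num k a b D = of_int (B_num k a D) / of_nat (\<Prod>p\<in>S. denominator_factor p k a b D)"
proof -
  define f0 where "f0 = (\<lambda>p::nat. if p = 2 then xi2 k a b D else 1)"
  define f1 where "f1 = (\<lambda>p::nat. if prime p \<and> p \<noteq> 2 \<and> int p dvd gcd a b
    then p ^ nu p (B_num k a D) else 1)"
  define f2 where "f2 = (\<lambda>p::nat. if prime p \<and> \<not> int p dvd 2 * a * D \<and> Legendre D (int p) = -1
    then p ^ nu p (B_num k a D) else 1)"
  define f3 where "f3 = (\<lambda>p::nat. if prime p \<and> \<not> int p dvd 2 * a \<and> int p dvd D then eta p k a D else 1)"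
  have denominator_factor: "denominator_factor p k a b D = f0 p * f1 p * f2 p * f3 p" if "prime p" for p
    using denominator_factor_eq[OF that] unfolding f0_def f1_def f2_def f3_def .
  have "f1 p = 1 \<and> f2 p = 1 \<and> f3 p = 1" if "p \<notin> S" for p
  proof (cases "prime p")
    case True
    \<comment> \<open>A product of natural numbers is 1 only if each factor is.\<close>
    have "f0 p * f1 p * f2 p * f3 p = 1" using denominator_factor[OF True] S(3)[OF True that] by simp
    thus ?thesis by (simp only: nat_mult_eq_1_iff)
  qed (simp add: f1_def f2_def f3_def)
  hence "{p. f1 p \<noteq> 1} \<subseteq> S" "{p. f2 p \<noteq> 1} \<subseteq> S" "{p. f3 p \<noteq> 1} \<subseteq> S" by blast+
  hence P: "Prod_any f1 = prod f1 S" "Prod_any f2 = prod f2 S" "Prod_any f3 = prod f3 S"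
    using Prod_any.expand_superset[OF S(1)] by blast+
  have "prod f0 S = xi2 k a b D"
    unfolding f0_def by (subst prod.delta[OF S(1)]) (use two in simp)
  hence "xi2 k a b D * Prod_any f1 * Prod_any f2 * Prod_any f3 = (\<Prod>p\<in>S. f0 p * f1 p * f2 p * f3 p)"
    unfolding P by (simp only: prod.distrib)
  also have "\<dots> = (\<Prod>p\<in>S. denominator_factor p k a b D)"
    by (rule prod.cong[OF refl], rule denominator_factor[symmetric], rule S(2))
  finally show ?thesis
    unfolding A_num_def f1_def f2_def f3_def by (simp only:)
qed

section \<open>Periods of primitive polynomials\<close>

locale primitive_quadratic =
  fixes a b c :: int and k :: nat
  assumes a_pos: "a \<ge> 1" and k_pos: "k \<ge> 1" and primitive: "gcd a (gcd b c) = 1"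
    and D_ne: "\<And>i. 1 \<le> i \<Longrightarrow> i \<le> int k \<Longrightarrow> b\<^sup>2 - 4 * a * c \<noteq> a\<^sup>2 * i\<^sup>2"
begin

abbreviation "f \<equiv> [:c, b, a:]"
abbreviation "\<Delta> \<equiv> b\<^sup>2 - 4 * a * c"
abbreviation "B \<equiv> B_num k a \<Delta>"

text \<open>The valuation of \<open>g_fun\<close> at \<open>p\<close>, extended to all integers,
  where it is periodic outright and not only eventually.\<close>

definition h :: "nat \<Rightarrow> int \<Rightarrow> nat" where
  "h p = total_excess k (\<lambda>e. {z. int p ^ e dvd poly f z}) (nu p B)"

lemma local_data:
  assumes "prime p"
  shows "local_data p a b c k" "quad.D a b c = \<Delta>"
    "quad.R (int p) a b c = (\<lambda>e. {z. int p ^ e dvd poly f z})"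
proof -
  interpret quad "int p" a b c k by standard (use assms in simp)
  show "quad.D a b c = \<Delta>" by (rule D_def)
  show "quad.R (int p) a b c = (\<lambda>e. {z. int p ^ e dvd poly f z})"
    by (rule ext) (simp add: R_def F_def power2_eq_square algebra_simps)
  show "local_data p a b c k"
    by standard (use k_pos primitive D_ne D_def in auto)
qed

text \<open>One choice of the local exponents for all primes; they are the valuations of
  \<open>A_num\<close>, see \<open>nu_rat_A_num\<close>.\<close>

definition \<alpha> :: "nat \<Rightarrow> nat" where
  "\<alpha> = (SOME \<alpha>. \<forall>p. prime p \<longrightarrow> denominator_factor p k a b \<Delta> * p ^ \<alpha> p = p ^ nu p B \<and>
     has_exponent (int p) (h p)
       (if exceptional_type p a b \<Delta> \<and> \<alpha> p \<le> nu p (int k + 1) then 0 else \<alpha> p))"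

definition \<epsilon> :: "nat \<Rightarrow> nat" where
  "\<epsilon> p = (if exceptional_type p a b \<Delta> \<and> \<alpha> p \<le> nu p (int k + 1) then 0 else \<alpha> p)"

lemma alpha:
  assumes "prime p"
  shows "denominator_factor p k a b \<Delta> * p ^ \<alpha> p = p ^ nu p B" "has_exponent (int p) (h p) (\<epsilon> p)"
proof -
  have "\<exists>\<alpha>. \<forall>p. prime p \<longrightarrow> denominator_factor p k a b \<Delta> * p ^ \<alpha> p = p ^ nu p B \<and>
     has_exponent (int p) (h p)
       (if exceptional_type p a b \<Delta> \<and> \<alpha> p \<le> nu p (int k + 1) then 0 else \<alpha> p)"
  proof (rule choice, rule allI)
    fix p :: nat
    show "\<exists>\<alpha>. prime p \<longrightarrow> denominator_factor p k a b \<Delta> * p ^ \<alpha> = p ^ nu p B \<and>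
      has_exponent (int p) (h p)
        (if exceptional_type p a b \<Delta> \<and> \<alpha> \<le> nu p (int k + 1) then 0 else \<alpha>)"
    proof (cases "prime p")
      case True
      show ?thesis
        using local_data.local_exponent[OF local_data(1)[OF True]]
        unfolding local_data(2,3)[OF True] h_def by blast
    qed simp
  qed
  from someI_ex[OF this, folded \<alpha>_def] assms
  show "denominator_factor p k a b \<Delta> * p ^ \<alpha> p = p ^ nu p B" "has_exponent (int p) (h p) (\<epsilon> p)"
    unfolding \<epsilon>_def by blast+
qed

lemma B_pos: "B > 0"
proof -
  have "B \<noteq> 0"
    using local_data.B_nonzero[OF local_data(1)[OF two_is_prime_nat]]
    unfolding local_data(2)[OF two_is_prime_nat] .
  moreover have "B \<ge> 0" by (simp add: B_num_def)
  ultimately show ?thesis by simp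
qed

lemma multiplicity_g_fun:
  assumes "n \<notin> zero_set k f" "n \<ge> 1"
  obtains G where "G > 0" "g_fun k f n = of_int G"
    "\<And>p. prime p \<Longrightarrow> nu p G = h p (int n)"
proof -
  obtain G where G: "G > 0" "g_fun k f n = of_int G"
    "(\<Prod>i\<in>{0..k}. \<bar>poly f (int (n + i))\<bar>) = (LCM i\<in>{0..k}. poly f (int (n + i))) * G"
    "(LCM i\<in>{0..k}. poly f (int (n + i))) > 0"
    using g_fun_eq_int[OF assms] by blast
  have "nu p G = h p (int n)" if pr: "prime p" for p
  proof -
    interpret local_data p a b c k by (rule local_data(1)[OF pr])
    have "nu p (\<Prod>i\<in>{0..k}. \<bar>poly f (int n + int i)\<bar>) =
        nu p (LCM i\<in>{0..k}. poly f (int n + int i)) + h p (int n)"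
      unfolding h_def
    proof (rule multiplicity_prod_Lcm[where x = "poly f"])
      fix i assume "i \<le> k"
      thus "poly f (int n + int i) \<noteq> 0" using assms by (force simp: zero_set_def)
    next
      fix e assume "nu p B < e"
      hence "\<not> BB e" using BB_iff[of e] unfolding local_data(2)[OF pr] by simp
      hence "\<not> close k (R e)" using close_BB by blast
      from excess_not_close[OF this] show "excess k {z. int p ^ e dvd poly f z} (int n) = 0"
        using fun_cong[OF local_data(3)[OF pr], of e] by simp
    qed (use pr in simp)
    moreover have "nu p ((LCM i\<in>{0..k}. poly f (int (n + i))) * G) =
        nu p (LCM i\<in>{0..k}. poly f (int (n + i))) + nu p G"
      by (rule prime_elem_multiplicity_mult_distrib) (use pr G in auto)
    ultimately show ?thesis using G(3) by (simp only: of_nat_add)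
  qed
  thus thesis using that G by blast
qed

lemma g_fun_eq_iff:
  assumes "n \<notin> zero_set k f" "n \<ge> 1" "m \<notin> zero_set k f" "m \<ge> 1"
  shows "g_fun k f m = g_fun k f n \<longleftrightarrow> (\<forall>p. prime p \<longrightarrow> h p (int m) = h p (int n))"
proof -
  obtain G1 where G1: "G1 > 0" "g_fun k f n = of_int G1"
    "\<And>p. prime p \<Longrightarrow> nu p G1 = h p (int n)" using multiplicity_g_fun[OF assms(1,2)] by blast
  obtain G2 where G2: "G2 > 0" "g_fun k f m = of_int G2"
    "\<And>p. prime p \<Longrightarrow> nu p G2 = h p (int m)" using multiplicity_g_fun[OF assms(3,4)] by blast
  have "G2 = G1" if eq: "\<forall>p. prime p \<longrightarrow> h p (int m) = h p (int n)"
  proof (rule multiplicity_eq_int[OF G2(1) G1(1)])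
    fix p :: int assume p: "prime p"
    obtain q where q: "p = int q" using prime_ge_0_int[OF p] by (elim nonneg_int_cases)
    hence "prime q" using p by simp
    with q show "multiplicity p G2 = multiplicity p G1" using G1(3) G2(3) eq by simp
  qed
  thus ?thesis using G1 G2 by auto
qed

text \<open>The valuations determine \<open>g_fun\<close>, and an eventual period of the periodic
  function \<open>h p\<close> is a period of it.\<close>

lemma is_period_iff:
  "is_period k f t \<longleftrightarrow> t \<ge> 1 \<and> (\<forall>p. prime p \<longrightarrow> p ^ \<epsilon> p dvd t)"
proof -
  define n1 where "n1 = nat (\<bar>b\<bar> + \<bar>c\<bar> + 1)"
  have n1: "n \<notin> zero_set k f" "n \<ge> 1" if "n \<ge> n1" for n
    using that not_in_zero_set[OF a_pos, of b c n k] by (simp_all add: n1_def nat_le_iff)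
  have per: "periodic (h p) (int t) \<longleftrightarrow> p ^ \<epsilon> p dvd t" if "prime p" for p
    using alpha(2)[OF that] unfolding has_exponent_def by (simp flip: of_nat_power)
  show ?thesis
  proof
    assume "is_period k f t"
    then obtain n0 where t: "t \<ge> 1" "n0 \<ge> 1" and eq: "\<And>n. n \<ge> n0 \<Longrightarrow>
        n \<notin> zero_set k f \<and> n + t \<notin> zero_set k f \<and> g_fun k f (n + t) = g_fun k f n"
      unfolding is_period_def by auto
    have "p ^ \<epsilon> p dvd t" if p: "prime p" for p
      unfolding per[OF p, symmetric]
    proof (rule periodic_eventually[where ?n0.0 = "int n0" and q = "int p ^ \<epsilon> p"])
      fix n assume n: "n \<ge> int n0"
      define m where "m = nat n"
      have m: "m \<ge> n0" "n = int m" using n by (auto simp: m_def)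
      from eq[OF m(1)] have "\<forall>p. prime p \<longrightarrow> h p (int (m + t)) = h p (int m)"
        using g_fun_eq_iff[of m "m + t"] m t by simp
      thus "h p (n + int t) = h p n" using p m by simp
    qed (use alpha(2)[OF p] p prime_gt_0_nat in \<open>auto simp: has_exponent_def\<close>)
    thus "t \<ge> 1 \<and> (\<forall>p. prime p \<longrightarrow> p ^ \<epsilon> p dvd t)" using t by blast
  next
    assume *: "t \<ge> 1 \<and> (\<forall>p. prime p \<longrightarrow> p ^ \<epsilon> p dvd t)"
    have "g_fun k f (n + t) = g_fun k f n" if "n \<ge> n1" for n
    proof -
      have "h p (int (n + t)) = h p (int n)" if p: "prime p" for p
        using periodicD[of "h p" "int t" "int n"] * per[OF p] p by simp
      thus ?thesis using g_fun_eq_iff[of n "n + t"] n1[OF that] n1[of "n + t"] that by simp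
    qed
    thus "is_period k f t" unfolding is_period_def
      using * n1 by (intro conjI exI[of _ n1]) (auto simp: n1_def)
  qed
qed

text \<open>Outside \<open>S\<close> all exponents vanish; 2 is included since \<open>xi2\<close>
  occurs in the denominator in any case.\<close>

definition S :: "nat set" where "S = insert 2 (prime_factors (nat B))"

lemma finite_S: "finite S"
  by (simp add: S_def)

lemma prime_S: "p \<in> S \<Longrightarrow> prime p"
  by (auto simp: S_def)

lemma nu_B_notin: "prime p \<Longrightarrow> p \<notin> S \<Longrightarrow> nu p B = 0"
  using nu_int[of p "nat B"] B_pos by (auto simp: S_def in_prime_factors_iff not_dvd_imp_multiplicity_0)

lemma notin_S: "prime p \<Longrightarrow> p \<notin> S \<Longrightarrow> denominator_factor p k a b \<Delta> = 1" "prime p \<Longrightarrow> p \<notin> S \<Longrightarrow> \<alpha> p = 0"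
  using alpha(1)[of p] nu_B_notin[of p] prime_gt_1_nat[of p] by (auto simp: nat_mult_eq_1_iff)

lemma B_eq: "B = int (\<Prod>p\<in>S. p ^ nu p B)"
proof -
  have "nat B = (\<Prod>p\<in>S. p ^ nu p B)"
  proof (rule multiplicity_eq_nat)
    show "(\<Prod>p\<in>S. p ^ nu p B) > 0" using prime_S prime_gt_0_nat by (intro prod_pos) auto
    fix p :: nat assume p: "prime p"
    show "multiplicity p (nat B) = multiplicity p (\<Prod>p\<in>S. p ^ nu p B)"
      using nu_B_notin[OF p] nu_int[OF p, of "nat B"] B_pos
      by (subst multiplicity_prod_prime_powers) (use finite_S prime_S p in auto)
  qed (use B_pos in simp)
  hence "int (nat B) = int (\<Prod>p\<in>S. p ^ nu p B)" by (rule arg_cong)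
  moreover have "int (nat B) = B" using B_pos by simp
  ultimately show ?thesis by (simp only:)
qed

lemma A_num_eq: "A_num k a b \<Delta> = of_nat (\<Prod>p\<in>S. p ^ \<alpha> p)"
proof -
  have "(\<Prod>p\<in>S. denominator_factor p k a b \<Delta>) * (\<Prod>p\<in>S. p ^ \<alpha> p) = (\<Prod>p\<in>S. p ^ nu p B)"
    unfolding prod.distrib[symmetric] by (rule prod.cong[OF refl]) (rule alpha(1)[OF prime_S])
  hence eq: "of_nat (\<Prod>p\<in>S. denominator_factor p k a b \<Delta>) * of_nat (\<Prod>p\<in>S. p ^ \<alpha> p) = (of_int B :: rat)"
    by (subst B_eq) (simp only: of_int_of_nat_eq of_nat_mult[symmetric])
  have "2 \<in> S" by (simp add: S_def)
  have A: "A_num k a b \<Delta> = of_int B / of_nat (\<Prod>p\<in>S. denominator_factor p k a b \<Delta>)"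
    by (rule A_num_eq_quotient) (fact finite_S prime_S notin_S \<open>2 \<in> S\<close>)+
  have "(of_nat (\<Prod>p\<in>S. denominator_factor p k a b \<Delta>) :: rat) \<noteq> 0" using B_pos eq by auto
  thus ?thesis unfolding A eq[symmetric] by (rule nonzero_mult_div_cancel_left)
qed

lemma nu_rat_A_num:
  assumes p: "prime p"
  shows "nu_rat p (A_num k a b \<Delta>) = int (\<alpha> p)"
proof -
  have pos: "(\<Prod>p\<in>S. p ^ \<alpha> p) > 0" using prime_S prime_gt_0_nat by (intro prod_pos) auto
  have "quotient_of (A_num k a b \<Delta>) = (int (\<Prod>p\<in>S. p ^ \<alpha> p), 1)"
    unfolding A_num_eq using quotient_of_int[of "int (\<Prod>p\<in>S. p ^ \<alpha> p)"]
    by (simp only: Rat.of_int_def of_int_of_nat_eq)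
  hence "nu_rat p (A_num k a b \<Delta>) = int (multiplicity p (\<Prod>p\<in>S. p ^ \<alpha> p))"
    using nu_int[OF p pos] by (simp add: nu_rat_def)
  also have "multiplicity p (\<Prod>p\<in>S. p ^ \<alpha> p) = \<alpha> p"
    using notin_S(2)[OF p] by (subst multiplicity_prod_prime_powers) (use finite_S prime_S p in auto)
  finally show ?thesis .
qed

lemma exceptional_primes_eq:
  "exceptional_primes k a b \<Delta> =
     {p. prime p \<and> exceptional_type p a b \<Delta> \<and> 1 \<le> \<alpha> p \<and> \<alpha> p \<le> nu p (int k + 1)}"
  unfolding exceptional_primes_def exceptional_type_def using nu_rat_A_num by auto

lemma epsilon_eq: "prime p \<Longrightarrow> \<epsilon> p = (if p \<in> exceptional_primes k a b \<Delta> then 0 else \<alpha> p)"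
  by (auto simp: \<epsilon>_def exceptional_primes_eq)

text \<open>At an exceptional prime the denominator has factor 1, so \<open>\<alpha> p\<close> is
  the full valuation of \<open>B\<close>, which is at least that of \<open>L_num k\<close>; this
  bounds \<open>k\<close>.\<close>

lemma exceptional_bound:
  assumes "p \<in> exceptional_primes k a b \<Delta>"
  shows "prime p" "p dvd p ^ \<alpha> p" "p ^ \<alpha> p dvd k + 1" "k < p ^ \<alpha> p * p"
proof -
  show pr: "prime p" using assms by (simp add: exceptional_primes_eq)
  interpret local_data p a b c k by (rule local_data(1)[OF pr])
  have "\<alpha> p = nu p B"
    using alpha(1)[OF pr] denominator_factor_exceptional assms prime_gt_1_nat[OF pr]
    unfolding local_data(2)[OF pr] by (auto simp: exceptional_primes_eq power_inject_exp)
  hence "vL \<le> \<alpha> p" using vL_le_vB unfolding local_data(2)[OF pr] by simp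
  hence "p ^ Suc vL \<le> p ^ Suc (\<alpha> p)" using p_pos by (intro power_increasing) auto
  moreover have "k < p ^ Suc vL" using vL(2) by (metis of_nat_less_iff of_nat_power)
  ultimately have "k < p ^ Suc (\<alpha> p)" by linarith
  thus "k < p ^ \<alpha> p * p" by (simp only: power_Suc2)
  have "int p ^ \<alpha> p dvd int k + 1" unfolding le_vk_iff using assms by (simp add: exceptional_primes_eq)
  also have "int k + 1 = int (k + 1)" by simp
  finally show "p ^ \<alpha> p dvd k + 1" by (simp only: of_nat_power[symmetric] of_nat_dvd_iff)
  show "p dvd p ^ \<alpha> p" using assms by (intro dvd_power) (auto simp: exceptional_primes_eq)
qed

text \<open>For \<open>p < q\<close> the coprime powers \<open>p ^ \<alpha> p\<close> and
  \<open>q ^ \<alpha> q\<close> divide \<open>k + 1\<close>, so \<open>k + 1\<close> is at least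
  \<open>p ^ \<alpha> p * (p + 1)\<close>, against \<open>k < p ^ \<alpha> p * p\<close>.\<close>

lemma exceptional_not_less:
  assumes p: "p \<in> exceptional_primes k a b \<Delta>" and q: "q \<in> exceptional_primes k a b \<Delta>"
  shows "\<not> p < q"
proof
  assume "p < q"
  note P = exceptional_bound[OF p] and Q = exceptional_bound[OF q]
  have pos: "p ^ \<alpha> p > 0" "q ^ \<alpha> q > 0" using P(1) Q(1) prime_gt_0_nat by auto
  have "coprime (p ^ \<alpha> p) (q ^ \<alpha> q)" using P(1) Q(1) \<open>p < q\<close> by (simp add: primes_coprime)
  hence "p ^ \<alpha> p * q ^ \<alpha> q dvd k + 1" using P(3) Q(3) by (rule divides_mult[rotated 2])
  hence "p ^ \<alpha> p * q ^ \<alpha> q \<le> k + 1" by (rule dvd_imp_le) simp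
  moreover have "q \<le> q ^ \<alpha> q" using Q(2) pos(2) by (rule dvd_imp_le)
  hence "p ^ \<alpha> p * (p + 1) \<le> p ^ \<alpha> p * q ^ \<alpha> q" using \<open>p < q\<close> by (intro mult_left_mono) auto
  ultimately have "p ^ \<alpha> p * p + p ^ \<alpha> p \<le> k + 1" by (simp add: algebra_simps)
  thus False using P(4) pos(1) by linarith
qed

lemma exceptional_unique:
  "p \<in> exceptional_primes k a b \<Delta> \<Longrightarrow> q \<in> exceptional_primes k a b \<Delta> \<Longrightarrow> p = q"
  using exceptional_not_less by (meson linorder_neqE_nat)

lemma smallest_period_eq:
  "eventually_periodic k f" "smallest_period k f = (\<Prod>p\<in>S. p ^ \<epsilon> p)"
proof -
  define Q where "Q = (\<Prod>p\<in>S. p ^ \<epsilon> p)"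
  have Q: "Q > 0" unfolding Q_def using prime_S prime_gt_0_nat by (intro prod_pos) auto
  have ex0: "\<epsilon> p = 0" if "prime p" "p \<notin> S" for p using notin_S(2)[OF that] by (simp add: \<epsilon>_def)
  have "p ^ \<epsilon> p dvd Q" if "prime p" for p
  proof (cases "p \<in> S")
    case True
    thus ?thesis unfolding Q_def by (rule dvd_prodI[OF finite_S])
  qed (use ex0 that in simp)
  hence "is_period k f Q" using Q by (simp add: is_period_iff)
  moreover have "Q \<le> t" if t: "is_period k f t" for t
  proof -
    have "Q dvd t"
    proof (rule multiplicity_le_imp_dvd)
      fix p :: nat assume p: "prime p"
      have "\<epsilon> p \<le> multiplicity p t"
        using t p by (subst power_dvd_iff_le_multiplicity[symmetric])
          (auto simp: is_period_iff prime_nat_iff)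
      thus "multiplicity p Q \<le> multiplicity p t" unfolding Q_def
        by (subst multiplicity_prod_prime_powers) (use finite_S prime_S p in auto)
    qed (use Q in simp)
    thus ?thesis using t by (auto simp: is_period_def intro: dvd_imp_le)
  qed
  ultimately show "eventually_periodic k f" "smallest_period k f = (\<Prod>p\<in>S. p ^ \<epsilon> p)"
    unfolding eventually_periodic_def smallest_period_def Q_def[symmetric]
    by (blast, blast intro: Least_equality)
qed

lemma smallest_period_nonexceptional:
  assumes "exceptional_primes k a b \<Delta> = {}"
  shows "of_nat (smallest_period k f) = A_num k a b \<Delta>"
  unfolding smallest_period_eq(2) A_num_eq using epsilon_eq[OF prime_S] assms by simp

lemma smallest_period_exceptional:
  assumes q: "q \<in> exceptional_primes k a b \<Delta>"
  shows "of_nat (smallest_period k f) = A_num k a b \<Delta> / of_nat q powi nu_rat q (A_num k a b \<Delta>)"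
proof -
  have pq: "prime q" using q by (simp add: exceptional_primes_eq)
  have "q \<in> S" using notin_S(2)[OF pq] q by (auto simp: exceptional_primes_eq)
  have "(\<Prod>p\<in>S. p ^ \<alpha> p) = q ^ \<alpha> q * (\<Prod>p\<in>S - {q}. p ^ \<alpha> p)"
    by (rule prod.remove[OF finite_S \<open>q \<in> S\<close>])
  \<comment> \<open>By \<open>exceptional_unique\<close> only \<open>q\<close> loses its
    factor.\<close>
  also have "(\<Prod>p\<in>S - {q}. p ^ \<alpha> p) = (\<Prod>p\<in>S - {q}. p ^ \<epsilon> p)"
    using exceptional_unique[OF q] by (intro prod.cong) (auto simp: epsilon_eq[OF prime_S])
  also have "\<dots> = (\<Prod>p\<in>S. p ^ \<epsilon> p)"
    using epsilon_eq[OF pq] q by (subst prod.remove[OF finite_S \<open>q \<in> S\<close>]) simp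
  finally have "(\<Prod>p\<in>S. p ^ \<alpha> p) = q ^ \<alpha> q * smallest_period k f" by (simp only: smallest_period_eq(2))
  thus ?thesis unfolding nu_rat_A_num[OF pq] unfolding A_num_eq
    using prime_gt_0_nat[OF pq] by simp
qed

end

section \<open>Reduction to primitive polynomials\<close>

theorem theorem1p2:
  fixes a b c D :: int and k :: nat and f :: "int poly"
  assumes "a \<ge> 1" and "k \<ge> 1"
    and "f = [:c, b, a:]" and "D = b\<^sup>2 - 4 * a * c"
  shows "(eventually_periodic k f \<longleftrightarrow> (\<forall>i::int. 1 \<le> i \<and> i \<le> int k \<longrightarrow> D \<noteq> a\<^sup>2 * i\<^sup>2)) \<and>
    (eventually_periodic k f \<longrightarrow>
      (let d = gcd a (gcd b c);
           a' = a div d; b' = b div d; D' = D div d\<^sup>2;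
           A = A_num k a' b' D'; E = exceptional_primes k a' b' D'
       in (\<forall>p\<in>E. \<forall>q\<in>E. p = q) \<and>
          (E = {} \<longrightarrow> of_nat (smallest_period k f) = A) \<and>
          (\<forall>p\<in>E. of_nat (smallest_period k f) = A / of_nat p powi nu_rat p A)))"
proof (cases "\<forall>i::int. 1 \<le> i \<and> i \<le> int k \<longrightarrow> D \<noteq> a\<^sup>2 * i\<^sup>2")
  case False
  then obtain i where "1 \<le> i" "i \<le> int k" "D = a\<^sup>2 * i\<^sup>2" by blast
  thus ?thesis using not_periodic[OF assms(1), of i k b c] False assms(3,4) by auto
next
  case True
  define d where "d = gcd a (gcd b c)"
  define a' where "a' = a div d"
  define b' where "b' = b div d"
  define c' where "c' = c div d"
  have "a \<noteq> 0" using assms(1) by simp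
  hence d: "d > 0" unfolding d_def by (simp add: zero_less_iff_neq_zero order_less_le)
  have dvd: "d dvd a" "d dvd b" "d dvd c" by (simp_all add: d_def gcd_dvdI2)
  hence eqs: "a = d * a'" "b = d * b'" "c = d * c'" by (simp_all add: a'_def b'_def c'_def)
  \<comment> \<open>Dividing the coefficients by \<open>d\<close> divides the discriminant by
    \<open>d\<^sup>2\<close>, so \<open>D \<noteq> a\<^sup>2 * i\<^sup>2\<close> carries
    over.\<close>
  have D: "D = d\<^sup>2 * (b'\<^sup>2 - 4 * a' * c')"
    unfolding assms(4) by (simp add: eqs power2_eq_square algebra_simps)
  have D': "D div d\<^sup>2 = b'\<^sup>2 - 4 * a' * c'" unfolding D using d by simp
  interpret pq: primitive_quadratic a' b' c' k
  proof
    show "a' \<ge> 1" using assms(1) d eqs(1) by (metis int_one_le_iff_zero_less zero_less_mult_pos)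
    have "d * gcd a' (gcd b' c') = gcd (d * a') (gcd (d * b') (d * c'))"
      using d by (simp add: gcd_mult_left abs_mult)
    hence "d * gcd a' (gcd b' c') = d * 1" unfolding eqs[symmetric] by (simp add: d_def)
    thus "gcd a' (gcd b' c') = 1" using d by simp
    fix i assume "1 \<le> i" "i \<le> int k"
    hence "D \<noteq> a\<^sup>2 * i\<^sup>2" using True by blast
    thus "b'\<^sup>2 - 4 * a' * c' \<noteq> a'\<^sup>2 * i\<^sup>2" unfolding D eqs(1) by (auto simp: power_mult_distrib)
  qed (fact assms(2))
  have f: "f = Polynomial.smult d [:c', b', a':]" unfolding assms(3) by (simp add: eqs)
  have per: "is_period k f = is_period k [:c', b', a':]"
    unfolding f by (rule ext, rule is_period_smult[OF d])
  have sp: "smallest_period k f = smallest_period k [:c', b', a':]"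
    by (simp add: smallest_period_def per)
  have "eventually_periodic k f"
    using pq.smallest_period_eq(1) by (simp add: eventually_periodic_def per)
  moreover have "(let d = gcd a (gcd b c);
           a' = a div d; b' = b div d; D' = D div d\<^sup>2;
           A = A_num k a' b' D'; E = exceptional_primes k a' b' D'
       in (\<forall>p\<in>E. \<forall>q\<in>E. p = q) \<and>
          (E = {} \<longrightarrow> of_nat (smallest_period k f) = A) \<and>
          (\<forall>p\<in>E. of_nat (smallest_period k f) = A / of_nat p powi nu_rat p A))"
    unfolding Let_def d_def[symmetric] a'_def[symmetric] b'_def[symmetric] D' sp
    using pq.exceptional_unique pq.smallest_period_nonexceptional pq.smallest_period_exceptional
    by blast
  ultimately show ?thesis using True by blast
qed

end
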